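(* Let $\mathbb{K}$ be an algebraically closed field of characteristic zero, let $a,b,c$ be positive integers with $\gcd(a,b,c)=1$, and let $\Gamma$ be the $\mathbb{Z}$-grading on $\mathcal{A}=\mathbb{K}[x,y,z]$ in which $x,y,z$ are homogeneous of degrees $(a,b,-c)$. Assume that $\Gamma$ admits graded wild automorphisms (with $x,y$ labelled so that $a>b$). Let $\mathrm{E}$, $\alpha$, $D$, $U$, $W$ be as defined in the context, and for all $\tau\in W$, $\theta\in D$ let $\tau_\theta=s_{\tau,\theta}\circ\tau^{-1}$, where $s_{\tau,\theta}\in W$ is a fixed automorphism such that $s_{\tau,\theta}\circ\tau^{-1}\circ\theta\circ\tau\in\alpha(\mathrm{E})$. Then the group $\mathrm{Aut}_{\Gamma}(\mathcal{A})$ is generated by the following automorphisms: the automorphisms in $\alpha^{-1}(U)$; the automorphisms $\alpha^{-1}(\tau_\theta\circ\theta\circ\tau)$ with $\tau\in W$, $\theta\in D$; and the automorphisms in the group $\mathrm{T}=\{(x,y,\lambda z)\mid \lambda\in\mathbb{K},\ \lambda\neq 0\}$.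
   Context: A tuple $(f_1,\dots,f_n)$ of polynomials denotes the endomorphism of the polynomial algebra sending the $i$-th variable to $f_i$, identified with the polynomial map $(x_1,\dots,x_n)\mapsto(f_1,\dots,f_n)$; composition is composition of polynomial maps, i.e. $(\varphi\circ\psi)(p)=\varphi(\psi(p))$ on points $p$. For a grading of a polynomial algebra $\mathcal{B}$ by an abelian group $G$, an automorphism $\varphi$ is graded if $\varphi(\mathcal{B}_g)\subset\mathcal{B}_g$ for every $g\in G$. $\mathrm{Aut}_{\Gamma}(\mathcal{A})$ is the group of $\Gamma$-graded automorphisms of $\mathcal{A}$. An elementary automorphism is one of the form $(x_1,\dots,x_{i-1},\lambda x_i+F,x_{i+1},\dots,x_n)$ with $\lambda\in\mathbb{K}^\times$ and $F$ a polynomial not involving $x_i$. A graded automorphism is graded-tame if it is a composition of graded elementary automorphisms, and graded wild otherwise; $\Gamma$ admits graded wild automorphisms if at least one $\Gamma$-graded automorphism is graded wild. (It is known that, with $x,y$ suitably labelled, this holds if and only if there are natural numbers $P$ and $Q\geq 2$ with $a=cP+bQ$; in particular $a>b$.) $\mathrm{E}=\{\varphi\in\mathrm{Aut}_{\Gamma}(\mathcal{A})\mid \varphi(z)=z\}$. The homomorphism $\alpha:\mathrm{E}\to\mathrm{Aut}(\mathbb{K}[u,v])$ is given by $\alpha(f,g,z)=(f(u,v,1),g(u,v,1))$; it is known to be injective. $\widetilde{\Gamma}$ is the grading of $\mathbb{K}[u,v]$ by $\mathbb{Z}_c=\mathbb{Z}/c\mathbb{Z}$ with $\deg u=\overline{a}$,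 $\deg v=\overline{b}$ (residues mod $c$). For a one-variable polynomial $f$, $\underline{\deg}(f)$ is the smallest degree of a monomial occurring in $f$. Conditions on degrees of $f$ are regarded as satisfied when $f=0$. The sets of $\widetilde{\Gamma}$-graded automorphisms of $\mathbb{K}[u,v]$ are: $D=\{(u,\lambda v+\mu u^k)\mid \lambda\in\mathbb{K}^\times,\ \mu\in\mathbb{K},\ k\geq 1,\ \text{and } \mu=0 \text{ or } ka\equiv b\ (\mathrm{mod}\ c)\}$; $U=\{(\lambda u+f(v),v)\mid \lambda\in\mathbb{K}^\times,\ f \text{ is } \widetilde{\Gamma}\text{-homogeneous of degree } \overline{a},\ \underline{\deg}(f)\geq a/b\}$; $W=\{(\lambda u+f(v),v)\mid \lambda\in\mathbb{K}^\times,\ f \text{ is } \widetilde{\Gamma}\text{-homogeneous of degree } \overline{a},\ \underline{\deg}(f)>1,\ \deg(f)<a/b\}$. For every $\tau\in W$, $\theta\in D$ an automorphism $s_{\tau,\theta}\in W$ with $s_{\tau,\theta}\circ\tau^{-1}\circ\theta\circ\tau\in\alpha(\mathrm{E})$ exists; one such $s_{\tau,\theta}$ is fixed for each pair $(\tau,\theta)$. *)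

theory Defs
  imports
    "HOL-Library.Poly_Mapping"
    "HOL-Computational_Algebra.Polynomial"
    "HOL-Number_Theory.Cong"
    "HOL-Algebra.Generated_Groups"
begin

section \<open>Polynomial algebras and polynomial endomorphisms\<close>

text \<open>
  The polynomial algebra over \<open>'k\<close> with set of variables \<open>'v\<close> is the monoid algebra of the
  monomials (finitely supported exponent vectors).  A tuple of polynomials indexed by the variables
  stands both for the algebra endomorphism sending the variable \<open>v\<close> to \<open>\<phi> v\<close> and for the
  corresponding polynomial map.
\<close>

type_synonym ('v, 'k) mpol = "('v \<Rightarrow>\<^sub>0 nat) \<Rightarrow>\<^sub>0 'k"
type_synonym ('v, 'k) endo = "'v \<Rightarrow> ('v, 'k) mpol"

definition Const :: "'k::field \<Rightarrow> ('v, 'k) mpol"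
  where "Const c = Poly_Mapping.single 0 c"

definition Var :: "'v \<Rightarrow> ('v, 'k::field) mpol"
  where "Var v = Poly_Mapping.single (Poly_Mapping.single v 1) 1"

definition psubst :: "('v \<Rightarrow> ('w, 'k::field) mpol) \<Rightarrow> ('v, 'k) mpol \<Rightarrow> ('w, 'k) mpol"
  where "psubst \<sigma> p =
    (\<Sum>m\<in>Poly_Mapping.keys p. Const (Poly_Mapping.lookup p m) * (\<Prod>v\<in>Poly_Mapping.keys m. \<sigma> v ^ Poly_Mapping.lookup m v))"

text \<open>
  Composition of polynomial maps, so that \<open>\<psi>\<close> is applied to points first.  On the level of algebra
  endomorphisms the order is reversed.
\<close>

definition endo_comp :: "('v, 'k::field) endo \<Rightarrow> ('v, 'k) endo \<Rightarrow> ('v, 'k) endo"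
    (infixl \<open>\<circ>\<^sub>e\<close> 55)
  where "\<phi> \<circ>\<^sub>e \<psi> = (\<lambda>v. psubst \<psi> (\<phi> v))"

definition poly_End :: "('v, 'k::field) endo monoid"
  where "poly_End = \<lparr>carrier = UNIV, mult = (\<circ>\<^sub>e), one = Var\<rparr>"

definition poly_Aut :: "('v, 'k::field) endo monoid"
  where "poly_Aut = units_of poly_End"


section \<open>Gradings and graded automorphisms\<close>

text \<open>
  A grading in which all variables are homogeneous is given by the degree \<open>d m\<close> of each monomial
  \<open>m\<close>.  Degrees in \<open>\<int>/c\<int>\<close> are represented by their residues in \<open>{0..<c}\<close>.
\<close>

type_synonym 'v grading = "('v \<Rightarrow>\<^sub>0 nat) \<Rightarrow> int"

definition wdeg :: "('v \<Rightarrow> int) \<Rightarrow> 'v grading"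
  where "wdeg w m = (\<Sum>v\<in>Poly_Mapping.keys m. int (Poly_Mapping.lookup m v) * w v)"

definition wdeg_mod :: "nat \<Rightarrow> ('v \<Rightarrow> int) \<Rightarrow> 'v grading"
  where "wdeg_mod c w m = wdeg w m mod int c"

definition hom_comp :: "'v grading \<Rightarrow> int \<Rightarrow> ('v, 'k::field) mpol set"
  where "hom_comp d g = {p. \<forall>m\<in>Poly_Mapping.keys p. d m = g}"

definition graded :: "'v grading \<Rightarrow> ('v, 'k::field) endo \<Rightarrow> bool"
  where "graded d \<phi> \<longleftrightarrow> (\<forall>g. psubst \<phi> ` hom_comp d g \<subseteq> hom_comp d g)"

definition graded_Aut :: "'v grading \<Rightarrow> ('v, 'k::field) endo monoid"
  where "graded_Aut d = poly_Aut\<lparr>carrier := {\<phi> \<in> carrier poly_Aut. graded d \<phi>}\<rparr>"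

definition elementary :: "('v, 'k::field) endo \<Rightarrow> bool"
  where "elementary \<phi> \<longleftrightarrow> (\<exists>v l F. l \<noteq> 0 \<and> (\<forall>m\<in>Poly_Mapping.keys F. v \<notin> Poly_Mapping.keys m) \<and>
    \<phi> = Var(v := Const l * Var v + F))"

definition graded_tame :: "'v grading \<Rightarrow> ('v, 'k::field) endo \<Rightarrow> bool"
  where "graded_tame d \<phi> \<longleftrightarrow> (\<exists>\<phi>s. (\<forall>\<psi>\<in>set \<phi>s. elementary \<psi> \<and> \<psi> \<in> carrier (graded_Aut d)) \<and>
    \<phi> = foldr (\<circ>\<^sub>e) \<phi>s Var)"

definition graded_wild :: "'v grading \<Rightarrow> ('v, 'k::field) endo \<Rightarrow> bool"
  where "graded_wild d \<phi> \<longleftrightarrow> \<phi> \<in> carrier (graded_Aut d) \<and> \<not> graded_tame d \<phi>"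


section \<open>The algebras in the variables x, y, z and u, v\<close>

text \<open>
  The functions \<open>case_var3 f g h\<close> and \<open>case_var2 f g\<close> are the tuples \<open>(f, g, h)\<close> and \<open>(f, g)\<close>.
\<close>

datatype var3 = Vx | Vy | Vz
datatype var2 = Vu | Vv

text \<open>
  The linear orders only serve to make the polynomial algebras instances of class \<^class>\<open>idom\<close>.
\<close>

instantiation var3 :: linorder
begin
definition less_eq_var3 :: "var3 \<Rightarrow> var3 \<Rightarrow> bool"
  where "less_eq_var3 v w \<longleftrightarrow> case_var3 0 1 (2::nat) v \<le> case_var3 0 1 2 w"
definition less_var3 :: "var3 \<Rightarrow> var3 \<Rightarrow> bool"
  where "less_var3 v w \<longleftrightarrow> case_var3 0 1 (2::nat) v < case_var3 0 1 2 w"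
instance
  by standard (auto simp: less_eq_var3_def less_var3_def split: var3.splits)
end

instantiation var2 :: linorder
begin
definition less_eq_var2 :: "var2 \<Rightarrow> var2 \<Rightarrow> bool"
  where "less_eq_var2 v w \<longleftrightarrow> case_var2 0 (1::nat) v \<le> case_var2 0 1 w"
definition less_var2 :: "var2 \<Rightarrow> var2 \<Rightarrow> bool"
  where "less_var2 v w \<longleftrightarrow> case_var2 0 (1::nat) v < case_var2 0 1 w"
instance
  by standard (auto simp: less_eq_var2_def less_var2_def split: var2.splits)
end

definition Gamma :: "nat \<Rightarrow> nat \<Rightarrow> nat \<Rightarrow> var3 grading"
  where "Gamma a b c = wdeg (case_var3 (int a) (int b) (- int c))"

definition Gamma_tilde :: "nat \<Rightarrow> nat \<Rightarrow> nat \<Rightarrow> var2 grading"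
  where "Gamma_tilde a b c = wdeg_mod c (case_var2 (int a) (int b))"

definition E_set :: "nat \<Rightarrow> nat \<Rightarrow> nat \<Rightarrow> (var3, 'k::field) endo set"
  where "E_set a b c = {\<phi> \<in> carrier (graded_Aut (Gamma a b c)). \<phi> Vz = Var Vz}"

text \<open>The map \<open>\<alpha>\<close> sets \<open>x = u\<close>, \<open>y = v\<close>, \<open>z = 1\<close>; it is only meaningful on \<^const>\<open>E_set\<close>.\<close>

definition alpha :: "(var3, 'k::field) endo \<Rightarrow> (var2, 'k) endo"
  where "alpha \<phi> =
    (let \<sigma> = case_var3 (Var Vu) (Var Vv) 1
     in case_var2 (psubst \<sigma> (\<phi> Vx)) (psubst \<sigma> (\<phi> Vy)))"

text \<open>
  One-variable polynomials have type \<^typ>\<open>'k poly\<close>; \<open>upoly f p\<close> is \<open>f(p)\<close>.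
\<close>

definition upoly :: "'k::field poly \<Rightarrow> ('v, 'k) mpol \<Rightarrow> ('v, 'k) mpol"
  where "upoly f p = poly (map_poly Const f) p"

definition low_degree :: "'k::field poly \<Rightarrow> nat"
  where "low_degree f = (LEAST n. coeff f n \<noteq> 0)"

definition D_set :: "nat \<Rightarrow> nat \<Rightarrow> nat \<Rightarrow> (var2, 'k::field) endo set"
  where "D_set a b c =
    {case_var2 (Var Vu) (Const l * Var Vv + Const \<mu> * Var Vu ^ k) | l \<mu> k.
      l \<noteq> 0 \<and> k \<ge> 1 \<and> (\<mu> = 0 \<or> [k * a = b] (mod c))}"

definition U_set :: "nat \<Rightarrow> nat \<Rightarrow> nat \<Rightarrow> (var2, 'k::field) endo set"
  where "U_set a b c =
    {case_var2 (Const l * Var Vu + upoly f (Var Vv)) (Var Vv) | l f.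
      l \<noteq> 0 \<and> upoly f (Var Vv) \<in> hom_comp (Gamma_tilde a b c) (int a mod int c) \<and>
      (f = 0 \<or> real (low_degree f) \<ge> real a / real b)}"

definition W_set :: "nat \<Rightarrow> nat \<Rightarrow> nat \<Rightarrow> (var2, 'k::field) endo set"
  where "W_set a b c =
    {case_var2 (Const l * Var Vu + upoly f (Var Vv)) (Var Vv) | l f.
      l \<noteq> 0 \<and> upoly f (Var Vv) \<in> hom_comp (Gamma_tilde a b c) (int a mod int c) \<and>
      (f = 0 \<or> low_degree f > 1 \<and> real (degree f) < real a / real b)}"

definition T_set :: "(var3, 'k::field) endo set"
  where "T_set = {case_var3 (Var Vx) (Var Vy) (Const l * Var Vz) | l. l \<noteq> 0}"

end

theory Submission
  imports Defs
begin

text \<open>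
  The variable \<open>z\<close> is the only one of negative degree, so \<open>z\<close> divides every element of degree
  \<open>-c\<close>.  As automorphisms preserve irreducibility, a graded automorphism maps \<open>z\<close> to a scalar
  multiple of \<open>z\<close> (\<open>graded_Aut_scales_z\<close>).  Modulo \<open>T\<close> only \<open>E\<close> remains, and setting \<open>z = 1\<close> turns
  an element of \<open>E\<close> into an automorphism \<open>(f, g)\<close> of \<open>K[u, v]\<close> that is graded modulo \<open>c\<close> and
  satisfies a lower bound on monomials: \<open>u^i v^j\<close> occurs in \<open>f\<close> only if \<open>i a + j b \<ge> a\<close>, and in \<open>g\<close>
  only if \<open>i a + j b \<ge> b\<close>.  Since \<open>a > b\<close>, the origin is fixed and \<open>f\<close> has no linear term in \<open>v\<close>.

  All such \<open>(f, g)\<close> are products of elements of \<open>D\<close>, \<open>U\<close> and \<open>W\<close> (\<open>graded_tame_at_origin\<close>).  This is a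
  graded form of the Jung--van der Kulk theorem, obtained by Rentschler's method.  The polynomial
  \<open>f\<close> is killed by a nonzero locally nilpotent derivation, namely the transport of \<open>\<partial>/\<partial>v\<close>.  For
  every choice of weights, the leading part of a locally nilpotent derivation is again locally
  nilpotent and kills the leading form of \<open>f\<close> (\<open>lnd_kills_leading_form\<close>).  Its kernel is closed
  under taking factors and does not contain both variables, which is so restrictive that, unless
  \<open>f\<close> involves one variable only, some leading form of \<open>f\<close> is divisible by a binomial \<open>x - r y^k\<close>
  (\<open>newton_edge\<close>).  Substituting \<open>x + r y^k\<close> for \<open>x\<close> lowers the sum of the degrees of \<open>f\<close> in the two
  variables.  The shear used is graded because all monomials of the appropriate edge occur in \<open>f\<close>.
  It belongs to \<open>U\<close> or \<open>W\<close> if \<open>x = u\<close> and \<open>k \<ge> 2\<close>, and to \<open>D\<close> if \<open>x = v\<close>; the case \<open>x = u\<close>, \<open>k = 1\<close> is turned into the latter by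
  exchanging the roles of the variables.  The process ends with \<open>f = \<lambda>u\<close>, where \<open>g = \<mu>v + h(u)\<close>.

  Finally let \<open>H\<close> be the group generated by the given automorphisms, and \<open>M\<close> the set of all
  \<open>\<tau> \<circ> \<alpha>(h)\<close> with \<open>\<tau> \<in> W\<close> and \<open>h \<in> H \<inter> E\<close>.  For \<open>\<theta> \<in> D\<close> the equation
  \<open>\<theta> \<circ> \<tau> = (\<tau> \<circ> s\<inverse>) \<circ> (s \<circ> \<tau>\<inverse> \<circ> \<theta> \<circ> \<tau>)\<close> with \<open>s = s\<^bsub>\<tau>,\<theta>\<^esub>\<close> shows that
  \<open>M\<close> is stable under left multiplication by \<open>D\<close>; for \<open>U\<close> and \<open>W\<close> this holds because both consist of
  triangular maps.  Hence \<open>\<alpha>(E) \<subseteq> M\<close>.  If \<open>\<tau> \<circ> \<alpha>(h)\<close> lies in \<open>\<alpha>(E)\<close>, so does \<open>\<tau>\<close>; the monomials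
  \<open>v^j\<close> in its first component then have \<open>j b \<ge> a\<close>, so that \<open>\<tau> \<in> U\<close> and \<open>\<tau> \<circ> \<alpha>(h)\<close> lifts to \<open>H\<close>.
\<close>

section \<open>Polynomial algebras\<close>

abbreviation mons :: "('v, 'k::zero) mpol \<Rightarrow> ('v \<Rightarrow>\<^sub>0 nat) set"
  where "mons \<equiv> Poly_Mapping.keys"

abbreviation coef :: "('v, 'k::zero) mpol \<Rightarrow> ('v \<Rightarrow>\<^sub>0 nat) \<Rightarrow> 'k"
  where "coef \<equiv> Poly_Mapping.lookup"

abbreviation expo :: "('v \<Rightarrow>\<^sub>0 nat) \<Rightarrow> 'v \<Rightarrow> nat"
  where "expo \<equiv> Poly_Mapping.lookup"

abbreviation mono1 :: "'v \<Rightarrow> nat \<Rightarrow> 'v \<Rightarrow>\<^sub>0 nat"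
  where "mono1 \<equiv> Poly_Mapping.single"

abbreviation term1 :: "('v \<Rightarrow>\<^sub>0 nat) \<Rightarrow> 'k \<Rightarrow> ('v, 'k::zero) mpol"
  where "term1 \<equiv> Poly_Mapping.single"

lemma coef_term1: "coef (term1 m c) m' = (if m = m' then c else 0)"
  by (simp add: lookup_single when_def)

lemma mono1_eq_iff [simp]: "mono1 v i = mono1 v j \<longleftrightarrow> i = j"
  by (metis lookup_single_eq)

lemma mpol_eq_sum: "(p :: ('v, 'k::comm_monoid_add) mpol) = (\<Sum>m\<in>mons p. term1 m (coef p m))"
proof (rule poly_mapping_eqI)
  fix k
  show "coef p k = coef (\<Sum>m\<in>mons p. term1 m (coef p m)) k"
    by (simp add: lookup_sum coef_term1 sum.delta in_keys_iff cong: if_cong)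
qed

lemma mpol_induct_terms [case_names single add]:
  assumes "\<And>m c. P (term1 m c)" and "\<And>p q. P p \<Longrightarrow> P q \<Longrightarrow> P (p + q)"
  shows "P (p :: ('v, 'k::comm_monoid_add) mpol)"
proof -
  have "P (\<Sum>m\<in>A. term1 m (coef p m))" if "finite A" for A
    using that
  proof (induction A)
    case empty
    show ?case using assms(1)[of 0 0] by simp
  next
    case (insert m A)
    then show ?case using assms by simp
  qed
  from this[of "mons p"] show ?thesis using mpol_eq_sum[of p] by (metis finite_keys)
qed

lemma monomial_induct [case_names zero step]:
  assumes "P 0" and "\<And>m v. P m \<Longrightarrow> P (m + mono1 v 1)"
  shows "P (m :: 'v \<Rightarrow>\<^sub>0 nat)"
proof (induction m rule: Poly_Mapping.update_induct)
  case const
  show ?case by (rule assms(1))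
next
  case (update f a b)
  have "Poly_Mapping.update a b f = f + mono1 a b"
    using update(1)
    by (intro poly_mapping_eqI) (auto simp: lookup_update lookup_add lookup_single in_keys_iff)
  moreover have "P (f + mono1 a b)" for b
  proof (induction b)
    case 0
    then show ?case using update by simp
  next
    case (Suc b)
    then show ?case using assms(2)[of "f + mono1 a b" a] by (simp add: add.assoc single_add[symmetric])
  qed
  ultimately show ?case by simp
qed

lemma Const_0 [simp]: "Const 0 = 0"
  by (simp add: Const_def)

lemma Const_1 [simp]: "Const 1 = 1"
  by (simp add: Const_def)

lemma Const_add: "Const (c + d) = Const c + Const d"
  by (simp add: Const_def single_add)

lemma Const_mult: "Const (c * d) = Const c * Const d"
  by (simp add: Const_def mult_single)

lemma Const_uminus: "Const (- c) = - Const c"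
  by (simp add: Const_def single_uminus)

lemma Const_of_nat: "Const (of_nat n) = of_nat n"
  by (induction n) (simp_all add: Const_add)

lemma Const_eq_iff: "Const a = Const b \<longleftrightarrow> a = b"
  by (metis Const_def lookup_single_eq)

lemma Const_mult_term1: "Const c * term1 m d = term1 m (c * d)"
  by (simp add: Const_def mult_single)

lemma coef_Const_mult: "coef (Const c * p) m = c * coef p m"
proof (induction p rule: mpol_induct_terms)
  case (single m' c')
  then show ?case by (simp add: Const_mult_term1 coef_term1)
next
  case (add p q)
  then show ?case by (simp add: lookup_add algebra_simps)
qed

lemma Var_power: "Var v ^ n = term1 (mono1 v n) 1"
  by (induction n) (simp_all add: Var_def mult_single single_add[symmetric])

lemma term1_step: "term1 (m + mono1 v 1) c = term1 m c * Var v"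
  by (simp add: Var_def mult_single)

lemma mpol_induct [case_names Const Var add mult]:
  assumes C: "\<And>c. P (Const c)" and V: "\<And>v. P (Var v)"
    and A: "\<And>p q. P p \<Longrightarrow> P q \<Longrightarrow> P (p + q)" and M: "\<And>p q. P p \<Longrightarrow> P q \<Longrightarrow> P (p * q)"
  shows "P p"
proof (induction p rule: mpol_induct_terms)
  case (single m c)
  show ?case
  proof (induction m rule: monomial_induct)
    case zero
    then show ?case using C[of c] by (simp add: Const_def)
  next
    case (step m v)
    then show ?case using V[of v] M term1_step[of m v c] by simp
  qed
next
  case (add p q)
  then show ?case by (rule A)
qed

subsection \<open>Substitution is a ring homomorphism\<close>

definition meval :: "('v \<Rightarrow> ('w, 'k::field) mpol) \<Rightarrow> ('v \<Rightarrow>\<^sub>0 nat) \<Rightarrow> ('w, 'k) mpol"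
  where "meval \<sigma> m = (\<Prod>v\<in>Poly_Mapping.keys m. \<sigma> v ^ expo m v)"

lemma meval_superset:
  assumes "finite A" "Poly_Mapping.keys m \<subseteq> A"
  shows "meval \<sigma> m = (\<Prod>v\<in>A. \<sigma> v ^ expo m v)"
  unfolding meval_def using assms by (intro prod.mono_neutral_left) (auto simp: in_keys_iff)

lemma meval_0 [simp]: "meval \<sigma> 0 = 1"
  by (simp add: meval_def)

lemma meval_mono1: "meval \<sigma> (mono1 v n) = \<sigma> v ^ n"
  by (subst meval_superset[of "{v}"]) auto

lemma meval_add: "meval \<sigma> (m + n) = meval \<sigma> m * meval \<sigma> n"
proof -
  let ?A = "Poly_Mapping.keys m \<union> Poly_Mapping.keys n"
  have "meval \<sigma> (m + n) = (\<Prod>v\<in>?A. \<sigma> v ^ expo (m + n) v)"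
    using Poly_Mapping.keys_add[of m n] by (intro meval_superset) auto
  moreover have "meval \<sigma> m = (\<Prod>v\<in>?A. \<sigma> v ^ expo m v)" "meval \<sigma> n = (\<Prod>v\<in>?A. \<sigma> v ^ expo n v)"
    by (intro meval_superset; auto)+
  ultimately show ?thesis by (simp add: lookup_add power_add prod.distrib)
qed

lemma psubst_superset:
  assumes "finite A" "mons p \<subseteq> A"
  shows "psubst \<sigma> p = (\<Sum>m\<in>A. Const (coef p m) * meval \<sigma> m)"
  unfolding psubst_def meval_def using assms
  by (intro sum.mono_neutral_left) (auto simp: in_keys_iff)

lemma psubst_term1: "psubst \<sigma> (term1 m c) = Const c * meval \<sigma> m"
  by (subst psubst_superset[of "{m}"]) auto

lemma psubst_add [simp]: "psubst \<sigma> (p + q) = psubst \<sigma> p + psubst \<sigma> q"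
proof -
  let ?A = "mons p \<union> mons q"
  have "psubst \<sigma> (p + q) = (\<Sum>m\<in>?A. Const (coef (p + q) m) * meval \<sigma> m)"
    using Poly_Mapping.keys_add[of p q] by (intro psubst_superset) auto
  moreover have "psubst \<sigma> p = (\<Sum>m\<in>?A. Const (coef p m) * meval \<sigma> m)"
      "psubst \<sigma> q = (\<Sum>m\<in>?A. Const (coef q m) * meval \<sigma> m)"
    by (intro psubst_superset; auto)+
  ultimately show ?thesis by (simp add: lookup_add Const_add algebra_simps sum.distrib)
qed

lemma psubst_0 [simp]: "psubst \<sigma> 0 = 0"
  by (simp add: psubst_def)

lemma psubst_Const [simp]: "psubst \<sigma> (Const c) = Const c"
  using psubst_term1[of \<sigma> 0 c] by (simp add: Const_def)

lemma psubst_1 [simp]: "psubst \<sigma> 1 = 1"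
  using psubst_Const[of \<sigma> 1] by simp

lemma psubst_Var [simp]: "psubst \<sigma> (Var v) = \<sigma> v"
  by (simp add: Var_def psubst_term1 meval_mono1)

lemma psubst_mult [simp]: "psubst \<sigma> (p * q) = psubst \<sigma> p * psubst \<sigma> q"
proof (induction p rule: mpol_induct_terms)
  case (single m c)
  show ?case
  proof (induction q rule: mpol_induct_terms)
    case (single n d)
    show ?case by (simp add: mult_single psubst_term1 meval_add Const_mult)
  next
    case (add p q)
    then show ?case by (simp add: algebra_simps)
  qed
next
  case (add p q)
  then show ?case by (simp add: algebra_simps)
qed

lemma psubst_power [simp]: "psubst \<sigma> (p ^ n) = psubst \<sigma> p ^ n"
  by (induction n) simp_all

lemma psubst_uminus [simp]: "psubst \<sigma> (- p) = - psubst \<sigma> p"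
  using psubst_add[of \<sigma> p "- p"] by (simp add: eq_neg_iff_add_eq_0 add.commute)

lemma psubst_diff [simp]: "psubst \<sigma> (p - q) = psubst \<sigma> p - psubst \<sigma> q"
  using psubst_add[of \<sigma> p "- q"] by simp

lemma psubst_sum [simp]: "psubst \<sigma> (sum f A) = (\<Sum>i\<in>A. psubst \<sigma> (f i))"
  by (induction A rule: infinite_finite_induct) simp_all

lemma psubst_psubst: "psubst \<sigma> (psubst \<tau> p) = psubst (\<lambda>v. psubst \<sigma> (\<tau> v)) p"
  by (induction p rule: mpol_induct) simp_all

lemma psubst_Var_id [simp]: "psubst Var p = p"
  by (induction p rule: mpol_induct) simp_all

lemma upoly_eq_sum:
  fixes p :: "('v, 'k::field) mpol"
  assumes "degree f \<le> n"
  shows "upoly f p = (\<Sum>i\<le>n. Const (coeff f i) * p ^ i)"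
proof -
  have "upoly f p = (\<Sum>i\<le>degree (map_poly (Const :: 'k \<Rightarrow> ('v, 'k) mpol) f). Const (coeff f i) * p ^ i)"
    unfolding upoly_def poly_altdef by (rule sum.cong) (simp_all add: coeff_map_poly)
  also have "\<dots> = (\<Sum>i\<le>n. Const (coeff f i) * p ^ i)"
  proof (rule sum.mono_neutral_left)
    have "degree (map_poly (Const :: 'k \<Rightarrow> ('v, 'k) mpol) f) \<le> degree f"
      by (rule degree_le) (simp add: coeff_map_poly coeff_eq_0)
    then show "{..degree (map_poly (Const :: 'k \<Rightarrow> ('v, 'k) mpol) f)} \<subseteq> {..n}"
      using assms by auto
    show "\<forall>i\<in>{..n} - {..degree (map_poly (Const :: 'k \<Rightarrow> ('v, 'k) mpol) f)}. Const (coeff f i) * p ^ i = 0"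
      using coeff_eq_0[of "map_poly (Const :: 'k \<Rightarrow> ('v, 'k) mpol) f"] by (auto simp: coeff_map_poly)
  qed simp
  finally show ?thesis .
qed

lemma upoly_0 [simp]: "upoly 0 p = 0"
  by (simp add: upoly_def)

lemma upoly_add: "upoly (f + g) p = upoly f p + upoly g p"
  by (simp add: upoly_eq_sum[of _ "max (degree f) (degree g)"] degree_add_le Const_add
      sum.distrib algebra_simps)

lemma upoly_smult: "upoly (smult l f) p = Const l * upoly f p"
  by (simp add: upoly_eq_sum[of _ "degree f"] degree_smult_le Const_mult sum_distrib_left mult.assoc)

lemma upoly_monom: "upoly (monom l k) p = Const l * p ^ k"
proof -
  have "upoly (monom l k) p = (\<Sum>i\<le>k. if i = k then Const l * p ^ k else 0)"
    by (subst upoly_eq_sum[OF degree_monom_le], rule sum.cong) auto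
  then show ?thesis by simp
qed

lemma psubst_upoly [simp]: "psubst \<sigma> (upoly f p) = upoly f (psubst \<sigma> p)"
  by (simp add: upoly_eq_sum[of f "degree f"])

lemma coef_upoly_Var: "coef (upoly f (Var v)) (mono1 v k) = coeff f k"
proof -
  have "coef (upoly f (Var v)) (mono1 v k)
      = (\<Sum>i\<le>max k (degree f). coeff f i * (if i = k then 1 else 0))"
    by (simp add: upoly_eq_sum[of f "max k (degree f)"] lookup_sum Var_power coef_Const_mult
        coef_term1)
  also have "\<dots> = (\<Sum>i\<le>max k (degree f). if i = k then coeff f i else 0)"
    by (intro sum.cong) auto
  finally show ?thesis by simp
qed

subsection \<open>The group of polynomial automorphisms\<close>

lemma endo_comp_apply: "(\<phi> \<circ>\<^sub>e \<psi>) v = psubst \<psi> (\<phi> v)"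
  by (simp add: endo_comp_def)

lemma endo_comp_assoc: "(\<phi> \<circ>\<^sub>e \<psi>) \<circ>\<^sub>e \<chi> = \<phi> \<circ>\<^sub>e (\<psi> \<circ>\<^sub>e \<chi>)"
  by (rule ext) (simp add: endo_comp_def psubst_psubst)

lemma endo_comp_Var [simp]: "\<phi> \<circ>\<^sub>e Var = \<phi>" "Var \<circ>\<^sub>e \<phi> = \<phi>"
  by (rule ext, simp add: endo_comp_def)+

lemma psubst_endo_comp: "psubst (\<phi> \<circ>\<^sub>e \<psi>) p = psubst \<psi> (psubst \<phi> p)"
  by (simp add: psubst_psubst endo_comp_def)

interpretation poly_End: monoid "poly_End :: ('v, 'k::field) endo monoid"
  by (rule monoidI) (simp_all add: poly_End_def endo_comp_assoc)

interpretation poly_Aut: group "poly_Aut :: ('v, 'k::field) endo monoid"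
  unfolding poly_Aut_def by (rule poly_End.units_group)

lemma mult_poly_Aut [simp]: "\<phi> \<otimes>\<^bsub>poly_Aut\<^esub> \<psi> = \<phi> \<circ>\<^sub>e \<psi>"
  by (simp add: poly_Aut_def units_of_def poly_End_def)

lemma one_poly_Aut [simp]: "\<one>\<^bsub>poly_Aut\<^esub> = Var"
  by (simp add: poly_Aut_def units_of_def poly_End_def)

lemma carrier_poly_Aut: "\<phi> \<in> carrier poly_Aut \<longleftrightarrow> (\<exists>\<psi>. \<phi> \<circ>\<^sub>e \<psi> = Var \<and> \<psi> \<circ>\<^sub>e \<phi> = Var)"
  by (auto simp: poly_Aut_def units_of_def poly_End_def Units_def)

lemma poly_AutI: "\<phi> \<circ>\<^sub>e \<psi> = Var \<Longrightarrow> \<psi> \<circ>\<^sub>e \<phi> = Var \<Longrightarrow> \<phi> \<in> carrier poly_Aut"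
  by (auto simp: carrier_poly_Aut)

lemma poly_Aut_comp [intro]:
  "\<phi> \<in> carrier poly_Aut \<Longrightarrow> \<psi> \<in> carrier poly_Aut \<Longrightarrow> \<phi> \<circ>\<^sub>e \<psi> \<in> carrier poly_Aut"
  using poly_Aut.m_closed by fastforce

lemma inv_poly_Aut:
  assumes "\<phi> \<in> carrier poly_Aut"
  shows "inv\<^bsub>poly_Aut\<^esub> \<phi> \<in> carrier poly_Aut"
    "\<phi> \<circ>\<^sub>e inv\<^bsub>poly_Aut\<^esub> \<phi> = Var" "inv\<^bsub>poly_Aut\<^esub> \<phi> \<circ>\<^sub>e \<phi> = Var"
  using assms poly_Aut.r_inv[OF assms] poly_Aut.l_inv[OF assms] by auto

lemma psubst_inverse:
  assumes "\<phi> \<circ>\<^sub>e \<psi> = Var"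
  shows "psubst \<psi> (psubst \<phi> p) = p" "psubst \<psi> (\<phi> v) = Var v"
  using assms psubst_endo_comp[of \<phi> \<psi> p] endo_comp_apply[of \<phi> \<psi> v] by simp_all

section \<open>Weights and homogeneous parts\<close>

lemma wdeg_superset:
  assumes "finite A" "Poly_Mapping.keys m \<subseteq> A"
  shows "wdeg w m = (\<Sum>v\<in>A. int (expo m v) * w v)"
  unfolding wdeg_def using assms by (intro sum.mono_neutral_left) (auto simp: in_keys_iff)

lemma wdeg_0 [simp]: "wdeg w 0 = 0"
  by (simp add: wdeg_def)

lemma wdeg_mono1 [simp]: "wdeg w (mono1 v n) = int n * w v"
  by (subst wdeg_superset[of "{v}"]) auto

lemma wdeg_add [simp]: "wdeg w (m + n) = wdeg w m + wdeg w n"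
proof -
  let ?A = "Poly_Mapping.keys m \<union> Poly_Mapping.keys n"
  have "wdeg w (m + n) = (\<Sum>v\<in>?A. int (expo (m + n) v) * w v)"
    using Poly_Mapping.keys_add[of m n] by (intro wdeg_superset) auto
  moreover have "wdeg w m = (\<Sum>v\<in>?A. int (expo m v) * w v)"
      "wdeg w n = (\<Sum>v\<in>?A. int (expo n v) * w v)"
    by (intro wdeg_superset; auto)+
  ultimately show ?thesis by (simp add: lookup_add algebra_simps sum.distrib)
qed

lemma wdeg_nonneg: "(\<And>v. w v \<ge> 0) \<Longrightarrow> wdeg w m \<ge> 0"
  unfolding wdeg_def by (intro sum_nonneg) simp

lemma wdeg_mod_0: "wdeg_mod 0 w = wdeg w"
  by (rule ext) (simp add: wdeg_mod_def)

lemma mons_mult: "m \<in> mons (p * q) \<Longrightarrow> \<exists>m1 \<in> mons p. \<exists>m2 \<in> mons q. m = m1 + m2"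
  using Poly_Mapping.keys_mult[of p q] by blast

lemma mons_add: "m \<in> mons (p + q) \<Longrightarrow> m \<in> mons p \<or> m \<in> mons q"
  using Poly_Mapping.keys_add[of p q] by blast

lemma mons_Const_mult: "mons (Const l * p) \<subseteq> mons p"
  by (auto simp: in_keys_iff coef_Const_mult)

lemma Var_neq_0: "Var v \<noteq> 0"
  by (metis Var_def lookup_single_eq lookup_zero zero_neq_one)

subsection \<open>Selecting monomials\<close>

definition mpart :: "('v \<Rightarrow>\<^sub>0 nat) set \<Rightarrow> ('v, 'k::field) mpol \<Rightarrow> ('v, 'k) mpol"
  where "mpart S p = (\<Sum>m\<in>mons p \<inter> S. term1 m (coef p m))"

lemma coef_mpart: "coef (mpart S p) m = (if m \<in> S then coef p m else 0)"
  by (auto simp: mpart_def lookup_sum coef_term1 in_keys_iff)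

lemma mons_mpart: "mons (mpart S p) = mons p \<inter> S"
  by (auto simp: in_keys_iff coef_mpart split: if_splits)

lemma mpart_add: "mpart S (p + q) = mpart S p + mpart S q"
  by (rule poly_mapping_eqI) (simp add: coef_mpart lookup_add)

lemma mpart_0 [simp]: "mpart S 0 = 0"
  by (rule poly_mapping_eqI) (simp add: coef_mpart)

lemma mpart_compl: "mpart S p + mpart (- S) p = p"
  by (rule poly_mapping_eqI) (simp add: coef_mpart lookup_add)

lemma mpart_id: "mons p \<subseteq> S \<Longrightarrow> mpart S p = p"
  by (rule poly_mapping_eqI) (auto simp: coef_mpart in_keys_iff)

lemma mpart_eq_0: "mons p \<inter> S = {} \<Longrightarrow> mpart S p = 0"
  by (rule poly_mapping_eqI) (auto simp: coef_mpart in_keys_iff)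

lemma mpart_term1: "mpart S (term1 m c) = (if m \<in> S then term1 m c else 0)"
  by (rule poly_mapping_eqI) (auto simp: coef_mpart coef_term1)

subsection \<open>The filtration of a weight\<close>

definition below :: "('v \<Rightarrow> int) \<Rightarrow> int \<Rightarrow> ('v, 'k::field) mpol set"
  where "below w n = {p. \<forall>m\<in>mons p. wdeg w m \<le> n}"

abbreviation hpart :: "('v \<Rightarrow> int) \<Rightarrow> int \<Rightarrow> ('v, 'k::field) mpol \<Rightarrow> ('v, 'k) mpol"
  where "hpart w n \<equiv> mpart {m. wdeg w m = n}"

lemma belowD: "p \<in> below w n \<Longrightarrow> m \<in> mons p \<Longrightarrow> wdeg w m \<le> n"
  by (simp add: below_def)

lemma below_add: "p \<in> below w n \<Longrightarrow> q \<in> below w n \<Longrightarrow> p + q \<in> below w n"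
  by (auto simp: below_def dest!: mons_add)

lemma below_0 [simp]: "0 \<in> below w n"
  by (simp add: below_def)

lemma below_mono: "p \<in> below w n \<Longrightarrow> n \<le> n' \<Longrightarrow> p \<in> below w n'"
  by (force simp: below_def)

lemma below_mult: "p \<in> below w n \<Longrightarrow> q \<in> below w n' \<Longrightarrow> p * q \<in> below w (n + n')"
  by (force simp: below_def dest!: mons_mult)

lemma below_term1: "wdeg w m \<le> n \<Longrightarrow> term1 m c \<in> below w n"
  by (simp add: below_def)

lemma below_Const: "n \<ge> 0 \<Longrightarrow> Const c \<in> below w n"
  by (simp add: Const_def below_term1)

lemma below_Const_mult: "p \<in> below w n \<Longrightarrow> Const c * p \<in> below w n"
  using below_mult[OF below_Const, of 0 p w n c] by simp

lemma below_Var: "w v \<le> n \<Longrightarrow> Var v \<in> below w n"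
  by (simp add: Var_def below_term1)

lemma below_power: "p \<in> below w n \<Longrightarrow> p ^ k \<in> below w (int k * n)"
proof (induction k)
  case 0
  then show ?case using below_Const[of 0 1 w] by simp
next
  case (Suc k)
  then show ?case using below_mult[of p w n "p ^ k" "int k * n"] by (simp add: algebra_simps)
qed

lemma below_sum: "(\<And>i. i \<in> A \<Longrightarrow> f i \<in> below w n) \<Longrightarrow> sum f A \<in> below w n"
  by (induction A rule: infinite_finite_induct) (auto intro: below_add)

lemma below_meval:
  assumes "\<And>v. \<sigma> v \<in> below w' (w v)"
  shows "meval \<sigma> m \<in> below w' (wdeg w m)"
proof (induction m rule: monomial_induct)
  case zero
  then show ?case using below_Const[of 0 1] by simp
next
  case (step m v)
  then show ?case using below_mult[OF step assms[of v]] by (simp add: meval_add meval_mono1)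
qed

lemma below_psubst:
  assumes "\<And>v. \<sigma> v \<in> below w' (w v)" and p: "p \<in> below w n"
  shows "psubst \<sigma> p \<in> below w' n"
proof -
  have "Const (coef p m) * meval \<sigma> m \<in> below w' n" if "m \<in> mons p" for m
    using below_mono[OF below_meval[of \<sigma> w' w m, OF assms(1)] belowD[OF p that]]
    by (rule below_Const_mult)
  then show ?thesis by (subst psubst_superset[of "mons p"]) (auto intro: below_sum)
qed

lemma hpart_above: "p \<in> below w n \<Longrightarrow> n < n' \<Longrightarrow> hpart w n' p = 0"
  by (rule mpart_eq_0) (auto dest: belowD)

text \<open>
  Multiplying by a homogeneous polynomial shifts all weights by the same amount.
\<close>

lemma hpart_mult_hom:
  assumes h: "\<And>m. m \<in> mons h \<Longrightarrow> wdeg w m = e"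
  shows "hpart w (n + e) (q * h) = hpart w n q * h"
proof -
  let ?S = "{m. wdeg w m = n}"
  have "q * h = mpart ?S q * h + mpart (- ?S) q * h"
    by (metis distrib_right mpart_compl)
  moreover have "hpart w (n + e) (mpart ?S q * h) = mpart ?S q * h"
    using h by (intro mpart_id) (auto dest!: mons_mult simp: mons_mpart)
  moreover have "hpart w (n + e) (mpart (- ?S) q * h) = 0"
    using h by (intro mpart_eq_0) (force dest!: mons_mult simp: mons_mpart)
  ultimately show ?thesis by (simp add: mpart_add)
qed

lemma below_split:
  assumes "p \<in> below w n"
  obtains p' where "p = hpart w n p + p'" "p' \<in> below w (n - 1)"
proof
  show "p = hpart w n p + mpart (- {m. wdeg w m = n}) p" by (simp add: mpart_compl)
  show "mpart (- {m. wdeg w m = n}) p \<in> below w (n - 1)"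
    using assms by (force simp: below_def mons_mpart)
qed

text \<open>
  All products of homogeneous parts other than that of the leading forms have smaller weight.
\<close>

lemma hpart_mult_top:
  assumes p: "p \<in> below w n" and q: "q \<in> below w n'"
  shows "hpart w (n + n') (p * q) = hpart w n p * hpart w n' q"
proof -
  obtain q' where q': "q = hpart w n' q + q'" "q' \<in> below w (n' - 1)"
    using below_split[OF q] .
  have "hpart w (n + n') (p * q') = 0"
    using hpart_above[OF below_mult[OF p q'(2)]] by simp
  moreover have "hpart w (n + n') (p * hpart w n' q) = hpart w n p * hpart w n' q"
    by (rule hpart_mult_hom) (simp add: mons_mpart)
  moreover have "p * q = p * hpart w n' q + p * q'"
    by (subst q'(1)) (simp add: algebra_simps)
  ultimately show ?thesis by (simp add: mpart_add)
qed

lemma top_weight_exists: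
  assumes "p \<noteq> 0"
  obtains n where "p \<in> below w n" "hpart w n p \<noteq> 0" "\<exists>m\<in>mons p. wdeg w m = n"
proof
  let ?n = "Max (wdeg w ` mons p)"
  have ne: "mons p \<noteq> {}" using assms by (metis finite_keys keys_eq_empty)
  show "p \<in> below w ?n" by (simp add: below_def)
  have "?n \<in> wdeg w ` mons p" using ne by (intro Max_in) auto
  then show ex: "\<exists>m\<in>mons p. wdeg w m = ?n" by auto
  then obtain m where "m \<in> mons p" "wdeg w m = ?n" by blast
  then have "m \<in> mons (hpart w ?n p)" by (simp add: mons_mpart)
  then show "hpart w ?n p \<noteq> 0" by auto
qed

subsection \<open>Constants and irreducibility of variables\<close>

lemma total_degree_0_imp_Const:
  assumes "p \<in> below (\<lambda>_. 1) 0"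
  shows "p = Const (coef p 0)"
proof (rule poly_mapping_eqI)
  fix m
  have "m = 0" if "m \<in> mons p"
  proof -
    have "(\<Sum>v\<in>Poly_Mapping.keys m. int (expo m v)) \<le> 0"
      using belowD[OF assms that] by (simp add: wdeg_def)
    then have "\<forall>v\<in>Poly_Mapping.keys m. int (expo m v) = 0"
      by (metis (no_types, lifting) finite_keys of_nat_0_le_iff order_antisym sum_nonneg sum_nonneg_eq_0_iff)
    then show "m = 0" by (metis keys_eq_empty equals0I in_keys_iff of_nat_eq_0_iff)
  qed
  then show "coef p m = coef (Const (coef p 0)) m"
    by (auto simp: Const_def coef_term1 in_keys_iff)
qed

text \<open>
  Over an integral domain leading forms multiply to something nonzero, so the total degree is
  additive.
\<close>

lemma factor_of_degree_le:
  fixes p q :: "('v::linorder, 'k::field) mpol"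
  assumes "p * q \<in> below (\<lambda>_. 1) n" "p * q \<noteq> 0"
  obtains i j where "i \<ge> 0" "j \<ge> 0" "i + j \<le> n" "p \<in> below (\<lambda>_. 1) i" "q \<in> below (\<lambda>_. 1) j"
proof -
  have "p \<noteq> 0" "q \<noteq> 0" using assms(2) by auto
  obtain i where i: "p \<in> below (\<lambda>_. 1) i" "hpart (\<lambda>_. 1) i p \<noteq> 0" "\<exists>m\<in>mons p. wdeg (\<lambda>_. 1) m = i"
    by (rule top_weight_exists[OF \<open>p \<noteq> 0\<close>])
  obtain j where j: "q \<in> below (\<lambda>_. 1) j" "hpart (\<lambda>_. 1) j q \<noteq> 0" "\<exists>m\<in>mons q. wdeg (\<lambda>_. 1) m = j"
    by (rule top_weight_exists[OF \<open>q \<noteq> 0\<close>])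
  have "hpart (\<lambda>_. 1) (i + j) (p * q) \<noteq> 0"
    using i(2) j(2) by (simp add: hpart_mult_top[OF i(1) j(1)])
  then have "i + j \<le> n" using hpart_above[OF assms(1)] by (meson not_le)
  moreover have "i \<ge> 0" "j \<ge> 0" using i(3) j(3) by (auto intro: wdeg_nonneg)
  ultimately show ?thesis using that i(1) j(1) by blast
qed

lemma factor_of_Var:
  fixes p q :: "('v::linorder, 'k::field) mpol"
  assumes "p * q = Var v"
  shows "(\<exists>l. l \<noteq> 0 \<and> p = Const l) \<or> (\<exists>l. l \<noteq> 0 \<and> q = Const l)"
proof -
  have "p * q \<in> below (\<lambda>_. 1) 1" using below_Var[of "\<lambda>_. 1" v 1] assms by simp
  moreover have nz: "p * q \<noteq> 0" unfolding assms by (rule Var_neq_0)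
  ultimately obtain i j where ij: "i \<ge> 0" "j \<ge> 0" "i + j \<le> 1" "p \<in> below (\<lambda>_. 1) i" "q \<in> below (\<lambda>_. 1) j"
    by (rule factor_of_degree_le)
  then have "i = 0 \<or> j = 0" by linarith
  then have "p = Const (coef p 0) \<or> q = Const (coef q 0)" using total_degree_0_imp_Const ij by blast
  moreover have "p \<noteq> 0" "q \<noteq> 0" using nz by auto
  ultimately show ?thesis by (metis Const_0)
qed

text \<open>
  An automorphism maps a variable to an irreducible polynomial, so a component divisible by a
  variable is a scalar multiple of it.
\<close>

lemma component_divisible_by_Var:
  fixes \<phi> :: "('v::linorder, 'k::field) endo"
  assumes aut: "\<phi> \<in> carrier poly_Aut" and comp: "\<phi> v = Var y * r"
  obtains e where "r = Const e" "e \<noteq> 0"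
proof -
  obtain \<psi> where \<psi>: "\<phi> \<circ>\<^sub>e \<psi> = Var" "\<psi> \<circ>\<^sub>e \<phi> = Var" using aut by (auto simp: carrier_poly_Aut)
  have "\<psi> y * psubst \<psi> r = Var v" using psubst_inverse(2)[OF \<psi>(1), of v] comp by simp
  then consider e where "\<psi> y = Const e" | e where "psubst \<psi> r = Const e" "e \<noteq> 0"
    using factor_of_Var by blast
  then show ?thesis
  proof cases
    case 1
    then have "Var y = Const e" using psubst_inverse(2)[OF \<psi>(2), of y] by simp
    then have "expo m y = 0" if "m \<in> mons (Var y :: ('v, 'k) mpol)" for m
      using that by (simp add: Const_def split: if_splits)
    then have "expo (mono1 y 1) y = 0" by (simp add: Var_def)
    then show ?thesis by simp
  next
    case 2
    then have "psubst \<phi> (psubst \<psi> r) = Const e" by simp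
    then have "r = Const e" by (simp only: psubst_inverse(1)[OF \<psi>(2)])
    then show ?thesis using that 2 by blast
  qed
qed

lemma Var_dvd:
  assumes "\<And>m. m \<in> mons p \<Longrightarrow> expo m v > 0"
  obtains r where "p = Var v * r"
proof
  let ?r = "\<Sum>m\<in>mons p. term1 (m - mono1 v 1) (coef p m)"
  have "p = (\<Sum>m\<in>mons p. term1 m (coef p m))" by (rule mpol_eq_sum)
  also have "\<dots> = (\<Sum>m\<in>mons p. Var v * term1 (m - mono1 v 1) (coef p m))"
  proof (rule sum.cong)
    fix m assume "m \<in> mons p"
    then have "mono1 v 1 + (m - mono1 v 1) = m"
      using assms[of m] by (intro poly_mapping_eqI) (auto simp: lookup_add lookup_minus lookup_single when_def)
    then show "term1 m (coef p m) = Var v * term1 (m - mono1 v 1) (coef p m)"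
      by (simp add: Var_def mult_single)
  qed simp
  finally show "p = Var v * ?r" by (simp add: sum_distrib_left)
qed

text \<open>
  Multiplying by a monomial permutes coefficients without merging them, so that divisibility by a
  variable can be read off after such a multiplication.
\<close>

lemma coef_shift: "coef (term1 n c * p) (n + m) = c * coef p m"
proof (induction p rule: mpol_induct_terms)
  case (single m' d)
  then show ?case by (simp add: mult_single coef_term1)
next
  case (add p q)
  then show ?case by (simp add: algebra_simps lookup_add)
qed

lemma mons_Var_mult: "m \<in> mons (Var v * p) \<Longrightarrow> expo m v > 0"
  by (auto dest!: mons_mult simp: Var_def lookup_add)

section \<open>Gradings\<close>

lemma hom_comp_add: "p \<in> hom_comp d g \<Longrightarrow> q \<in> hom_comp d g \<Longrightarrow> p + q \<in> hom_comp d g"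
  by (auto simp: hom_comp_def dest!: mons_add)

lemma hom_comp_0 [simp]: "0 \<in> hom_comp d g"
  by (simp add: hom_comp_def)

lemma hom_comp_sum: "(\<And>i. i \<in> A \<Longrightarrow> f i \<in> hom_comp d g) \<Longrightarrow> sum f A \<in> hom_comp d g"
  by (induction A rule: infinite_finite_induct) (auto intro: hom_comp_add)

lemma hom_comp_Const_mult: "p \<in> hom_comp d g \<Longrightarrow> Const c * p \<in> hom_comp d g"
  using mons_Const_mult by (force simp: hom_comp_def)

lemma hom_comp_Var: "Var v \<in> hom_comp (wdeg_mod c w) (w v mod int c)"
  by (simp add: hom_comp_def Var_def wdeg_mod_def)

lemma hom_comp_mult:
  assumes "p \<in> hom_comp (wdeg_mod c w) (g mod int c)" "q \<in> hom_comp (wdeg_mod c w) (h mod int c)"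
  shows "p * q \<in> hom_comp (wdeg_mod c w) ((g + h) mod int c)"
proof -
  have "wdeg_mod c w m = (g + h) mod int c" if m: "m \<in> mons (p * q)" for m
  proof -
    obtain m1 m2 where "m = m1 + m2" "wdeg w m1 mod int c = g mod int c"
        "wdeg w m2 mod int c = h mod int c"
      using mons_mult[OF m] assms by (auto simp: hom_comp_def wdeg_mod_def)
    then show ?thesis using mod_add_cong by (simp add: wdeg_mod_def)
  qed
  then show ?thesis by (simp add: hom_comp_def)
qed

lemma hom_comp_Const: "Const l \<in> hom_comp (wdeg_mod c w) (0 mod int c)"
  by (simp add: hom_comp_def Const_def wdeg_mod_def)

lemma hom_comp_power:
  assumes "p \<in> hom_comp (wdeg_mod c w) (g mod int c)"
  shows "p ^ k \<in> hom_comp (wdeg_mod c w) ((int k * g) mod int c)"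
proof (induction k)
  case 0
  then show ?case using hom_comp_Const[of 1 c w] by simp
next
  case (Suc k)
  then show ?case using hom_comp_mult[OF assms Suc] by (simp add: algebra_simps)
qed

lemma hom_comp_meval:
  assumes "\<And>v. \<sigma> v \<in> hom_comp (wdeg_mod c w') (w v mod int c)"
  shows "meval \<sigma> m \<in> hom_comp (wdeg_mod c w') (wdeg_mod c w m)"
proof (induction m rule: monomial_induct)
  case zero
  then show ?case using hom_comp_Const[of 1 c w'] by (simp add: wdeg_mod_def[of c w])
next
  case (step m v)
  then show ?case using hom_comp_mult[OF step[unfolded wdeg_mod_def[of c w]] assms[of v]]
    by (simp add: meval_add meval_mono1 wdeg_mod_def[of c w])
qed

lemma hom_comp_psubst:
  assumes "\<And>v. \<sigma> v \<in> hom_comp (wdeg_mod c w') (w v mod int c)" and "p \<in> hom_comp (wdeg_mod c w) g"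
  shows "psubst \<sigma> p \<in> hom_comp (wdeg_mod c w') g"
proof -
  have "Const (coef p m) * meval \<sigma> m \<in> hom_comp (wdeg_mod c w') g" if "m \<in> mons p" for m
    using hom_comp_meval[of \<sigma> c w' w m, OF assms(1)] assms(2) that
    by (intro hom_comp_Const_mult) (auto simp: hom_comp_def)
  then show ?thesis by (subst psubst_superset[of "mons p"]) (auto intro: hom_comp_sum)
qed

lemma graded_wdeg_iff: "graded (wdeg w) \<phi> \<longleftrightarrow> (\<forall>v. \<phi> v \<in> hom_comp (wdeg w) (w v))"
proof
  assume g: "graded (wdeg w) \<phi>"
  show "\<forall>v. \<phi> v \<in> hom_comp (wdeg w) (w v)"
  proof
    fix v
    have "Var v \<in> hom_comp (wdeg w) (w v)" using hom_comp_Var[of v 0 w] by (simp add: wdeg_mod_0)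
    then show "\<phi> v \<in> hom_comp (wdeg w) (w v)"
      using g unfolding graded_def by (metis image_subset_iff psubst_Var)
  qed
next
  assume "\<forall>v. \<phi> v \<in> hom_comp (wdeg w) (w v)"
  then show "graded (wdeg w) \<phi>"
    using hom_comp_psubst[of \<phi> 0 w w] by (auto simp: graded_def wdeg_mod_0)
qed

lemma graded_comp: "graded d \<phi> \<Longrightarrow> graded d \<psi> \<Longrightarrow> graded d (\<phi> \<circ>\<^sub>e \<psi>)"
  unfolding graded_def psubst_endo_comp by blast

text \<open>
  Split the image of a homogeneous element under the inverse into the part of the right degree and
  the rest.  Mapping back, the rest contributes only monomials of other degrees, hence nothing, and
  it vanishes by injectivity.
\<close>

lemma graded_inverse:
  fixes \<phi> \<psi> :: "('v, 'k::field) endo"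
  assumes g: "graded d \<phi>" and inv: "\<phi> \<circ>\<^sub>e \<psi> = Var" "\<psi> \<circ>\<^sub>e \<phi> = Var"
  shows "graded d \<psi>"
  unfolding graded_def
proof safe
  fix h :: int and p :: "('v, 'k) mpol" assume p: "p \<in> hom_comp d h"
  define q where "q = psubst \<psi> p"
  let ?S = "{m. d m = h}"
  have split: "q = mpart ?S q + mpart (- ?S) q" by (simp add: mpart_compl)
  have "psubst \<phi> q = p" unfolding q_def using psubst_inverse(1)[OF inv(2)] by simp
  have "mpart ?S q \<in> hom_comp d h" by (simp add: hom_comp_def mons_mpart)
  then have "psubst \<phi> (mpart ?S q) \<in> hom_comp d h" using g by (auto simp: graded_def)
  moreover have "psubst \<phi> (mpart (- ?S) q) = p + Const (- 1) * psubst \<phi> (mpart ?S q)"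
    using arg_cong[OF split, of "psubst \<phi>"] \<open>psubst \<phi> q = p\<close>
    by (simp add: Const_uminus algebra_simps)
  ultimately have "psubst \<phi> (mpart (- ?S) q) \<in> hom_comp d h"
    using p by (metis hom_comp_add hom_comp_Const_mult)
  then have same: "mons (psubst \<phi> (mpart (- ?S) q)) \<subseteq> ?S"
    by (auto simp: hom_comp_def)
  have "mons (psubst \<phi> (mpart (- ?S) q)) \<inter> ?S = {}"
  proof -
    let ?q = "mpart (- ?S) q"
    have "psubst \<phi> ?q = (\<Sum>m\<in>mons ?q. psubst \<phi> (term1 m (coef ?q m)))"
      by (subst mpol_eq_sum[of ?q]) (rule psubst_sum)
    then have "mons (psubst \<phi> ?q) \<subseteq> (\<Union>m\<in>mons ?q. mons (psubst \<phi> (term1 m (coef ?q m))))"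
      by (simp only: Poly_Mapping.keys_sum)
    moreover have "mons (psubst \<phi> (term1 m (coef ?q m))) \<inter> ?S = {}" if "m \<in> mons ?q" for m
    proof -
      have "term1 m (coef ?q m) \<in> hom_comp d (d m)" by (simp add: hom_comp_def)
      then have "psubst \<phi> (term1 m (coef ?q m)) \<in> hom_comp d (d m)" using g by (auto simp: graded_def)
      then show ?thesis using that by (auto simp: hom_comp_def mons_mpart)
    qed
    ultimately show ?thesis by blast
  qed
  with same have "psubst \<phi> (mpart (- ?S) q) = 0" by (metis inf.orderE keys_eq_empty)
  then have "mpart (- ?S) q = 0" using psubst_inverse(1)[OF inv(1)] by (metis psubst_0)
  with split have "q = mpart ?S q" by simp
  with \<open>mpart ?S q \<in> hom_comp d h\<close> show "psubst \<psi> p \<in> hom_comp d h"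
    unfolding q_def[symmetric] by metis
qed

lemma carrier_graded_Aut: "\<phi> \<in> carrier (graded_Aut d) \<longleftrightarrow> \<phi> \<in> carrier poly_Aut \<and> graded d \<phi>"
  by (simp add: graded_Aut_def)

lemma subgroup_graded: "subgroup {\<phi> :: ('v, 'k::field) endo. \<phi> \<in> carrier poly_Aut \<and> graded d \<phi>} poly_Aut"
proof (rule poly_Aut.subgroupI)
  show "{\<phi> \<in> carrier poly_Aut. graded d \<phi>} \<noteq> {}"
    using poly_Aut.one_closed by (auto simp: graded_def intro!: exI[of _ Var])
next
  fix \<phi> :: "('v, 'k) endo" assume "\<phi> \<in> {\<phi> \<in> carrier poly_Aut. graded d \<phi>}"
  then show "inv\<^bsub>poly_Aut\<^esub> \<phi> \<in> {\<phi> \<in> carrier poly_Aut. graded d \<phi>}"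
    using inv_poly_Aut[of \<phi>] graded_inverse[of d \<phi>] by blast
next
  fix \<phi> \<psi> :: "('v, 'k) endo"
  assume "\<phi> \<in> {\<phi> \<in> carrier poly_Aut. graded d \<phi>}" "\<psi> \<in> {\<phi> \<in> carrier poly_Aut. graded d \<phi>}"
  then show "\<phi> \<otimes>\<^bsub>poly_Aut\<^esub> \<psi> \<in> {\<phi> \<in> carrier poly_Aut. graded d \<phi>}"
    using graded_comp[of d \<phi> \<psi>] poly_Aut_comp[of \<phi> \<psi>] by simp
qed blast

lemma group_graded_Aut: "group (graded_Aut d)"
  unfolding graded_Aut_def by (rule poly_Aut.subgroup_imp_group[OF subgroup_graded])

lemma mult_graded_Aut [simp]: "\<phi> \<otimes>\<^bsub>graded_Aut d\<^esub> \<psi> = \<phi> \<circ>\<^sub>e \<psi>"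
  by (simp add: graded_Aut_def poly_Aut_def units_of_def poly_End_def)

lemma graded_AutI:
  "graded d \<phi> \<Longrightarrow> \<phi> \<circ>\<^sub>e \<psi> = Var \<Longrightarrow> \<psi> \<circ>\<^sub>e \<phi> = Var \<Longrightarrow> \<phi> \<in> carrier (graded_Aut d)"
  by (simp add: carrier_graded_Aut poly_AutI)

section \<open>Locally nilpotent derivations\<close>

definition derivation :: "(('v, 'k::field) mpol \<Rightarrow> ('v, 'k) mpol) \<Rightarrow> bool"
  where "derivation D \<longleftrightarrow> (\<forall>p q. D (p + q) = D p + D q) \<and>
    (\<forall>p q. D (p * q) = D p * q + p * D q) \<and> (\<forall>c. D (Const c) = 0)"

definition lnd :: "(('v, 'k::field) mpol \<Rightarrow> ('v, 'k) mpol) \<Rightarrow> bool"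
  where "lnd D \<longleftrightarrow> derivation D \<and> (\<forall>p. \<exists>n. (D ^^ n) p = 0)"

lemma lnd_derivation: "lnd D \<Longrightarrow> derivation D"
  by (simp add: lnd_def)

lemma derivation_add: "derivation D \<Longrightarrow> D (p + q) = D p + D q"
  by (simp add: derivation_def)

lemma derivation_mult: "derivation D \<Longrightarrow> D (p * q) = D p * q + p * D q"
  by (simp add: derivation_def)

lemma derivation_Const: "derivation D \<Longrightarrow> D (Const c) = 0"
  by (simp add: derivation_def)

lemma derivation_0: "derivation D \<Longrightarrow> D 0 = 0"
  using derivation_Const[of D 0] by simp

lemma derivation_Const_mult: "derivation D \<Longrightarrow> D (Const c * p) = Const c * D p"
  by (simp add: derivation_mult derivation_Const)

lemma derivation_diff: "derivation D \<Longrightarrow> D (p - q) = D p - D q"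
  using derivation_add[of D p "Const (- 1) * q"] derivation_Const_mult[of D "- 1" q]
  by (simp add: Const_uminus)

lemma derivation_sum: "derivation D \<Longrightarrow> D (sum f A) = (\<Sum>i\<in>A. D (f i))"
  by (induction A rule: infinite_finite_induct) (simp_all add: derivation_0 derivation_add)

lemma derivation_power: "derivation D \<Longrightarrow> D (p ^ Suc n) = of_nat (Suc n) * p ^ n * D p"
proof (induction n)
  case 0
  then show ?case by simp
next
  case (Suc n)
  then show ?case by (simp add: derivation_mult algebra_simps)
qed

lemma derivation_pow_add: "derivation D \<Longrightarrow> (D ^^ n) (p + q) = (D ^^ n) p + (D ^^ n) q"
  by (induction n) (simp_all add: derivation_add)

lemma derivation_pow_0: "derivation D \<Longrightarrow> (D ^^ n) 0 = 0"
  by (induction n) (simp_all add: derivation_0)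

lemma derivation_pow_mono: "derivation D \<Longrightarrow> (D ^^ m) p = 0 \<Longrightarrow> m \<le> n \<Longrightarrow> (D ^^ n) p = 0"
  using funpow_add[of "n - m" m D] by (simp add: derivation_pow_0)

lemma derivation_eq_0:
  assumes D: "derivation D" and V: "\<And>v. D (Var v) = 0"
  shows "D p = 0"
  by (induction p rule: mpol_induct)
    (simp_all add: derivation_Const[OF D] V derivation_add[OF D] derivation_mult[OF D])

subsection \<open>The degree function of a locally nilpotent derivation\<close>

lemma derivation_pow_kernel_mult:
  assumes "derivation D" "D p = 0"
  shows "(D ^^ n) (p * q) = p * (D ^^ n) q"
  by (induction n) (simp_all add: derivation_mult assms)

text \<open>
  The Leibniz formula for a power of \<open>D\<close>, reduced to the only term that survives at the top order.
  Applying \<open>D\<close> once to the product and using the induction hypothesis twice turns the coefficients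
  into Pascal's recursion, which avoids the full binomial sum.
\<close>

lemma derivation_pow_top_mult:
  fixes p q :: "('v, 'k::field) mpol"
  assumes D: "derivation D"
  shows "(D ^^ Suc a) p = 0 \<Longrightarrow> (D ^^ Suc b) q = 0 \<Longrightarrow>
    (D ^^ (a + b)) (p * q) = of_nat ((a + b) choose a) * ((D ^^ a) p * (D ^^ b) q) \<and>
    (D ^^ Suc (a + b)) (p * q) = 0"
proof (induction "a + b" arbitrary: a b p q rule: less_induct)
  case less
  consider "a = 0" | "b = 0" | a' b' where "a = Suc a'" "b = Suc b'"
    by (cases a; cases b) auto
  then show ?case
  proof cases
    case 1
    then have "D p = 0" using less.prems by simp
    then show ?thesis
      using less.prems derivation_pow_kernel_mult[OF D, of p b q] derivation_pow_kernel_mult[OF D, of p "Suc b" q] 1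
      by simp
  next
    case 2
    then have "D q = 0" using less.prems by simp
    then show ?thesis
      using less.prems derivation_pow_kernel_mult[OF D, of q a p] derivation_pow_kernel_mult[OF D, of q "Suc a" p] 2
      by (simp add: mult.commute)
  next
    case 3
    have Dp: "(D ^^ Suc a') (D p) = 0" "(D ^^ a') (D p) = (D ^^ a) p"
      and Dq: "(D ^^ Suc b') (D q) = 0" "(D ^^ b') (D q) = (D ^^ b) q"
      using less.prems 3 funpow_Suc_right[of a' D] funpow_Suc_right[of b' D]
        funpow_Suc_right[of a D] funpow_Suc_right[of b D] by (auto simp: fun_eq_iff)
    have 1: "(D ^^ (a' + b)) (D p * q) = of_nat ((a' + b) choose a') * ((D ^^ a) p * (D ^^ b) q)"
      "(D ^^ Suc (a' + b)) (D p * q) = 0"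
      using less.hyps[of a' b "D p" q] Dp less.prems 3 by auto
    have 2: "(D ^^ (a + b')) (p * D q) = of_nat ((a + b') choose a) * ((D ^^ a) p * (D ^^ b) q)"
      "(D ^^ Suc (a + b')) (p * D q) = 0"
      using less.hyps[of a b' p "D q"] Dq less.prems 3 by auto
    have S: "(D ^^ Suc n) (p * q) = (D ^^ n) (D p * q) + (D ^^ n) (p * D q)" for n
      by (simp only: funpow_Suc_right o_apply derivation_mult[OF D] derivation_pow_add[OF D])
    have e: "a + b = Suc (a' + b)" "a + b = Suc (a + b')" "a' + b = a + b'" using 3 by auto
    have "(D ^^ (a + b)) (p * q) = (of_nat ((a' + b) choose a') + of_nat ((a' + b) choose a)) * ((D ^^ a) p * (D ^^ b) q)"
      using S[of "a' + b"] 1(1) 2(1) unfolding e(1) by (simp only: e(3) distrib_right)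
    also have "of_nat ((a' + b) choose a') + of_nat ((a' + b) choose a) = (of_nat ((a + b) choose a) :: ('v, 'k) mpol)"
      using 3 by simp
    finally show ?thesis using S[of "a + b"] 1(2) 2(2) e by simp
  qed
qed

text \<open>
  For the transport of \<open>\<partial>/\<partial>v\<close> along an automorphism this is the degree in the second coordinate.
  The degree of \<open>0\<close> is \<open>0\<close>, not \<open>-\<infinity>\<close>.
\<close>

definition lnd_deg :: "(('v, 'k::field) mpol \<Rightarrow> ('v, 'k) mpol) \<Rightarrow> ('v, 'k) mpol \<Rightarrow> nat"
  where "lnd_deg D p = (LEAST n. (D ^^ Suc n) p = 0)"

lemma lnd_deg_eqI:
  assumes D: "derivation D" and "(D ^^ n) p \<noteq> 0" "(D ^^ Suc n) p = 0"
  shows "lnd_deg D p = n"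
  unfolding lnd_deg_def
proof (rule Least_equality)
  fix m assume "(D ^^ Suc m) p = 0"
  then show "n \<le> m" using derivation_pow_mono[OF D, of "Suc m" p n] assms(2) by force
qed fact

lemma lnd_degE:
  assumes "lnd D" "p \<noteq> 0"
  shows "(D ^^ lnd_deg D p) p \<noteq> 0" "(D ^^ Suc (lnd_deg D p)) p = 0"
proof -
  obtain N where N: "(D ^^ N) p = 0" using assms(1) by (auto simp: lnd_def)
  define n where "n = (LEAST n. (D ^^ n) p = 0)"
  have n0: "(D ^^ n) p = 0" unfolding n_def by (rule LeastI[of _ N]) (rule N)
  then obtain k where k: "n = Suc k" using assms(2) by (cases n) auto
  have "(D ^^ k) p \<noteq> 0" using not_less_Least[of k "\<lambda>n. (D ^^ n) p = 0"] k unfolding n_def by auto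
  moreover from this have "lnd_deg D p = k"
    using n0 k lnd_deg_eqI[OF lnd_derivation[OF assms(1)]] by simp
  ultimately show "(D ^^ lnd_deg D p) p \<noteq> 0" "(D ^^ Suc (lnd_deg D p)) p = 0" using n0 k by auto
qed

text \<open>
  Characteristic zero enters here, through the binomial coefficient at the top order.
\<close>

lemma lnd_deg_mult:
  fixes p q :: "('v::linorder, 'k::field_char_0) mpol"
  assumes "lnd D" "p \<noteq> 0" "q \<noteq> 0"
  shows "lnd_deg D (p * q) = lnd_deg D p + lnd_deg D q"
proof (rule lnd_deg_eqI[OF lnd_derivation[OF assms(1)]])
  let ?a = "lnd_deg D p" and ?b = "lnd_deg D q"
  note p = lnd_degE[OF assms(1,2)] and q = lnd_degE[OF assms(1,3)]
  note top = derivation_pow_top_mult[OF lnd_derivation[OF assms(1)] p(2) q(2)]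
  have "(?a + ?b) choose ?a \<noteq> 0" by simp
  then show "(D ^^ (?a + ?b)) (p * q) \<noteq> 0"
    using top p(1) q(1) by (simp del: of_nat_add)
  show "(D ^^ Suc (?a + ?b)) (p * q) = 0" using top by blast
qed

lemma lnd_deg_D:
  assumes "lnd D" "D p \<noteq> 0"
  shows "lnd_deg D p = Suc (lnd_deg D (D p))"
proof -
  have "p \<noteq> 0" using assms derivation_0[OF lnd_derivation] by auto
  note p = lnd_degE[OF assms]
  show ?thesis
    using p by (intro lnd_deg_eqI[OF lnd_derivation[OF assms(1)]]) (simp_all del: funpow.simps add: funpow_Suc_right)
qed

lemma lnd_deg_eq_0_iff:
  assumes "lnd D" "p \<noteq> 0"
  shows "lnd_deg D p = 0 \<longleftrightarrow> D p = 0"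
  using lnd_degE[OF assms] lnd_deg_D[of D p] assms
  by (cases "D p = 0") (auto intro: lnd_deg_eqI[OF lnd_derivation])

text \<open>
  The kernel consists of the elements of degree zero, and degrees add up without cancellation.
\<close>

lemma lnd_kernel_factor:
  fixes p q :: "('v::linorder, 'k::field_char_0) mpol"
  assumes "lnd D" "D (p * q) = 0" "p * q \<noteq> 0"
  shows "D p = 0" "D q = 0"
  using lnd_deg_mult[of D p q] lnd_deg_eq_0_iff[of D p] lnd_deg_eq_0_iff[of D q]
    lnd_deg_eq_0_iff[of D "p * q"] assms by auto

lemma lnd_kernel_power:
  fixes p :: "('v::linorder, 'k::field_char_0) mpol"
  assumes "lnd D" "D (p ^ n) = 0" "p \<noteq> 0" "n > 0"
  shows "D p = 0"
proof -
  obtain k where "n = Suc k" using assms(4) by (cases n) auto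
  then show ?thesis using lnd_kernel_factor(1)[of D p "p ^ k"] assms by simp
qed

text \<open>
  A nonzero image has degree one less than its argument.  If \<open>q\<close> divides \<open>D p\<close> then \<open>p\<close> has larger
  degree than \<open>q\<close>, and vice versa.
\<close>

lemma lnd_no_cross_division:
  fixes p q :: "('v::linorder, 'k::field_char_0) mpol"
  assumes D: "lnd D" and "D p = q * r" "D q = p * t" "D p \<noteq> 0" "D q \<noteq> 0"
  shows False
proof -
  have nz: "p \<noteq> 0" "q \<noteq> 0" "r \<noteq> 0" "t \<noteq> 0" using assms by auto
  have "lnd_deg D p = Suc (lnd_deg D q + lnd_deg D r)"
    using lnd_deg_D[OF D assms(4)] lnd_deg_mult[OF D nz(2,3)] assms(2) by simp
  moreover have "lnd_deg D q = Suc (lnd_deg D p + lnd_deg D t)"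
    using lnd_deg_D[OF D assms(5)] lnd_deg_mult[OF D nz(1,4)] assms(3) by simp
  ultimately show False by linarith
qed

subsection \<open>The leading part of a derivation\<close>

text \<open>
  The component of degree \<open>d\<close> of \<open>D\<close> with respect to the grading by \<open>w\<close>.  It is a derivation for
  every \<open>d\<close>, and the leading part of \<open>D\<close> if \<open>d\<close> is the largest degree for which it is nonzero.
\<close>

definition leading :: "('v \<Rightarrow> int) \<Rightarrow> int \<Rightarrow> (('v, 'k::field) mpol \<Rightarrow> ('v, 'k) mpol)
    \<Rightarrow> ('v, 'k) mpol \<Rightarrow> ('v, 'k) mpol"
  where "leading w d D p = (\<Sum>m\<in>mons p. hpart w (wdeg w m + d) (D (term1 m (coef p m))))"

lemma mpart_sum: "mpart S (sum f A) = (\<Sum>i\<in>A. mpart S (f i))"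
  by (induction A rule: infinite_finite_induct) (simp_all add: mpart_add)

lemma leading_superset:
  assumes "derivation D" "finite A" "mons p \<subseteq> A"
  shows "leading w d D p = (\<Sum>m\<in>A. hpart w (wdeg w m + d) (D (term1 m (coef p m))))"
  unfolding leading_def using assms
  by (intro sum.mono_neutral_left) (auto simp: in_keys_iff derivation_0)

lemma leading_term1:
  "derivation D \<Longrightarrow> leading w d D (term1 m c) = hpart w (wdeg w m + d) (D (term1 m c))"
  by (subst leading_superset[of D "{m}"]) auto

lemma leading_add:
  assumes "derivation D"
  shows "leading w d D (p + q) = leading w d D p + leading w d D q"
proof -
  let ?A = "mons p \<union> mons q"
  have "mons (p + q) \<subseteq> ?A" by (rule Poly_Mapping.keys_add)
  then show ?thesis
    by (simp add: leading_superset[OF assms, of ?A] lookup_add single_add derivation_add[OF assms]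
        mpart_add sum.distrib)
qed

lemma leading_mult:
  assumes "derivation D"
  shows "leading w d D (p * q) = leading w d D p * q + p * leading w d D q"
proof (induction p rule: mpol_induct_terms)
  case (single m c)
  show ?case
  proof (induction q rule: mpol_induct_terms)
    case (single n e)
    let ?t = "term1 m c" and ?s = "term1 n e"
    have "hpart w (wdeg w m + d + wdeg w n) (D ?t * ?s) = hpart w (wdeg w m + d) (D ?t) * ?s"
      by (rule hpart_mult_hom) (simp split: if_splits)
    moreover have "hpart w (wdeg w n + d + wdeg w m) (D ?s * ?t) = hpart w (wdeg w n + d) (D ?s) * ?t"
      by (rule hpart_mult_hom) (simp split: if_splits)
    moreover have "leading w d D (?t * ?s) = hpart w (wdeg w m + wdeg w n + d) (D (?t * ?s))"
      by (simp add: mult_single leading_term1[OF assms])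
    ultimately show ?case
      by (simp add: leading_term1[OF assms] derivation_mult[OF assms] mpart_add algebra_simps)
  next
    case (add p q)
    then show ?case by (simp add: leading_add[OF assms] algebra_simps)
  qed
next
  case (add p q)
  then show ?case by (simp add: leading_add[OF assms] algebra_simps)
qed

lemma derivation_leading: "derivation D \<Longrightarrow> derivation (leading w d D)"
  unfolding derivation_def[of "leading w d D"]
  by (simp add: leading_add leading_mult leading_term1 Const_def)
    (simp add: Const_def[symmetric] derivation_Const)

lemma leading_hom:
  assumes "derivation D" "\<And>m. m \<in> mons p \<Longrightarrow> wdeg w m = n"
  shows "leading w d D p = hpart w (n + d) (D p)"
proof -
  have "D p = (\<Sum>m\<in>mons p. D (term1 m (coef p m)))"
    by (subst mpol_eq_sum[of p]) (rule derivation_sum[OF assms(1)])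
  then show ?thesis using assms(2) by (simp add: leading_def mpart_sum)
qed

context
  fixes D :: "('v, 'k::field) mpol \<Rightarrow> ('v, 'k) mpol" and w :: "'v \<Rightarrow> int" and d :: int
  assumes D: "derivation D" and bound: "\<And>v. D (Var v) \<in> below w (w v + d)"
begin

lemma derivation_below:
  assumes p: "p \<in> below w n"
  shows "D p \<in> below w (n + d)"
proof -
  have t: "D (term1 m 1) \<in> below w (wdeg w m + d)" for m
  proof (induction m rule: monomial_induct)
    case zero
    then show ?case using derivation_Const[OF D, of 1] by (simp add: Const_def)
  next
    case (step m v)
    have "D (term1 m 1) * Var v \<in> below w (wdeg w m + d + w v)"
      by (intro below_mult step below_Var order_refl)
    moreover have "term1 m 1 * D (Var v) \<in> below w (wdeg w m + (w v + d))"
      by (intro below_mult bound below_term1 order_refl)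
    ultimately show ?case
      unfolding term1_step derivation_mult[OF D] by (intro below_add) (simp_all add: algebra_simps)
  qed
  have "D p = (\<Sum>m\<in>mons p. D (term1 m (coef p m)))"
    by (subst mpol_eq_sum[of p]) (rule derivation_sum[OF D])
  moreover have "D (term1 m (coef p m)) \<in> below w (n + d)" if "m \<in> mons p" for m
  proof -
    have "D (term1 m (coef p m)) = Const (coef p m) * D (term1 m 1)"
      using derivation_Const_mult[OF D, of "coef p m" "term1 m 1"] by (simp add: Const_mult_term1)
    then show ?thesis
      using below_Const_mult[OF below_mono[OF t[of m]]] belowD[OF p that] by auto
  qed
  ultimately show ?thesis by (simp add: below_sum)
qed

lemma leading_step:
  assumes p: "p \<in> below w n"
  shows "hpart w (n + d) (D p) = leading w d D (hpart w n p)"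
proof -
  obtain p' where p': "p = hpart w n p + p'" "p' \<in> below w (n - 1)" using below_split[OF p] .
  have "D p = D (hpart w n p) + D p'" by (subst p'(1)) (rule derivation_add[OF D])
  moreover have "hpart w (n + d) (D p') = 0"
    using derivation_below[OF p'(2)] by (rule hpart_above) simp
  moreover have "leading w d D (hpart w n p) = hpart w (n + d) (D (hpart w n p))"
    by (rule leading_hom[OF D]) (simp add: mons_mpart)
  ultimately show ?thesis by (simp add: mpart_add)
qed

text \<open>
  The power \<open>D^k\<close> raises weights by at most \<open>k d\<close>, and what it does to the top weight is exactly
  the \<open>k\<close>-th power of the leading part.  Nilpotency therefore passes to the leading part.
\<close>

lemma leading_pow:
  assumes p: "p \<in> below w n"
  shows "(D ^^ k) p \<in> below w (n + int k * d) \<and>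
    hpart w (n + int k * d) ((D ^^ k) p) = (leading w d D ^^ k) (hpart w n p)"
proof (induction k)
  case 0
  then show ?case using p by simp
next
  case (Suc k)
  have e: "n + int (Suc k) * d = (n + int k * d) + d" by (simp add: algebra_simps)
  show ?case unfolding e using Suc derivation_below leading_step by simp
qed

lemma lnd_leading:
  assumes "lnd D"
  shows "lnd (leading w d D)"
  unfolding lnd_def
proof safe
  let ?L = "leading w d D"
  show L: "derivation ?L" by (rule derivation_leading[OF D])
  fix p
  show "\<exists>n. (?L ^^ n) p = 0"
  proof (induction p rule: mpol_induct_terms)
    case (single m c)
    obtain k where k: "(D ^^ k) (term1 m c) = 0" using assms by (auto simp: lnd_def)
    have "hpart w (wdeg w m) (term1 m c) = term1 m c" by (simp add: mpart_term1)
    then have "(?L ^^ k) (term1 m c) = 0"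
      using leading_pow[of "term1 m c" "wdeg w m" k, OF below_term1] k by simp
    then show ?case ..
  next
    case (add p q)
    then obtain i j where ij: "(?L ^^ i) p = 0" "(?L ^^ j) q = 0" by blast
    have "(?L ^^ max i j) p = 0" "(?L ^^ max i j) q = 0"
      by (rule derivation_pow_mono[OF L ij(1)], simp) (rule derivation_pow_mono[OF L ij(2)], simp)
    then have "(?L ^^ max i j) (p + q) = 0"
      by (simp add: derivation_pow_add[OF L])
    then show ?case ..
  qed
qed

end

text \<open>
  Choosing \<open>d\<close> as the largest increase of weight that \<open>D\<close> achieves on a variable makes the leading
  part nonzero.
\<close>

theorem lnd_kills_leading_form:
  fixes D :: "('v, 'k::field) mpol \<Rightarrow> ('v, 'k) mpol"
  assumes fin: "finite (UNIV :: 'v set)" and D: "lnd D" and nz: "D g \<noteq> 0"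
    and f: "D f = 0" "f \<in> below w n"
  obtains L where "lnd L" "\<exists>v. L (Var v) \<noteq> 0" "L (hpart w n f) = 0"
proof -
  note der = lnd_derivation[OF D]
  define S where "S = (\<Union>v. (\<lambda>m. wdeg w m - w v) ` mons (D (Var v)))"
  have "finite S" unfolding S_def using fin by simp
  have "\<exists>v. D (Var v) \<noteq> 0" using derivation_eq_0[OF der] nz by blast
  then have "S \<noteq> {}" unfolding S_def by (metis (no_types, lifting) SUP_bot_conv(1) UNIV_I empty_is_image keys_eq_empty)
  define d where "d = Max S"
  have bound: "D (Var v) \<in> below w (w v + d)" for v
  proof -
    have "wdeg w m - w v \<le> d" if "m \<in> mons (D (Var v))" for m
      unfolding d_def using \<open>finite S\<close> that by (intro Max_ge) (auto simp: S_def)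
    then show ?thesis by (force simp: below_def)
  qed
  have "d \<in> S" unfolding d_def using \<open>finite S\<close> \<open>S \<noteq> {}\<close> by (rule Max_in)
  then obtain v m where vm: "m \<in> mons (D (Var v))" "wdeg w m = w v + d"
    by (force simp: S_def)
  have "hpart w (w v) (Var v) = (Var v :: ('v, 'k) mpol)" by (simp add: Var_def mpart_term1)
  then have "leading w d D (Var v) = hpart w (w v + d) (D (Var v))"
    using leading_step[OF der bound below_Var[OF order_refl], of v] by simp
  moreover have "m \<in> mons (hpart w (w v + d) (D (Var v)))" using vm by (simp add: mons_mpart)
  ultimately have "leading w d D (Var v) \<noteq> 0" by auto
  moreover have "leading w d D (hpart w n f) = 0"
    using leading_step[OF der bound f(2)] f(1) by simp
  moreover have "lnd (leading w d D)" by (rule lnd_leading[OF der bound D])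
  ultimately show ?thesis using that by blast
qed

section \<open>The Newton polygon of a kernel element in two variables\<close>

lemma var2_cases: "x \<noteq> y \<Longrightarrow> v = x \<or> v = (y :: var2)"
  by (cases x; cases y; cases v) auto

lemma finite_var2: "finite (UNIV :: var2 set)"
proof -
  have "(UNIV :: var2 set) = {Vu, Vv}" using var2.exhaust by blast
  then show ?thesis by (metis finite.emptyI finite.insertI)
qed

text \<open>
  The weight \<open>i\<close> for the variable \<open>x\<close> and \<open>j\<close> for the other one.
\<close>

definition wt :: "var2 \<Rightarrow> int \<Rightarrow> int \<Rightarrow> var2 \<Rightarrow> int"
  where "wt x i j v = (if v = x then i else j)"

lemma wdeg_var2:
  assumes "x \<noteq> y"
  shows "wdeg w m = int (expo m x) * w x + int (expo m y) * w (y :: var2)"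
  using assms var2_cases[OF assms] by (subst wdeg_superset[of "{x, y}"]) auto

lemma monomial_eq_var2:
  assumes "x \<noteq> y" "expo m x = expo n x" "expo m y = expo n (y :: var2)"
  shows "m = n"
proof (rule poly_mapping_eqI)
  fix v show "expo m v = expo n v" using var2_cases[OF assms(1), of v] assms(2,3) by auto
qed

lemma term1_var2: "term1 (mono1 x i + mono1 y j) c = Const c * (Var x ^ i * Var y ^ j)"
  by (simp add: Var_power mult_single Const_mult_term1)

lemma expo_pair:
  assumes "x \<noteq> y"
  shows "expo (mono1 x i + mono1 y j) x = i" "expo (mono1 x i + mono1 y j) y = j"
  using assms by (auto simp: lookup_add lookup_single)

lemma lnd_not_both:
  assumes "x \<noteq> y" "\<exists>v. L (Var v) \<noteq> 0"
  shows "L (Var x) \<noteq> 0 \<or> L (Var (y :: var2)) \<noteq> 0"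
  using var2_cases[OF assms(1)] assms(2) by metis

text \<open>
  For weights that order the monomials of \<open>f\<close> lexicographically, the leading form of \<open>f\<close> is a single
  term \<open>x^n y^j\<close>.  If both exponents were positive, a nonzero derivation would kill both variables.
\<close>

lemma newton_vertex:
  fixes f :: "(var2, 'k::field_char_0) mpol"
  assumes xy: "x \<noteq> y" and D: "lnd D" "D g \<noteq> 0" "D f = 0"
    and n: "n > 0" "\<And>m. m \<in> mons f \<Longrightarrow> expo m x \<le> n"
    and m0: "m0 \<in> mons f" "expo m0 x = n"
  shows "expo m0 y = 0"
proof (rule ccontr)
  assume ne: "expo m0 y \<noteq> 0"
  define M where "M = Suc (Max ((\<lambda>m. expo m y) ` mons f))"
  have M: "expo m y < M" if "m \<in> mons f" for m
    unfolding M_def less_Suc_eq_le using that by (intro Max_ge) auto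
  define S where "S = {m \<in> mons f. expo m x = n}"
  define j where "j = Max ((\<lambda>m. expo m y) ` S)"
  have S: "finite S" "m0 \<in> S" using m0 by (auto simp: S_def)
  have jmax: "expo m y \<le> j" if "m \<in> S" for m
    unfolding j_def using that S by (intro Max_ge) auto
  have "j \<in> (\<lambda>m. expo m y) ` S" unfolding j_def using S by (intro Max_in) auto
  then obtain m1 where m1: "m1 \<in> mons f" "expo m1 x = n" "expo m1 y = j" by (auto simp: S_def)
  have j: "j > 0" using jmax[OF S(2)] ne by simp
  \<comment> \<open>weight \<open>x\<close> so heavily that the powers of \<open>y\<close> only break ties\<close>
  define w where "w = wt x (int M) 1"
  define N where "N = int M * int n + int j"
  have wdeg: "wdeg w m = int M * int (expo m x) + int (expo m y)" for m
    using xy by (simp add: wdeg_var2[OF xy] w_def wt_def)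
  have small: "wdeg w m < N" if "m \<in> mons f" "expo m x \<noteq> n" for m
  proof -
    have "expo m x + 1 \<le> n" using n(2)[OF that(1)] that(2) by simp
    then have "M * (expo m x + 1) \<le> M * n" by (intro mult_left_mono) auto
    then have "M * expo m x + expo m y < M * n" using M[OF that(1)] by simp
    then have "int (M * expo m x + expo m y) < int (M * n)" by (simp only: of_nat_less_iff)
    then show ?thesis unfolding wdeg N_def by simp
  qed
  have "f \<in> below w N"
  proof -
    have "wdeg w m \<le> N" if "m \<in> mons f" for m
      using small[OF that] jmax[of m] that by (cases "expo m x = n") (auto simp: wdeg N_def S_def)
    then show ?thesis by (simp add: below_def)
  qed
  then obtain L where L: "lnd L" "\<exists>v. L (Var v) \<noteq> 0" "L (hpart w N f) = 0"
    using lnd_kills_leading_form[OF finite_var2 D(1,2,3)] by blast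
  have "hpart w N f = term1 m1 (coef f m1)"
  proof (rule poly_mapping_eqI)
    fix m
    have "m = m1" if "m \<in> mons f" "wdeg w m = N"
    proof (rule monomial_eq_var2[OF xy])
      show "expo m x = expo m1 x" using small[OF that(1)] that(2) m1 by force
      then show "expo m y = expo m1 y" using that m1 by (simp add: wdeg N_def)
    qed
    moreover have "wdeg w m1 = N" using m1 by (simp add: wdeg N_def)
    ultimately show "coef (hpart w N f) m = coef (term1 m1 (coef f m1)) m"
      by (auto simp: coef_mpart coef_term1 in_keys_iff)
  qed
  moreover have "m1 = mono1 x n + mono1 y j"
    by (rule monomial_eq_var2[OF xy]) (simp_all add: expo_pair[OF xy] m1)
  then have "term1 m1 e = Const e * (Var x ^ n * Var y ^ j)" for e :: 'k
    using term1_var2[of x n y j e] by simp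
  ultimately have F: "hpart w N f = Const (coef f m1) * (Var x ^ n * Var y ^ j)" by simp
  have c: "Const (coef f m1) \<noteq> (0 :: (var2, 'k) mpol)"
    using m1(1) by (metis Const_def in_keys_iff lookup_single_eq lookup_zero)
  have nz: "Var x ^ n * Var y ^ j \<noteq> (0 :: (var2, 'k) mpol)" by (simp add: Var_neq_0)
  then have "L (Var x ^ n * Var y ^ j) = 0"
    using lnd_kernel_factor(2)[OF L(1), of "Const (coef f m1)"] L(3) F c by simp
  then have "L (Var x ^ n) = 0" "L (Var y ^ j) = 0"
    using lnd_kernel_factor[OF L(1) _ nz] by auto
  then have "L (Var x) = 0" "L (Var y) = 0"
    using lnd_kernel_power[OF L(1)] n(1) j Var_neq_0 by metis+
  then show False using lnd_not_both[OF xy L(2)] by simp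
qed

subsection \<open>Homogenization of a polynomial in one variable\<close>

text \<open>
  The value at \<open>(X, Y)\<close> of the form of degree \<open>g\<close> that becomes \<open>P\<close> for \<open>Y = 1\<close>.
\<close>

definition homog :: "'k::field poly \<Rightarrow> nat \<Rightarrow> ('v, 'k) mpol \<Rightarrow> ('v, 'k) mpol \<Rightarrow> ('v, 'k) mpol"
  where "homog P g X Y = (\<Sum>k\<le>g. Const (coeff P k) * (X ^ k * Y ^ (g - k)))"

lemma homog_linear_factor:
  fixes X Y :: "('v, 'k::field) mpol"
  assumes "degree Q \<le> g"
  shows "homog ([:- r, 1:] * Q) (Suc g) X Y = (X - Const r * Y) * homog Q g X Y"
proof -
  have 1: "homog (pCons 0 Q) (Suc g) X Y = X * homog Q g X Y"
    by (simp add: homog_def sum.atMost_Suc_shift sum_distrib_left mult_ac del: sum.atMost_Suc)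
  have "homog Q (Suc g) X Y = (\<Sum>k\<le>g. Const (coeff Q k) * (X ^ k * Y ^ (Suc g - k)))"
    using assms by (simp add: homog_def coeff_eq_0)
  also have "\<dots> = Y * homog Q g X Y"
    unfolding homog_def sum_distrib_left by (rule sum.cong) (simp_all add: Suc_diff_le mult_ac)
  finally have 2: "homog Q (Suc g) X Y = Y * homog Q g X Y" .
  have "homog ([:- r, 1:] * Q) (Suc g) X Y = homog (pCons 0 Q) (Suc g) X Y - Const r * homog Q (Suc g) X Y"
  proof -
    have "coeff ([:- r, 1:] * Q) k = coeff (pCons 0 Q) k - r * coeff Q k" for k by simp
    moreover have "(Const (a - r * b) :: ('v, 'k) mpol) = Const a - Const r * Const b" for a b
      using Const_add[of a "- (r * b)"] by (simp add: Const_uminus Const_mult)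
    ultimately show ?thesis
      unfolding homog_def
      by (simp only: sum_distrib_left sum_subtractf[symmetric] left_diff_distrib mult.assoc)
  qed
  then show ?thesis by (simp add: 1 2 algebra_simps)
qed

text \<open>
  Such a polynomial is a multiple of \<open>(t - r)^g\<close>, and in characteristic zero all coefficients of this
  power are nonzero.
\<close>

lemma unique_root_imp_coeffs_nonzero:
  fixes P :: "'k::{alg_closed_field, field_char_0} poly"
  assumes deg: "degree P = g" "g > 0" and uniq: "\<And>r r'. poly P r = 0 \<Longrightarrow> poly P r' = 0 \<Longrightarrow> r = r'"
    and nz: "coeff P 0 \<noteq> 0"
  obtains r where "poly P r = 0" "r \<noteq> 0" "\<And>k. k \<le> g \<Longrightarrow> coeff P k \<noteq> 0"
proof -
  have "P \<noteq> 0" using nz by auto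
  obtain A where A: "size A = degree P" "P = smult (lead_coeff P) (\<Prod>x\<in>#A. [:- x, 1:])"
    using alg_closed_imp_factorization[OF \<open>P \<noteq> 0\<close>] by blast
  have "A \<noteq> {#}" using A(1) deg by auto
  then obtain r where r: "r \<in># A" by blast
  have root: "poly P x = 0" if "x \<in># A" for x
  proof -
    obtain B where "A = add_mset x B" using multi_member_split[OF \<open>x \<in># A\<close>] by blast
    then show ?thesis by (subst A(2)) simp
  qed
  have "\<forall>x\<in>#A. x = r" using uniq root r by blast
  then have "A = replicate_mset (size A) r"
    by (metis set_mset_subset_singletonD singletonI subsetI)
  then have "A = replicate_mset g r" using A(1) deg by simp
  then have P: "P = smult (lead_coeff P) ([:- r, 1:] ^ g)"
    using A(2) by (metis image_replicate_mset prod_mset_replicate_mset)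
  have "poly P r = 0" using root r by blast
  moreover have "r \<noteq> 0" using \<open>poly P r = 0\<close> nz by (auto simp: poly_0_coeff_0)
  moreover have "coeff P k \<noteq> 0" if "k \<le> g" for k
  proof -
    have "coeff P k = lead_coeff P * (of_nat (g choose k) * 1 ^ k * (- r) ^ (g - k))"
      by (subst P) (simp add: coeff_linear_poly_power that)
    then show ?thesis using that \<open>r \<noteq> 0\<close> \<open>P \<noteq> 0\<close> by simp
  qed
  ultimately show ?thesis using that by blast
qed

text \<open>
  The assumed equation says that \<open>L\<close> kills \<open>x^q - r y^p\<close>.  If both exponents exceed one, comparing
  \<open>q x^(q-1) L x\<close> with \<open>r p y^(p-1) L y\<close> shows that \<open>y\<close> divides \<open>L x\<close> and \<open>x\<close> divides \<open>L y\<close>,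
  which is impossible.
\<close>

lemma kernel_binomial_has_linear_term:
  fixes r :: "'k::field_char_0"
  assumes xy: "x \<noteq> y" and L: "lnd L" "\<exists>v. L (Var v) \<noteq> 0" and r: "r \<noteq> 0"
    and pq: "p > 0" "q > 0" and eq: "L (Var x ^ q) = Const r * L (Var y ^ p :: (var2, 'k) mpol)"
  shows "q = 1 \<or> p = 1"
proof (rule ccontr)
  assume "\<not> ?thesis"
  then obtain p' q' where pq': "p = Suc p'" "q = Suc q'" "p' > 0" "q' > 0"
    using pq by (cases p; cases q) auto
  note der = lnd_derivation[OF L(1)]
  have E: "of_nat q * Var x ^ q' * L (Var x) = Const r * (of_nat p * Var y ^ p' * L (Var y))"
    using eq unfolding pq' derivation_power[OF der] .
  have rn: "Const r \<noteq> (0 :: (var2, 'k) mpol)"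
    using r by (metis Const_def lookup_single_eq lookup_zero)
  have nat_nz: "(of_nat p :: (var2, 'k) mpol) \<noteq> 0" "(of_nat q :: (var2, 'k) mpol) \<noteq> 0"
    using pq by auto
  have "L (Var x) = 0 \<longleftrightarrow> L (Var y) = 0"
  proof
    assume "L (Var x) = 0"
    then have "Const r * (of_nat p * Var y ^ p' * L (Var y)) = 0" using E by simp
    then show "L (Var y) = 0" using rn nat_nz by (simp add: Var_neq_0)
  next
    assume "L (Var y) = 0"
    then have "of_nat q * Var x ^ q' * L (Var x) = 0" using E by simp
    then show "L (Var x) = 0" using nat_nz by (simp add: Var_neq_0)
  qed
  then have nz: "L (Var x) \<noteq> 0" "L (Var y) \<noteq> 0" using lnd_not_both[OF xy L(2)] by auto
  \<comment> \<open>a power of one variable can be cancelled when divisibility by the other variable is tested\<close>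
  have dvd: "\<exists>t. A = Var v * t"
    if uv: "u \<noteq> v" and "n \<noteq> (0::nat)" and eq': "of_nat n * Var u ^ i * A = Var v * B"
    for u v :: var2 and n i and A B :: "(var2, 'k) mpol"
  proof -
    have "expo m v > 0" if m: "m \<in> mons A" for m
    proof -
      have "of_nat n * Var u ^ i * A = term1 (mono1 u i) (of_nat n) * A"
        by (simp add: Var_power Const_of_nat[symmetric] Const_mult_term1)
      then have "coef (of_nat n * Var u ^ i * A) (mono1 u i + m) = of_nat n * coef A m"
        by (simp only: coef_shift)
      then have "mono1 u i + m \<in> mons (Var v * B)"
        using m \<open>n \<noteq> 0\<close> eq' by (simp add: in_keys_iff)
      then show ?thesis using mons_Var_mult[of "mono1 u i + m" v B] uv
        by (simp add: lookup_add lookup_single)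
    qed
    then show ?thesis by (metis Var_dvd)
  qed
  obtain p'' q'' where pq'': "p' = Suc p''" "q' = Suc q''" using pq' by (cases p'; cases q') auto
  have "of_nat q * Var x ^ q' * L (Var x) = Var y * (Const r * (of_nat p * Var y ^ p'' * L (Var y)))"
    unfolding E unfolding pq'' by (simp add: mult_ac)
  then obtain s where s: "L (Var x) = Var y * s" using dvd[OF xy] pq(2) by blast
  have "of_nat p * Var y ^ p' * L (Var y) = Const (1 / r) * (Const r * (of_nat p * Var y ^ p' * L (Var y)))"
    using r by (simp add: mult.assoc[symmetric] Const_mult[symmetric])
  also have "\<dots> = Var x * (Const (1 / r) * (of_nat q * Var x ^ q'' * L (Var x)))"
    unfolding E[symmetric] unfolding pq'' by (simp add: mult_ac)
  finally obtain t where t: "L (Var y) = Var x * t" using dvd[OF xy[symmetric]] pq(1) by blast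
  show False using lnd_no_cross_division[OF L(1) s t nz] .
qed

text \<open>
  With weights \<open>k\<close> for \<open>x\<close> and \<open>1\<close> for \<open>y\<close>, the leading form of \<open>f\<close> has weight \<open>k s\<close> and contains all
  monomials of that weight: geometrically, \<open>f\<close> has a full edge in its Newton polygon from \<open>x^s\<close> to
  \<open>y^(k s)\<close>.  The binomial \<open>x - r y^k\<close> divides the form on this edge.
\<close>

definition exposed_binomial :: "(var2, 'k::field) mpol \<Rightarrow> var2 \<Rightarrow> var2 \<Rightarrow> nat \<Rightarrow> 'k \<Rightarrow> nat \<Rightarrow> bool"
  where "exposed_binomial f x y k r s \<longleftrightarrow> x \<noteq> y \<and> k > 0 \<and> s > 0 \<and> r \<noteq> 0 \<and>
    f \<in> below (wt x (int k) 1) (int (k * s)) \<and>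
    (\<exists>q. hpart (wt x (int k) 1) (int (k * s)) f = (Var x - Const r * Var y ^ k) * q) \<and>
    (\<forall>i\<le>s. mono1 x i + mono1 y (k * (s - i)) \<in> mons f)"

text \<open>
  By \<open>newton_vertex\<close> the Newton polygon has pure powers \<open>x^n\<close> and \<open>y^m\<close> as vertices.  For the weights
  that give both of them the same value, no monomial lies above the segment joining them: otherwise
  the leading form would be divisible by \<open>x\<close> and by \<open>y\<close>.  The leading form is thus a form in
  \<open>X = x^q\<close> and \<open>Y = y^p\<close>, where \<open>n = q s\<close>, \<open>m = p s\<close> with coprime \<open>p\<close> and \<open>q\<close>, and splits into linear
  factors \<open>X - r Y\<close>.  All of them lie in the kernel, so they coincide, since two different ones would
  put \<open>X\<close> and \<open>Y\<close> into the kernel.  Finally one of \<open>p\<close> and \<open>q\<close> is one.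
\<close>

theorem newton_edge:
  fixes f :: "(var2, 'k::{alg_closed_field, field_char_0}) mpol"
  assumes D: "lnd D" "D g \<noteq> 0" "D f = 0"
    and pos: "\<And>v. \<exists>m\<in>mons f. expo m v > 0"
  obtains x y k r s where "exposed_binomial f x y k r s"
proof -
  define x y where "x = Vu" and "y = Vv"
  have xy: "x \<noteq> y" by (simp add: x_def y_def)
  define top where "top v = Max ((\<lambda>m. expo m v) ` mons f)" for v
  have top_ge: "expo m v \<le> top v" if "m \<in> mons f" for m v
    unfolding top_def using that by (intro Max_ge) auto
  have top_pos: "top v > 0" for v using pos[of v] top_ge by (metis not_gr_zero le_zero_eq)
  have vertex: "mono1 v (top v) \<in> mons f" for v
  proof -
    have "top v \<in> (\<lambda>m. expo m v) ` mons f" unfolding top_def using pos[of v] by (intro Max_in) auto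
    then obtain m where m: "m \<in> mons f" "expo m v = top v" by auto
    obtain v' where v': "v \<noteq> v'" by (metis var2.distinct(1))
    have "expo m v' = 0"
      by (rule newton_vertex[OF v' D top_pos]) (use top_ge m in auto)
    then have "m = mono1 v (top v)" using m v' by (intro monomial_eq_var2[OF v']) (auto simp: lookup_single)
    then show ?thesis using m by simp
  qed
  define n m where "n = top x" and "m = top y"
  have nm: "n > 0" "m > 0" "mono1 x n \<in> mons f" "mono1 y m \<in> mons f"
    unfolding n_def m_def by (rule top_pos vertex)+
  define w where "w = wt x (int m) (int n)"
  have wdeg: "wdeg w \<mu> = int m * int (expo \<mu> x) + int n * int (expo \<mu> y)" for \<mu>
    using xy by (simp add: wdeg_var2[OF xy] w_def wt_def mult.commute)
  have "f \<noteq> 0" using nm(3) by auto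
  then obtain N where N: "f \<in> below w N" "hpart w N f \<noteq> 0" by (rule top_weight_exists)
  obtain L where L: "lnd L" "\<exists>v. L (Var v) \<noteq> 0" "L (hpart w N f) = 0"
    using lnd_kills_leading_form[OF finite_var2 D N(1)] by blast
  note der = lnd_derivation[OF L(1)]
  have Nge: "N \<ge> int m * int n" using belowD[OF N(1) nm(3)] by (simp add: w_def wt_def mult.commute)
  have "N = int m * int n"
  proof (rule ccontr)
    assume "N \<noteq> int m * int n"
    then have gt: "N > int m * int n" using Nge by simp
    have "expo \<mu> x > 0 \<and> expo \<mu> y > 0" if "\<mu> \<in> mons (hpart w N f)" for \<mu>
    proof (rule ccontr)
      assume a: "\<not> (expo \<mu> x > 0 \<and> expo \<mu> y > 0)"
      have \<mu>: "\<mu> \<in> mons f" "wdeg w \<mu> = N" using that by (auto simp: mons_mpart)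
      have "int m * int (expo \<mu> x) \<le> int m * int n" "int n * int (expo \<mu> y) \<le> int n * int m"
        using top_ge[OF \<mu>(1)] by (auto simp: n_def m_def intro!: mult_left_mono)
      then show False using a gt \<mu>(2) by (auto simp: wdeg algebra_simps)
    qed
    then obtain q1 q2 where "hpart w N f = Var x * q1" "hpart w N f = Var y * q2"
      by (metis Var_dvd)
    then have "L (Var x) = 0" "L (Var y) = 0"
      using lnd_kernel_factor(1)[OF L(1)] L(3) N(2) by metis+
    then show False using lnd_not_both[OF xy L(2)] by simp
  qed
  obtain p q where gcd: "n = q * gcd n m" "m = p * gcd n m" "coprime q p"
    using gcd_coprime_exists[of n m] nm(1) by auto
  define s where "s = gcd n m"
  have nq: "n = q * s" and mp: "m = p * s" using gcd by (simp_all add: s_def)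
  have pos': "p > 0" "q > 0" "s > 0" using nm nq mp by auto
  define e where "e k = mono1 x (q * k) + mono1 y (p * (s - k))" for k
  have expo_e: "expo (e k) x = q * k" "expo (e k) y = p * (s - k)" for k
    unfolding e_def by (rule expo_pair[OF xy])+
  define P where "P = (\<Sum>k\<le>s. monom (coef f (e k)) k)"
  have coeffP: "coeff P k = (if k \<le> s then coef f (e k) else 0)" for k
    by (auto simp: P_def coeff_sum)
  have e_s: "e s = mono1 x n" and e_0: "e 0 = mono1 y m" by (simp_all add: e_def nq mp)
  have Ps: "coeff P s \<noteq> 0" "coeff P 0 \<noteq> 0" using nm by (auto simp: coeffP e_s e_0 in_keys_iff)
  have degP: "degree P = s"
    using Ps(1) by (intro antisym degree_le le_degree) (auto simp: coeffP)
  have edge: "\<exists>k\<le>s. \<mu> = e k" if "wdeg w \<mu> = N" for \<mu>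
  proof -
    have "int (m * expo \<mu> x + n * expo \<mu> y) = int (m * n)"
      using that \<open>N = int m * int n\<close> by (simp add: wdeg)
    then have "m * expo \<mu> x + n * expo \<mu> y = m * n" by (simp only: of_nat_eq_iff)
    then have "s * (p * expo \<mu> x + q * expo \<mu> y) = s * (p * (q * s))"
      unfolding nq mp by (simp add: algebra_simps)
    then have E: "p * expo \<mu> x + q * expo \<mu> y = p * (q * s)" using pos' by simp
    then have "q dvd p * expo \<mu> x"
      by (metis dvd_add_left_iff dvd_triv_left dvd_mult2 mult.left_commute)
    then obtain k where k: "expo \<mu> x = q * k"
      using gcd(3) by (metis coprime_dvd_mult_right_iff dvdE)
    then have "q * (p * k + expo \<mu> y) = q * (p * s)" using E by (simp add: algebra_simps)
    then have E': "p * k + expo \<mu> y = p * s" using pos' by simp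
    then have "p * k \<le> p * s" by linarith
    then have "k \<le> s" using pos' by simp
    moreover have "expo \<mu> y = p * (s - k)" using E' by (simp add: diff_mult_distrib2)
    ultimately show ?thesis using k by (intro exI[of _ k] conjI monomial_eq_var2[OF xy]) (simp_all add: expo_e)
  qed
  have wdeg_e: "wdeg w (e k) = N" if "k \<le> s" for k
  proof -
    have "m * (q * k) + n * (p * (s - k)) = p * s * q * (k + (s - k))"
      unfolding nq mp by (simp only: distrib_left mult_ac)
    also have "\<dots> = m * n" using that by (simp add: nq mp)
    finally have "int (m * (q * k) + n * (p * (s - k))) = int (m * n)" by (rule arg_cong)
    then show ?thesis unfolding wdeg expo_e \<open>N = int m * int n\<close> by simp
  qed
  let ?X = "Var x ^ q :: (var2, 'k) mpol" and ?Y = "Var y ^ p :: (var2, 'k) mpol"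
  have F: "hpart w N f = homog P s ?X ?Y"
  proof (rule poly_mapping_eqI)
    fix \<mu>
    have "homog P s ?X ?Y = (\<Sum>k\<le>s. term1 (e k) (coef f (e k)))"
      unfolding homog_def e_def term1_var2
      by (intro sum.cong refl) (simp add: coeffP e_def power_mult)
    then have H: "coef (homog P s ?X ?Y) \<mu> = (\<Sum>k\<le>s. if e k = \<mu> then coef f (e k) else 0)"
      by (simp add: lookup_sum coef_term1)
    show "coef (hpart w N f) \<mu> = coef (homog P s ?X ?Y) \<mu>"
    proof (cases "wdeg w \<mu> = N")
      case True
      then obtain k0 where k0: "k0 \<le> s" "\<mu> = e k0" using edge by blast
      have "e k = \<mu> \<longleftrightarrow> k = k0" for k
        using k0(2) expo_e(1)[of k] expo_e(1)[of k0] pos'(2) by (metis mult_left_cancel not_gr_zero)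
      then show ?thesis unfolding H using True k0 by (simp add: coef_mpart)
    next
      case False
      then have "(\<Sum>k\<le>s. if e k = \<mu> then coef f (e k) else 0) = 0"
        using wdeg_e by (intro sum.neutral) auto
      then show ?thesis using False by (simp add: H coef_mpart)
    qed
  qed
  have root: "\<exists>Q. hpart w N f = (?X - Const r * ?Y) * Q" "L ?X = Const r * L ?Y" if "poly P r = 0" for r
  proof -
    obtain Q where Q: "P = [:- r, 1:] * Q" using \<open>poly P r = 0\<close> unfolding poly_eq_0_iff_dvd dvd_def by blast
    then have "Q \<noteq> 0" using Ps by auto
    then have "degree P = Suc (degree Q)" by (subst Q, subst degree_mult_eq) auto
    then have F': "hpart w N f = (?X - Const r * ?Y) * homog Q (degree Q) ?X ?Y"
      using F homog_linear_factor[of Q "degree Q" r ?X ?Y] Q degP by simp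
    then show "\<exists>Q. hpart w N f = (?X - Const r * ?Y) * Q" by blast
    have "L (?X - Const r * ?Y) = 0"
      using lnd_kernel_factor(1)[OF L(1), of "?X - Const r * ?Y" "homog Q (degree Q) ?X ?Y"]
        L(3) N(2) unfolding F' by blast
    then show "L ?X = Const r * L ?Y" by (simp add: derivation_diff[OF der] derivation_Const_mult[OF der])
  qed
  have uniq: "r = r'" if "poly P r = 0" "poly P r' = 0" for r r'
  proof (rule ccontr)
    assume "r \<noteq> r'"
    have "Const r * L ?Y = Const r' * L ?Y"
      using root(2)[OF that(1)] root(2)[OF that(2)] by (rule trans[OF sym])
    then have "L ?Y = 0" using \<open>r \<noteq> r'\<close> by (simp add: Const_eq_iff)
    then have "L (Var y) = 0" "L (Var x) = 0"
      using lnd_kernel_power[OF L(1)] root(2)[OF that(1)] pos' by (simp_all add: Var_neq_0)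
    then show False using lnd_not_both[OF xy L(2)] by simp
  qed
  obtain r where r: "poly P r = 0" "r \<noteq> 0" "\<And>k. k \<le> s \<Longrightarrow> coeff P k \<noteq> 0"
    using unique_root_imp_coeffs_nonzero[OF degP pos'(3) uniq Ps(2)] by blast
  have ein: "e k \<in> mons f" if "k \<le> s" for k using r(3)[OF that] that by (auto simp: coeffP in_keys_iff)
  obtain Q where Q: "hpart w N f = (?X - Const r * ?Y) * Q" using root(1)[OF r(1)] by blast
  have scale: "f \<in> below w' (int t) \<and> hpart w' (int t) f = hpart w N f"
    if "\<And>\<mu>. wdeg w \<mu> = int s * wdeg w' \<mu>" "N = int s * int t" for w' t
    using N(1) that pos' by (auto simp: below_def)
  have "q = 1 \<or> p = 1"
    by (rule kernel_binomial_has_linear_term[OF xy L(1,2) r(2) pos'(1,2) root(2)[OF r(1)]])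
  then show ?thesis
  proof
    assume q1: "q = 1"
    have "exposed_binomial f x y p r s"
    proof -
      have a1: "wdeg w \<mu> = int s * wdeg (wt x (int p) 1) \<mu>" for \<mu>
        using xy by (simp add: wdeg wdeg_var2[OF xy, of "wt x (int p) 1"] wt_def nq mp q1 algebra_simps)
      have a2: "N = int s * int (p * s)" using \<open>N = int m * int n\<close> by (simp add: nq mp q1)
      have "f \<in> below (wt x (int p) 1) (int (p * s))"
        "hpart (wt x (int p) 1) (int (p * s)) f = (Var x - Const r * Var y ^ p) * Q"
        using scale[OF a1 a2, THEN conjunct1]
          trans[OF scale[OF a1 a2, THEN conjunct2] Q[unfolded q1 power_one_right]] .
      moreover have "mono1 x i + mono1 y (p * (s - i)) \<in> mons f" if "i \<le> s" for i
        using ein[OF that] by (simp add: e_def q1)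
      ultimately show ?thesis
        unfolding exposed_binomial_def using xy pos' r(2) by blast
    qed
    then show ?thesis by (rule that)
  next
    assume p1: "p = 1"
    have r': "1 / r \<noteq> 0" using r(2) by simp
    have "exposed_binomial f y x q (1 / r) s"
    proof -
      have a1: "wdeg w \<mu> = int s * wdeg (wt y (int q) 1) \<mu>" for \<mu>
        using xy by (simp add: wdeg wdeg_var2[OF xy, of "wt y (int q) 1"] wt_def nq mp p1 algebra_simps)
      have a2: "N = int s * int (q * s)" using \<open>N = int m * int n\<close> by (simp add: nq mp p1)
      have h: "f \<in> below (wt y (int q) 1) (int (q * s))"
        "hpart (wt y (int q) 1) (int (q * s)) f = (Var x ^ q - Const r * Var y) * Q"
        using scale[OF a1 a2, THEN conjunct1]
          trans[OF scale[OF a1 a2, THEN conjunct2] Q[unfolded p1 power_one_right]] .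
      have "hpart (wt y (int q) 1) (int (q * s)) f = (Var y - Const (1 / r) * Var x ^ q) * (Const (- r) * Q)"
      proof -
        have "Const (- r) * (Var y - Const (1 / r) * Var x ^ q)
            = Const (- r) * Var y - (Const (- r) * Const (1 / r)) * (Var x ^ q :: (var2, 'k) mpol)"
          by (simp add: algebra_simps)
        also have "\<dots> = Var x ^ q - Const r * Var y"
          using r(2) by (simp add: Const_mult[symmetric]) (simp add: Const_uminus)
        finally have e: "Const (- r) * (Var y - Const (1 / r) * Var x ^ q) = (Var x ^ q - Const r * Var y :: (var2, 'k) mpol)" .
        show ?thesis unfolding h(2) e[symmetric] by (simp only: mult_ac)
      qed
      moreover have "mono1 y i + mono1 x (q * (s - i)) \<in> mons f" if "i \<le> s" for i
        using ein[of "s - i"] that by (simp add: e_def p1 add.commute)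
      ultimately show ?thesis
        unfolding exposed_binomial_def using h(1) xy[symmetric] pos' r' by blast
    qed
    then show ?thesis by (rule that)
  qed
qed

section \<open>Automorphisms of the polynomial algebra in two variables\<close>

subsection \<open>The kernel derivation of a coordinate\<close>

text \<open>
  By the Leibniz formula the elements annihilated by some power of \<open>D\<close> form a subalgebra.
\<close>

lemma lnd_by_generators:
  assumes D: "derivation D" and V: "\<And>v. \<exists>n. (D ^^ n) (Var v) = 0"
  shows "lnd D"
  unfolding lnd_def
proof safe
  fix p
  have ex: "\<exists>n. (D ^^ Suc n) p = 0" if "(D ^^ n) p = 0" for n p
    using that derivation_0[OF D] by (intro exI[of _ n]) simp
  have "\<exists>n. (D ^^ Suc n) p = 0"
  proof (induction p rule: mpol_induct)
    case (Const c)
    then show ?case using derivation_Const[OF D, of c] by (intro exI[of _ 0]) simp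
  next
    case (Var v)
    then show ?case using V ex by blast
  next
    case (add p q)
    then obtain i j where ij: "(D ^^ Suc i) p = 0" "(D ^^ Suc j) q = 0" by blast
    have "(D ^^ Suc (max i j)) p = 0" "(D ^^ Suc (max i j)) q = 0"
      by (rule derivation_pow_mono[OF D ij(1)], simp) (rule derivation_pow_mono[OF D ij(2)], simp)
    then have "(D ^^ Suc (max i j)) (p + q) = 0"
      by (simp only: derivation_pow_add[OF D] add_0)
    then show ?case by blast
  next
    case (mult p q)
    then show ?case using derivation_pow_top_mult[OF D] by blast
  qed
  then show "\<exists>n. (D ^^ n) p = 0" by blast
qed fact

definition partial :: "'v \<Rightarrow> ('v, 'k::field) mpol \<Rightarrow> ('v, 'k) mpol"
  where "partial v p = (\<Sum>m\<in>mons p. term1 (m - mono1 v 1) (of_nat (expo m v) * coef p m))"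

lemma partial_superset:
  assumes "finite A" "mons p \<subseteq> A"
  shows "partial v p = (\<Sum>m\<in>A. term1 (m - mono1 v 1) (of_nat (expo m v) * coef p m))"
  unfolding partial_def using assms by (intro sum.mono_neutral_left) (auto simp: in_keys_iff)

lemma partial_term1: "partial v (term1 m c) = term1 (m - mono1 v 1) (of_nat (expo m v) * c)"
  by (subst partial_superset[of "{m}"]) auto

lemma partial_add: "partial v (p + q) = partial v p + partial v q"
proof -
  have "mons (p + q) \<subseteq> mons p \<union> mons q" by (rule Poly_Mapping.keys_add)
  then show ?thesis
    by (simp add: partial_superset[of "mons p \<union> mons q"] lookup_add algebra_simps single_add sum.distrib)
qed

lemma partial_term1_mult: "partial v (term1 m c * term1 n d) = partial v (term1 m c) * term1 n d + term1 m c * partial v (term1 n d)"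
proof -
  have "m - mono1 v 1 + n = m + n - mono1 v 1" if "expo m v > 0"
    by (rule poly_mapping_eqI) (use that in \<open>auto simp: lookup_add lookup_minus lookup_single when_def\<close>)
  then have 1: "term1 (m - mono1 v 1 + n) (of_nat (expo m v) * (c * d)) = term1 (m + n - mono1 v 1) (of_nat (expo m v) * (c * d))"
    by (cases "expo m v = 0") auto
  have "m + (n - mono1 v 1) = m + n - mono1 v 1" if "expo n v > 0"
    by (rule poly_mapping_eqI) (use that in \<open>auto simp: lookup_add lookup_minus lookup_single when_def\<close>)
  then have 2: "term1 (m + (n - mono1 v 1)) (of_nat (expo n v) * (c * d)) = term1 (m + n - mono1 v 1) (of_nat (expo n v) * (c * d))"
    by (cases "expo n v = 0") auto
  have "partial v (term1 m c * term1 n d) = term1 (m + n - mono1 v 1) (of_nat (expo m v) * (c * d)) + term1 (m + n - mono1 v 1) (of_nat (expo n v) * (c * d))"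
    by (simp add: mult_single partial_term1 lookup_add distrib_right single_add)
  also have "\<dots> = partial v (term1 m c) * term1 n d + term1 m c * partial v (term1 n d)"
    unfolding 1[symmetric] 2[symmetric]
    by (simp add: mult_single partial_term1 mult.assoc mult.left_commute[of c])
  finally show ?thesis .
qed

lemma derivation_partial: "derivation (partial v)"
proof -
  have "partial v (p * q) = partial v p * q + p * partial v q" for p q :: "('a, 'b::field) mpol"
  proof (induction p rule: mpol_induct_terms)
    case (single m c)
    show ?case
      by (induction q rule: mpol_induct_terms)
        (simp_all add: partial_term1_mult partial_add algebra_simps)
  next
    case (add p q)
    then show ?case by (simp add: partial_add algebra_simps)
  qed
  then show ?thesis
    by (simp add: derivation_def partial_add partial_term1 Const_def)
qed

lemma partial_Var: "partial v (Var u) = (if u = v then 1 else 0)"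
  by (auto simp: Var_def partial_term1 lookup_single)

lemma lnd_partial: "lnd (partial v)"
proof (rule lnd_by_generators[OF derivation_partial])
  fix u
  have "(partial v ^^ 2) (Var u) = 0"
    using derivation_Const[OF derivation_partial, of v 1] derivation_0[OF derivation_partial, of v]
    by (auto simp: numeral_2_eq_2 partial_Var)
  then show "\<exists>n. (partial v ^^ n) (Var u) = 0" ..
qed

lemma lnd_transport:
  assumes inv: "\<phi> \<circ>\<^sub>e \<psi> = Var" "\<psi> \<circ>\<^sub>e \<phi> = Var" and D: "lnd D"
  shows "lnd (\<lambda>p. psubst \<phi> (D (psubst \<psi> p)))"
  unfolding lnd_def
proof safe
  note der = lnd_derivation[OF D]
  let ?D = "\<lambda>p. psubst \<phi> (D (psubst \<psi> p))"
  note canc = psubst_inverse(1)[OF inv(1)] psubst_inverse(1)[OF inv(2)]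
  show "derivation ?D"
    unfolding derivation_def
    by (simp add: derivation_add[OF der] derivation_mult[OF der] derivation_Const[OF der] canc)
  fix p
  have "(?D ^^ n) p = psubst \<phi> ((D ^^ n) (psubst \<psi> p))" for n
    by (induction n) (simp_all add: canc)
  moreover obtain n where "(D ^^ n) (psubst \<psi> p) = 0" using D by (auto simp: lnd_def)
  ultimately show "\<exists>n. (?D ^^ n) p = 0" by (metis psubst_0)
qed

lemma coordinate_killed_by_lnd:
  fixes \<phi> :: "(var2, 'k::field) endo"
  assumes "\<phi> \<in> carrier poly_Aut"
  obtains D g where "lnd D" "D g \<noteq> 0" "D (\<phi> Vu) = 0"
proof -
  obtain \<psi> where inv: "\<phi> \<circ>\<^sub>e \<psi> = Var" "\<psi> \<circ>\<^sub>e \<phi> = Var" using assms by (auto simp: carrier_poly_Aut)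
  let ?D = "\<lambda>p. psubst \<phi> (partial Vv (psubst \<psi> p))"
  have "?D (\<phi> Vv) \<noteq> 0" "?D (\<phi> Vu) = 0"
    using psubst_inverse(2)[OF inv(1)] by (simp_all add: partial_Var)
  then show ?thesis using that lnd_transport[OF inv lnd_partial] by blast
qed

subsection \<open>Shears\<close>

lemma psubst_cong:
  assumes "\<And>m v. m \<in> mons p \<Longrightarrow> expo m v > 0 \<Longrightarrow> \<sigma> v = \<tau> v"
  shows "psubst \<sigma> p = psubst \<tau> p"
  unfolding psubst_def
proof (rule sum.cong)
  fix m assume "m \<in> mons p"
  then have "(\<Prod>v\<in>Poly_Mapping.keys m. \<sigma> v ^ expo m v) = (\<Prod>v\<in>Poly_Mapping.keys m. \<tau> v ^ expo m v)"
    using assms[of m] by (intro prod.cong) (auto simp: in_keys_iff)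
  then show "Const (coef p m) * (\<Prod>v\<in>Poly_Mapping.keys m. \<sigma> v ^ expo m v)
      = Const (coef p m) * (\<Prod>v\<in>Poly_Mapping.keys m. \<tau> v ^ expo m v)" by simp
qed simp

definition shear :: "'v \<Rightarrow> ('v, 'k::field) mpol \<Rightarrow> ('v, 'k) endo"
  where "shear x h = Var(x := Var x + h)"

lemma shear_apply: "shear x h v = (if v = x then Var x + h else Var v)"
  by (simp add: shear_def)

lemma psubst_shear_fixes:
  assumes "\<And>m. m \<in> mons p \<Longrightarrow> expo m x = 0"
  shows "psubst (shear x h) p = p"
proof -
  have "psubst (shear x h) p = psubst Var p"
    by (rule psubst_cong) (use assms in \<open>auto simp: shear_apply\<close>)
  then show ?thesis by simp
qed

lemma shear_comp:
  assumes "\<And>m. m \<in> mons h \<Longrightarrow> expo m x = 0"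
  shows "shear x h \<circ>\<^sub>e shear x h' = shear x (h + h')"
  by (rule ext) (simp add: endo_comp_apply shear_apply psubst_shear_fixes[OF assms] algebra_simps)

lemma shear_0 [simp]: "shear x 0 = Var"
  by (simp add: shear_def)

lemma shear_inverse:
  assumes h: "\<And>m. m \<in> mons h \<Longrightarrow> expo m x = 0"
  shows "shear x h \<circ>\<^sub>e shear x (- h) = Var" "shear x (- h) \<circ>\<^sub>e shear x h = Var"
proof -
  have h': "expo m x = 0" if "m \<in> mons (- h)" for m using h that by (simp add: in_keys_iff)
  show "shear x (- h) \<circ>\<^sub>e shear x h = Var" using shear_comp[of "- h" x h, OF h'] by simp
  show "shear x h \<circ>\<^sub>e shear x (- h) = Var" by (simp add: shear_comp[OF h])
qed

lemma mons_Const_Var_power: "m \<in> mons (Const r * Var y ^ k) \<Longrightarrow> m = mono1 y k"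
  by (simp add: Var_power Const_mult_term1 split: if_splits)

lemma shear_power:
  assumes "x \<noteq> y"
  shows "shear x (Const r * Var y ^ k) \<circ>\<^sub>e shear x (Const (- r) * Var y ^ k) = Var"
    "shear x (Const (- r) * Var y ^ k) \<circ>\<^sub>e shear x (Const r * Var y ^ k) = Var"
proof -
  have h: "expo m x = 0" if "m \<in> mons (Const r * Var y ^ k)" for m
    using mons_Const_Var_power[OF that] assms by (simp add: lookup_single)
  note * = shear_inverse[of "Const r * Var y ^ k" x, OF h]
  show "shear x (Const r * Var y ^ k) \<circ>\<^sub>e shear x (Const (- r) * Var y ^ k) = Var"
    "shear x (Const (- r) * Var y ^ k) \<circ>\<^sub>e shear x (Const r * Var y ^ k) = Var"
    using * by (simp_all add: Const_uminus)
qed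

lemma below_shear_power:
  assumes "int k * w y \<le> w x"
  shows "shear x (Const r * Var y ^ k) v \<in> below w (w v)"
proof (cases "v = x")
  case True
  have "Const r * Var y ^ k \<in> below w (w x)"
    using below_mono[OF below_Const_mult[OF below_power[OF below_Var[of w y "w y", OF order_refl], of k], of r] assms] .
  then have "Var x + Const r * Var y ^ k \<in> below w (w x)"
    by (rule below_add[OF below_Var[OF order_refl]])
  then show ?thesis using True by (simp add: shear_apply)
qed (simp add: shear_apply below_Var)

subsection \<open>Reduction along an exposed binomial\<close>

definition mdeg :: "'v \<Rightarrow> ('v, 'k::zero) mpol \<Rightarrow> nat"
  where "mdeg v p = Max (insert 0 ((\<lambda>m. expo m v) ` mons p))"

lemma mdeg_le_iff: "mdeg v p \<le> n \<longleftrightarrow> (\<forall>m\<in>mons p. expo m v \<le> n)"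
  by (simp add: mdeg_def)

lemma expo_le_mdeg: "m \<in> mons p \<Longrightarrow> expo m v \<le> mdeg v p"
  using mdeg_le_iff[of v p "mdeg v p"] by simp

text \<open>
  For \<open>k = 1\<close> the edge is symmetric in the two variables, and \<open>x - r y\<close> is a multiple of
  \<open>y - x / r\<close>.
\<close>

lemma exposed_binomial_swap:
  assumes "exposed_binomial f x y 1 r s"
  shows "exposed_binomial f y x 1 (1 / r) s"
proof -
  have xy: "x \<noteq> y" and r: "r \<noteq> 0" using assms by (auto simp: exposed_binomial_def)
  obtain q where q: "hpart (wt x 1 1) (int s) f = (Var x - Const r * Var y) * q"
    using assms by (auto simp: exposed_binomial_def)
  have w: "wt y 1 1 = wt x 1 1" by (simp add: wt_def fun_eq_iff)
  have "Const (- r) * (Var y - Const (1 / r) * Var x)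
      = Const (- r) * Var y - (Const (- r) * Const (1 / r)) * (Var x :: (var2, 'a) mpol)"
    by (simp add: algebra_simps)
  also have "\<dots> = Var x - Const r * Var y"
    using r by (simp add: Const_mult[symmetric]) (simp add: Const_uminus)
  finally have e: "Const (- r) * (Var y - Const (1 / r) * Var x) = (Var x - Const r * Var y :: (var2, 'a) mpol)" .
  have "(Var x - Const r * Var y) * q = (Var y - Const (1 / r) * Var x) * (Const (- r) * q)"
    unfolding e[symmetric] by (simp only: mult_ac)
  then have 1: "\<exists>q'. hpart (wt x 1 1) (int s) f = (Var y - Const (1 / r) * Var x) * q'"
    using q by metis
  have 2: "mono1 y i + mono1 x (s - i) \<in> mons f" if "i \<le> s" for i
  proof -
    have "mono1 x (s - i) + mono1 y (s - (s - i)) \<in> mons f"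
      using assms by (simp add: exposed_binomial_def)
    then show ?thesis using that by (simp add: add.commute)
  qed
  have r': "1 / r \<noteq> 0" using r by simp
  note simps = exposed_binomial_def of_nat_1 mult_1 power_one_right
  show ?thesis
    unfolding simps w using assms[unfolded simps] xy[symmetric] r' 1 2 by blast
qed

text \<open>
  The shear preserves the weights \<open>(k, 1)\<close> and \<open>(1, 0)\<close>, so the degree in \<open>x\<close> stays at most \<open>s\<close> and
  the degree in \<open>y\<close> at most \<open>k s\<close>.  The latter could only be attained by the monomial \<open>y^(k s)\<close>.
\<close>

lemma shear_lowers_degree:
  assumes exp: "exposed_binomial f x y k r s"
  defines "f' \<equiv> psubst (shear x (Const r * Var y ^ k)) f"
  shows "mdeg x f' + mdeg y f' < mdeg x f + mdeg y f"
proof -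
  have xy: "x \<noteq> y" and k: "k > 0" and s: "s > 0" and bel: "f \<in> below (wt x (int k) 1) (int (k * s))"
    and edge: "\<And>i. i \<le> s \<Longrightarrow> mono1 x i + mono1 y (k * (s - i)) \<in> mons f"
    using exp by (auto simp: exposed_binomial_def)
  obtain q where q: "hpart (wt x (int k) 1) (int (k * s)) f = (Var x - Const r * Var y ^ k) * q"
    using exp by (auto simp: exposed_binomial_def)
  let ?e = "shear x (Const r * Var y ^ k)"
  let ?w = "wt x (int k) 1"
  have "mono1 x s \<in> mons f" "mono1 y (k * s) \<in> mons f" using edge[of s] edge[of 0] by simp_all
  then have old: "s \<le> mdeg x f" "k * s \<le> mdeg y f"
    using expo_le_mdeg[of "mono1 x s" f x] expo_le_mdeg[of "mono1 y (k * s)" f y] by simp_all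
  have wdeg: "wdeg ?w m = int k * int (expo m x) + int (expo m y)" for m
    using xy by (simp add: wdeg_var2[OF xy] wt_def mult.commute)
  have e1: "?e v \<in> below (wt x 1 0) (wt x 1 0 v)" for v
    by (rule below_shear_power) (use xy in \<open>simp add: wt_def\<close>)
  have e2: "?e v \<in> below ?w (?w v)" for v
    by (rule below_shear_power) (use xy in \<open>simp add: wt_def\<close>)
  have "f \<in> below (wt x 1 0) (int s)"
  proof -
    have "expo m x \<le> s" if "m \<in> mons f" for m
    proof -
      have "int k * int (expo m x) \<le> int k * int s"
        using belowD[OF bel that] by (simp add: wdeg)
      then show ?thesis using k by simp
    qed
    then show ?thesis using xy by (simp add: below_def wdeg_var2[OF xy] wt_def)
  qed
  then have "f' \<in> below (wt x 1 0) (int s)" unfolding f'_def by (rule below_psubst[OF e1])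
  then have new_x: "mdeg x f' \<le> s"
    using xy unfolding mdeg_le_iff by (auto simp: below_def wdeg_var2[OF xy] wt_def)
  have bel': "f' \<in> below ?w (int (k * s))" unfolding f'_def by (rule below_psubst[OF e2 bel])
  \<comment> \<open>the shear turns the binomial into the variable \<open>x\<close>, so that the pure power of \<open>y\<close> is cancelled\<close>
  obtain p' where p': "f = hpart ?w (int (k * s)) f + p'" "p' \<in> below ?w (int (k * s) - 1)"
    using below_split[OF bel] .
  have "psubst ?e (hpart ?w (int (k * s)) f) = Var x * psubst ?e q"
    unfolding q using xy by (simp add: shear_apply)
  moreover have "psubst ?e f = psubst ?e (hpart ?w (int (k * s)) f) + psubst ?e p'"
    using arg_cong[OF p'(1), of "psubst ?e"] by (simp only: psubst_add)
  ultimately have f': "f' = Var x * psubst ?e q + psubst ?e p'"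
    unfolding f'_def by (simp only:)
  have no: "mono1 y (k * s) \<notin> mons f'"
  proof
    assume "mono1 y (k * s) \<in> mons f'"
    then consider "mono1 y (k * s) \<in> mons (Var x * psubst ?e q)" | "mono1 y (k * s) \<in> mons (psubst ?e p')"
      unfolding f' using mons_add by blast
    then show False
    proof cases
      case 1
      then have "expo (mono1 y (k * s)) x > 0" by (rule mons_Var_mult)
      then show ?thesis using xy by (simp add: lookup_single)
    next
      case 2
      have "wdeg ?w (mono1 y (k * s)) \<le> int (k * s) - 1"
        by (rule belowD[OF below_psubst[OF e2 p'(2)] 2])
      then show ?thesis using xy by (simp add: wt_def)
    qed
  qed
  have "expo m y \<le> k * s - 1" if "m \<in> mons f'" for m
  proof -
    have le: "int k * int (expo m x) + int (expo m y) \<le> int (k * s)"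
      using belowD[OF bel' that] by (simp add: wdeg)
    then have "int (k * expo m x + expo m y) \<le> int (k * s)" by simp
    then have le': "k * expo m x + expo m y \<le> k * s" by (simp only: of_nat_le_iff)
    have "expo m y \<noteq> k * s"
    proof
      assume eq: "expo m y = k * s"
      then have "expo m x = 0" using le' k by simp
      then have "m = mono1 y (k * s)"
        using eq xy by (intro monomial_eq_var2[OF xy]) (auto simp: lookup_single)
      then show False using no that by simp
    qed
    then show ?thesis using le' by simp
  qed
  then have "mdeg y f' \<le> k * s - 1" unfolding mdeg_le_iff by blast
  moreover have "k * s > 0" using k s by simp
  ultimately show ?thesis using new_x old by linarith
qed

text \<open>
  Two neighbouring monomials \<open>x^s\<close> and \<open>x^(s-1) y^k\<close> of the edge have the same degree, so \<open>x\<close> and \<open>y^k\<close>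
  have the same degree as well, even though degrees are residues that cannot be divided by \<open>s\<close>.
\<close>

lemma exposed_binomial_degree:
  assumes "exposed_binomial f x y k r s" and hom: "f \<in> hom_comp (wdeg_mod c w) g"
  shows "w x mod int c = (int k * w y) mod int c"
proof -
  have s: "s > 0" and edge: "\<And>i. i \<le> s \<Longrightarrow> mono1 x i + mono1 y (k * (s - i)) \<in> mons f"
    using assms(1) by (auto simp: exposed_binomial_def)
  have d: "wdeg_mod c w m = g" if "m \<in> mons f" for m using hom that by (simp add: hom_comp_def)
  have "mono1 x s \<in> mons f" "mono1 x (s - 1) + mono1 y k \<in> mons f"
    using edge[of s] edge[of "s - 1"] s by simp_all
  from d[OF this(1)] d[OF this(2)]
  have "(int s * w x) mod int c = (int (s - 1) * w x + int k * w y) mod int c"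
    by (simp add: wdeg_mod_def)
  moreover have "int s * w x = int (s - 1) * w x + w x" using s by (simp add: algebra_simps of_nat_diff)
  ultimately have "(int (s - 1) * w x + w x) mod int c = (int (s - 1) * w x + int k * w y) mod int c"
    by simp
  then show ?thesis by (simp add: mod_eq_dvd_iff)
qed

section \<open>Graded tameness of origin-preserving automorphisms\<close>

text \<open>
  The negated weights \<open>2\<close> for \<open>u\<close> and \<open>1\<close> for \<open>v\<close>.  Being below these weights bounds monomials from
  below: \<open>f\<close> has weight at least two if and only if it has neither a constant term nor a linear term in
  \<open>v\<close>, and \<open>g\<close> has weight at least one if and only if it has no constant term.  In this form the
  conditions are visibly stable under composition.
\<close>

definition origin_order :: "var2 \<Rightarrow> int"
  where "origin_order = wt Vu (- 2) (- 1)"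

lemma low_degree_monom: "r \<noteq> 0 \<Longrightarrow> low_degree (monom r k) = k"
  unfolding low_degree_def by (rule Least_equality) (auto split: if_splits)

lemma endo_var2_eqI: "\<phi> Vu = \<psi> Vu \<Longrightarrow> \<phi> Vv = \<psi> Vv \<Longrightarrow> \<phi> = (\<psi> :: var2 \<Rightarrow> 'a)"
  by (rule ext) (metis var2.exhaust)

lemma shear_in_U_or_W:
  fixes r :: "'k::field"
  assumes "k \<ge> 2" "int a mod int c = (int k * int b) mod int c"
  shows "shear Vu (Const r * Var Vv ^ k) \<in> U_set a b c \<union> W_set a b c"
proof -
  define f where "f = monom r k"
  have "shear Vu (Const r * Var Vv ^ k) = case_var2 (Const 1 * Var Vu + upoly f (Var Vv)) (Var Vv)"
    by (rule endo_var2_eqI) (simp_all add: shear_apply f_def upoly_monom)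
  moreover have "upoly f (Var Vv) \<in> hom_comp (Gamma_tilde a b c) (int a mod int c)"
  proof -
    have "Var Vv \<in> hom_comp (Gamma_tilde a b c) (int b mod int c)"
      unfolding Gamma_tilde_def using hom_comp_Var[of Vv c "case_var2 (int a) (int b)"] by simp
    then have "Var Vv ^ k \<in> hom_comp (Gamma_tilde a b c) (int a mod int c)"
      unfolding assms(2) Gamma_tilde_def by (rule hom_comp_power)
    then show ?thesis unfolding f_def upoly_monom by (rule hom_comp_Const_mult)
  qed
  moreover have "f = 0 \<or> real (low_degree f) \<ge> real a / real b \<or>
      low_degree f > 1 \<and> real (degree f) < real a / real b"
    using assms(1) by (auto simp: f_def monom_eq_0_iff low_degree_monom degree_monom_eq)
  ultimately show ?thesis
    unfolding U_set_def W_set_def using one_neq_zero[where 'a = 'k] by blast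
qed

lemma shear_in_D:
  assumes "k \<ge> 1" "int b mod int c = (int k * int a) mod int c"
  shows "shear Vv (Const r * Var Vu ^ k) \<in> D_set a b c"
proof -
  have "[k * a = b] (mod c)"
    unfolding cong_def using assms(2) by (metis of_nat_eq_iff of_nat_mult zmod_int)
  moreover have "shear Vv (Const r * Var Vu ^ k) = case_var2 (Var Vu) (Const 1 * Var Vv + Const r * Var Vu ^ k)"
    by (rule endo_var2_eqI) (simp_all add: shear_apply)
  ultimately show ?thesis unfolding D_set_def using assms(1) by fastforce
qed

context
  fixes a b c :: nat and P :: "(var2, 'k::{alg_closed_field, field_char_0}) endo \<Rightarrow> bool"
  assumes P_D: "\<And>\<theta>. \<theta> \<in> D_set a b c \<Longrightarrow> P \<theta>"
    and P_U: "\<And>\<theta>. \<theta> \<in> U_set a b c \<Longrightarrow> P \<theta>"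
    and P_W: "\<And>\<theta>. \<theta> \<in> W_set a b c \<Longrightarrow> P \<theta>"
    and P_comp: "\<And>\<phi> \<psi>. P \<phi> \<Longrightarrow> P \<psi> \<Longrightarrow> P (\<phi> \<circ>\<^sub>e \<psi>)"
begin

lemma shears_by_sums:
  assumes "finite A" and "\<And>m. m \<in> A \<Longrightarrow>
    expo m Vv = 0 \<and> expo m Vu \<ge> 1 \<and> int b mod int c = (int (expo m Vu) * int a) mod int c"
  shows "P (shear Vv (\<Sum>m\<in>A. term1 m (h m)))"
  using assms
proof (induction A)
  case empty
  have "Var = case_var2 (Var Vu) (Const (1 :: 'k) * Var Vv + Const 0 * Var Vu ^ 1)"
    by (rule endo_var2_eqI) simp_all
  then have "(Var :: (var2, 'k) endo) \<in> D_set a b c" unfolding D_set_def by fastforce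
  then show ?case using P_D by simp
next
  case (insert m A)
  have m: "expo m Vv = 0" "expo m Vu \<ge> 1" "int b mod int c = (int (expo m Vu) * int a) mod int c"
    using insert.prems by auto
  have "m = mono1 Vu (expo m Vu)"
    using m(1) by (intro monomial_eq_var2[of Vu Vv]) (auto simp: lookup_single)
  then have t: "term1 m (h m) = Const (h m) * Var Vu ^ expo m Vu"
    by (metis Const_mult_term1 Var_power mult.right_neutral)
  have "P (shear Vv (term1 m (h m)))" unfolding t by (rule P_D[OF shear_in_D[OF m(2,3)]])
  moreover have "P (shear Vv (\<Sum>m\<in>A. term1 m (h m)))" using insert by auto
  moreover have "shear Vv (term1 m (h m)) \<circ>\<^sub>e shear Vv (\<Sum>m\<in>A. term1 m (h m))
      = shear Vv (\<Sum>m\<in>insert m A. term1 m (h m))"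
    using insert.hyps m(1) by (subst shear_comp) (simp_all split: if_splits)
  ultimately show ?case using P_comp by metis
qed

text \<open>
  Here \<open>\<phi> = (l u, G(u) + v r)\<close>.  Composing with a shear on the left removes \<open>G\<close>, so that the second
  component \<open>v r\<close> is divisible by \<open>v\<close> and \<open>r\<close> is a constant.
\<close>

lemma linear_first_component:
  fixes l :: 'k
  assumes aut: "\<phi> \<in> carrier poly_Aut" and u: "\<phi> Vu = Const l * Var Vu" and "l \<noteq> 0"
    and hom: "\<phi> Vv \<in> hom_comp (Gamma_tilde a b c) (int b mod int c)"
    and ord: "\<phi> Vv \<in> below origin_order (- 1)"
  shows "P \<phi>"
proof -
  define G where "G = mpart {m. expo m Vv = 0} (\<phi> Vv)"
  have G: "expo m Vv = 0" "m \<in> mons (\<phi> Vv)" if "m \<in> mons G" for m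
    using that by (auto simp: G_def mons_mpart)
  have "expo m Vv > 0" if "m \<in> mons (mpart (- {m. expo m Vv = 0}) (\<phi> Vv))" for m
    using that by (auto simp: mons_mpart)
  then obtain r where r: "mpart (- {m. expo m Vv = 0}) (\<phi> Vv) = Var Vv * r" by (rule Var_dvd)
  have split: "\<phi> Vv = G + Var Vv * r" unfolding G_def r[symmetric] by (simp add: mpart_compl)
  \<comment> \<open>subtracting the part in \<open>u\<close> alone leaves an automorphism whose second component is divisible by \<open>v\<close>\<close>
  define h where "h = psubst (case_var2 (Const (1 / l) * Var Vu) (Var Vv)) G"
  have hv: "expo m Vv = 0" if "m \<in> mons h" for m
  proof -
    have "Const (1 / l) * Var Vu \<in> below (wt Vv 1 0) 0"
      by (intro below_Const_mult below_Var) (simp add: wt_def)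
    then have "case_var2 (Const (1 / l) * Var Vu) (Var Vv) v \<in> below (wt Vv 1 0) (wt Vv 1 0 v)" for v
      by (cases v) (auto simp: wt_def intro: below_Var)
    moreover have "G \<in> below (wt Vv 1 0) 0"
      using G(1) by (simp add: below_def wdeg_var2[of Vv Vu] wt_def)
    ultimately have "h \<in> below (wt Vv 1 0) 0" unfolding h_def by (rule below_psubst)
    from belowD[OF this that] show ?thesis by (simp add: wdeg_var2[of Vv Vu] wt_def)
  qed
  have "psubst \<phi> h = psubst Var G"
    unfolding h_def psubst_psubst
  proof (rule psubst_cong)
    fix m v assume "m \<in> mons G" "expo m v > 0"
    then have "v = Vu" using G(1) by (cases v) auto
    then show "psubst \<phi> (case_var2 (Const (1 / l) * Var Vu) (Var Vv) v) = Var v"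
      using \<open>l \<noteq> 0\<close> by (simp add: u mult.assoc[symmetric] Const_mult[symmetric])
  qed
  then have \<phi>h: "psubst \<phi> h = G" by simp
  define \<phi>' where "\<phi>' = shear Vv (- h) \<circ>\<^sub>e \<phi>"
  have "shear Vv (- h) \<in> carrier poly_Aut" using shear_inverse[of h Vv] hv by (intro poly_AutI) auto
  then have aut': "\<phi>' \<in> carrier poly_Aut" unfolding \<phi>'_def using aut by blast
  have "\<phi>' Vv = Var Vv * r"
    unfolding \<phi>'_def endo_comp_apply by (simp add: shear_apply \<phi>h split)
  then obtain e where e: "r = Const e" "e \<noteq> 0" by (rule component_divisible_by_Var[OF aut'])
  \<comment> \<open>thus \<open>\<phi> = (l u, e v + G)\<close>, and it remains to write it with the given generators\<close>
  have monG: "expo m Vv = 0 \<and> expo m Vu \<ge> 1 \<and> int b mod int c = (int (expo m Vu) * int a) mod int c"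
    if "m \<in> mons G" for m
  proof (intro conjI)
    show z: "expo m Vv = 0" using G(1)[OF that] .
    have "wdeg origin_order m \<le> - 1" by (rule belowD[OF ord G(2)[OF that]])
    then show "expo m Vu \<ge> 1" using z by (simp add: wdeg_var2[of Vu Vv] origin_order_def wt_def)
    have "Gamma_tilde a b c m = int b mod int c" using hom G(2)[OF that] by (simp add: hom_comp_def)
    then show "int b mod int c = (int (expo m Vu) * int a) mod int c"
      using z by (simp add: Gamma_tilde_def wdeg_mod_def wdeg_var2[of Vu Vv])
  qed
  have "P (shear Vv (\<Sum>m\<in>mons G. term1 m (coef G m / e)))"
    by (rule shears_by_sums[OF finite_keys monG])
  also have "(\<Sum>m\<in>mons G. term1 m (coef G m / e)) = Const (1 / e) * G"
    by (subst (3) mpol_eq_sum[of G]) (simp add: sum_distrib_left Const_mult_term1)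
  finally have P3: "P (shear Vv (Const (1 / e) * G))" .
  have P1: "P (case_var2 (Const l * Var Vu) (Var Vv))"
  proof (rule P_U)
    show "case_var2 (Const l * Var Vu) (Var Vv) \<in> U_set a b c"
      unfolding U_set_def using \<open>l \<noteq> 0\<close> by (intro CollectI exI[of _ l] exI[of _ 0]) simp
  qed
  have P2: "P (case_var2 (Var Vu) (Const e * Var Vv))"
  proof (rule P_D)
    show "case_var2 (Var Vu) (Const e * Var Vv) \<in> D_set a b c"
      unfolding D_set_def using e(2) by (intro CollectI exI[of _ e] exI[of _ 0] exI[of _ 1]) simp
  qed
  have "\<phi> = case_var2 (Const l * Var Vu) (Var Vv) \<circ>\<^sub>e case_var2 (Var Vu) (Const e * Var Vv) \<circ>\<^sub>e shear Vv (Const (1 / e) * G)"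
  proof (rule endo_var2_eqI)
    show "\<phi> Vu = (case_var2 (Const l * Var Vu) (Var Vv) \<circ>\<^sub>e case_var2 (Var Vu) (Const e * Var Vv) \<circ>\<^sub>e shear Vv (Const (1 / e) * G)) Vu"
      by (simp add: endo_comp_apply u shear_apply)
    have "Const e * (Const (1 / e) * G) = G"
      using e(2) by (simp add: mult.assoc[symmetric] Const_mult[symmetric])
    then show "\<phi> Vv = (case_var2 (Const l * Var Vu) (Var Vv) \<circ>\<^sub>e case_var2 (Var Vu) (Const e * Var Vv) \<circ>\<^sub>e shear Vv (Const (1 / e) * G)) Vv"
      by (simp add: endo_comp_apply shear_apply split e(1) distrib_left mult.commute)
  qed
  then show ?thesis using P_comp P1 P2 P3 by metis
qed

text \<open>
  Without constant term, a polynomial in one variable is divisible by that variable, hence a multiple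
  of it; and \<open>f\<close> is not a multiple of \<open>v\<close> as it has no linear term in \<open>v\<close>.
\<close>

lemma one_variable_first_component:
  assumes aut: "\<phi> \<in> carrier poly_Aut" and ord: "\<phi> Vu \<in> below origin_order (- 2)"
    and one: "\<And>m. m \<in> mons (\<phi> Vu) \<Longrightarrow> expo m x = 0"
  obtains l where "\<phi> Vu = Const l * Var Vu" "l \<noteq> (0 :: 'k)"
proof -
  obtain y where xy: "y \<noteq> x" by (metis var2.distinct(1))
  have "expo m y > 0" if "m \<in> mons (\<phi> Vu)" for m
  proof (rule ccontr)
    assume "\<not> expo m y > 0"
    then have "wdeg origin_order m = 0" using one[OF that] by (simp add: wdeg_var2[OF xy])
    then show False using belowD[OF ord that] by simp
  qed
  then obtain r where r: "\<phi> Vu = Var y * r" by (rule Var_dvd)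
  obtain e where e: "r = Const e" "e \<noteq> 0" by (rule component_divisible_by_Var[OF aut r])
  have f: "\<phi> Vu = Const e * Var y" using r e by (simp add: mult.commute)
  then have "coef (\<phi> Vu) (mono1 y 1) = e" by (simp add: Var_def Const_mult_term1)
  then have "mono1 y 1 \<in> mons (\<phi> Vu)" using e(2) by (simp add: in_keys_iff)
  then have "wdeg origin_order (mono1 y 1) \<le> - 2" by (rule belowD[OF ord])
  then have "y = Vu" by (auto simp: origin_order_def wt_def split: if_splits)
  then show ?thesis using that f e(2) by blast
qed

text \<open>
  The property \<open>P\<close> stands for membership in any set of endomorphisms that contains \<open>D\<close>, \<open>U\<close> and \<open>W\<close> and
  is closed under composition.  The induction runs over the degrees of the first component, which is
  reduced by composing with shears on the right.
\<close>

theorem graded_tame_at_origin: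
  assumes "\<phi> \<in> carrier poly_Aut"
    and "\<And>v. \<phi> v \<in> hom_comp (Gamma_tilde a b c) (case_var2 (int a) (int b) v mod int c)"
    and "\<And>v. \<phi> v \<in> below origin_order (origin_order v)"
  shows "P \<phi>"
  using assms
proof (induction "mdeg Vu (\<phi> Vu) + mdeg Vv (\<phi> Vu)" arbitrary: \<phi> rule: less_induct)
  case less
  note aut = less.prems(1) and hom = less.prems(2) and ord = less.prems(3)
  have ordu: "\<phi> Vu \<in> below origin_order (- 2)" and ordv: "\<phi> Vv \<in> below origin_order (- 1)"
    using ord[of Vu] ord[of Vv] by (simp_all add: origin_order_def wt_def)
  show ?case
  proof (cases "\<exists>x. \<forall>m\<in>mons (\<phi> Vu). expo m x = 0")
    case True
    then obtain l where l: "\<phi> Vu = Const l * Var Vu" "l \<noteq> 0"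
      using one_variable_first_component[OF aut ordu] by metis
    have "\<phi> Vv \<in> hom_comp (Gamma_tilde a b c) (int b mod int c)" using hom[of Vv] by simp
    then show ?thesis by (rule linear_first_component[OF aut l _ ordv])
  next
    case False
    obtain D g where D: "lnd D" "D g \<noteq> 0" "D (\<phi> Vu) = 0" by (rule coordinate_killed_by_lnd[OF aut])
    obtain x y k r s where exp0: "exposed_binomial (\<phi> Vu) x y k r s"
      using newton_edge[OF D] False by (metis not_gr_zero)
    \<comment> \<open>a linear binomial is read as a multiple of \<open>v - u / r\<close>, for which the shear fixes \<open>u\<close>\<close>
    obtain x y k r s where exp: "exposed_binomial (\<phi> Vu) x y k r s" and k2: "x = Vu \<Longrightarrow> k \<ge> 2"
    proof (cases "x = Vu \<and> k = 1")
      case True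
      then have e1: "exposed_binomial (\<phi> Vu) Vu y 1 r s" using exp0 by simp
      then have "y \<noteq> Vu" unfolding exposed_binomial_def by blast
      then show ?thesis using that exposed_binomial_swap[OF e1] by blast
    next
      case False
      moreover have "k > 0" using exp0 unfolding exposed_binomial_def by blast
      ultimately have "x = Vu \<Longrightarrow> k \<ge> 2" by auto
      then show ?thesis using that exp0 by blast
    qed
    have xy: "x \<noteq> y" and k: "k > 0" using exp by (auto simp: exposed_binomial_def)
    let ?w = "case_var2 (int a) (int b)"
    have deg: "?w x mod int c = (int k * ?w y) mod int c"
      using exposed_binomial_degree[OF exp, of c ?w] hom[of Vu] by (simp add: Gamma_tilde_def)
    let ?e = "\<lambda>r. shear x (Const r * Var y ^ k)"
    have Pe: "P (?e q)" for q
    proof (cases x)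
      case Vu
      then have "y = Vv" using xy by (cases y) auto
      then show ?thesis using shear_in_U_or_W[OF k2, of a c b q] deg Vu P_U P_W by auto
    next
      case Vv
      then have "y = Vu" using xy by (cases y) auto
      then show ?thesis using shear_in_D[of k b c a q] k deg Vv P_D by auto
    qed
    have "?e r \<in> carrier poly_Aut" by (rule poly_AutI[OF shear_power[OF xy]])
    then have aut': "\<phi> \<circ>\<^sub>e ?e r \<in> carrier poly_Aut" using aut by blast
    have e_hom: "?e r v \<in> hom_comp (Gamma_tilde a b c) (?w v mod int c)" for v
    proof (cases "v = x")
      case True
      have "Var y ^ k \<in> hom_comp (Gamma_tilde a b c) (?w x mod int c)"
        unfolding deg Gamma_tilde_def by (rule hom_comp_power[OF hom_comp_Var])
      then have "Var x + Const r * Var y ^ k \<in> hom_comp (Gamma_tilde a b c) (?w x mod int c)"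
        unfolding Gamma_tilde_def by (intro hom_comp_add hom_comp_Var hom_comp_Const_mult)
      then show ?thesis using True by (simp add: shear_apply)
    next
      case False
      then show ?thesis using hom_comp_Var by (simp add: shear_apply Gamma_tilde_def)
    qed
    have e_ord: "?e r v \<in> below origin_order (origin_order v)" for v
    proof (rule below_shear_power)
      show "int k * origin_order y \<le> origin_order x"
        using xy k k2 by (cases x; cases y) (auto simp: origin_order_def wt_def)
    qed
    have "P (\<phi> \<circ>\<^sub>e ?e r)"
    proof (rule less.hyps[OF _ aut'])
      show "mdeg Vu ((\<phi> \<circ>\<^sub>e ?e r) Vu) + mdeg Vv ((\<phi> \<circ>\<^sub>e ?e r) Vu) < mdeg Vu (\<phi> Vu) + mdeg Vv (\<phi> Vu)"
        using shear_lowers_degree[OF exp] xy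
        by (cases x; cases y) (simp_all add: endo_comp_apply add.commute)
      show "(\<phi> \<circ>\<^sub>e ?e r) v \<in> hom_comp (Gamma_tilde a b c) (?w v mod int c)" for v
        unfolding endo_comp_apply Gamma_tilde_def
        by (rule hom_comp_psubst) (use e_hom hom in \<open>simp_all add: Gamma_tilde_def\<close>)
      show "(\<phi> \<circ>\<^sub>e ?e r) v \<in> below origin_order (origin_order v)" for v
        unfolding endo_comp_apply by (rule below_psubst[OF e_ord ord])
    qed
    then have "P (\<phi> \<circ>\<^sub>e ?e r \<circ>\<^sub>e ?e (- r))" using P_comp Pe by blast
    then show ?thesis by (simp add: endo_comp_assoc shear_power(1)[OF xy])
  qed
qed

end

section \<open>Graded automorphisms in three variables\<close>

lemma endo_var3_eqI: "\<phi> Vx = \<psi> Vx \<Longrightarrow> \<phi> Vy = \<psi> Vy \<Longrightarrow> \<phi> Vz = \<psi> Vz \<Longrightarrow> \<phi> = (\<psi> :: var3 \<Rightarrow> 'a)"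
  by (rule ext) (metis var3.exhaust)

lemma wdeg_var3:
  "wdeg w m = int (expo m Vx) * w Vx + int (expo m Vy) * w Vy + int (expo m Vz) * w Vz"
proof -
  have "v \<in> {Vx, Vy, Vz}" for v by (cases v) auto
  then show ?thesis by (subst wdeg_superset[of "{Vx, Vy, Vz}"]) auto
qed

lemma graded_Gamma_iff:
  "graded (Gamma a b c) \<phi> \<longleftrightarrow>
    (\<forall>v. \<phi> v \<in> hom_comp (Gamma a b c) (case_var3 (int a) (int b) (- int c) v))"
  unfolding Gamma_def by (rule graded_wdeg_iff)

lemma graded_Gamma_component:
  assumes "\<phi> \<in> carrier (graded_Aut (Gamma a b c))"
  shows "\<phi> v \<in> hom_comp (Gamma a b c) (case_var3 (int a) (int b) (- int c) v)"
  using assms unfolding carrier_graded_Aut graded_Gamma_iff by blast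

lemma degree_of_z_divisible:
  assumes "p \<in> hom_comp (Gamma a b c) (- int c)" "c > 0"
  obtains h where "p = Var Vz * h"
proof -
  have "expo m Vz > 0" if "m \<in> mons p" for m
  proof (rule ccontr)
    assume "\<not> expo m Vz > 0"
    moreover have "wdeg (case_var3 (int a) (int b) (- int c)) m = - int c"
      using assms(1) that by (simp add: hom_comp_def Gamma_def)
    ultimately have "int (expo m Vx) * int a + int (expo m Vy) * int b = - int c" by (simp add: wdeg_var3)
    moreover have "int (expo m Vx) * int a + int (expo m Vy) * int b \<ge> 0" by simp
    ultimately show False using assms(2) by linarith
  qed
  then show ?thesis using Var_dvd that by metis
qed

lemma graded_Aut_scales_z:
  fixes \<phi> :: "(var3, 'k::field) endo"
  assumes \<phi>: "\<phi> \<in> carrier (graded_Aut (Gamma a b c))" and "c > 0"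
  obtains l where "l \<noteq> 0" "\<phi> Vz = Const l * Var Vz"
proof -
  have "\<phi> Vz \<in> hom_comp (Gamma a b c) (- int c)"
    using graded_Gamma_component[OF \<phi>, of Vz] by simp
  then obtain h where h: "\<phi> Vz = Var Vz * h" using degree_of_z_divisible[OF _ \<open>c > 0\<close>] by blast
  have "\<phi> \<in> carrier poly_Aut" using \<phi> by (simp add: carrier_graded_Aut)
  then obtain l where "h = Const l" "l \<noteq> 0" using h by (rule component_divisible_by_Var)
  then show ?thesis using that h by (simp add: mult.commute)
qed

subsection \<open>Dehomogenization\<close>

lemma one_graded_Aut [simp]: "\<one>\<^bsub>graded_Aut d\<^esub> = Var"
  by (simp add: graded_Aut_def poly_Aut_def units_of_def poly_End_def)

lemma alpha_simps:
  "alpha \<phi> Vu = psubst (case_var3 (Var Vu) (Var Vv) 1) (\<phi> Vx)"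
  "alpha \<phi> Vv = psubst (case_var3 (Var Vu) (Var Vv) 1) (\<phi> Vy)"
  by (simp_all add: alpha_def Let_def)

lemma alpha_Var [simp]: "alpha Var = Var"
  by (rule endo_var2_eqI) (simp_all add: alpha_simps)

lemma alpha_comp:
  assumes "\<psi> Vz = Var Vz"
  shows "alpha (\<phi> \<circ>\<^sub>e \<psi>) = alpha \<phi> \<circ>\<^sub>e alpha \<psi>"
proof -
  let ?\<sigma> = "case_var3 (Var Vu) (Var Vv) 1"
  have "psubst ?\<sigma> (\<psi> v) = psubst (alpha \<psi>) (?\<sigma> v)" for v
    using assms by (cases v) (simp_all add: alpha_simps)
  then have "psubst ?\<sigma> (psubst \<psi> p) = psubst (alpha \<psi>) (psubst ?\<sigma> p)" for p
    by (simp add: psubst_psubst)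
  then show ?thesis by (intro endo_var2_eqI) (simp_all add: alpha_simps endo_comp_apply)
qed

lemma E_setD:
  assumes "\<phi> \<in> E_set a b c"
  shows "\<phi> \<in> carrier (graded_Aut (Gamma a b c))" "\<phi> Vz = Var Vz"
  using assms by (auto simp: E_set_def)

lemma E_set_comp:
  assumes "\<phi> \<in> E_set a b c" "\<psi> \<in> E_set a b c"
  shows "\<phi> \<circ>\<^sub>e \<psi> \<in> E_set a b c"
proof -
  have "\<phi> \<circ>\<^sub>e \<psi> \<in> carrier (graded_Aut (Gamma a b c))"
    using group.is_monoid[OF group_graded_Aut, THEN monoid.m_closed, OF E_setD(1)[OF assms(1)] E_setD(1)[OF assms(2)]]
    by simp
  then show ?thesis using assms by (simp add: E_set_def endo_comp_apply)
qed

lemma E_set_Var: "Var \<in> E_set a b c"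
  using group.is_monoid[OF group_graded_Aut, THEN monoid.one_closed, of "Gamma a b c"]
  by (simp add: E_set_def)

lemma E_set_inverse:
  assumes "\<phi> \<in> E_set a b c"
  defines "\<psi> \<equiv> inv\<^bsub>graded_Aut (Gamma a b c)\<^esub> \<phi>"
  shows "\<psi> \<in> E_set a b c" "\<phi> \<circ>\<^sub>e \<psi> = Var" "\<psi> \<circ>\<^sub>e \<phi> = Var"
proof -
  interpret group "graded_Aut (Gamma a b c)" by (rule group_graded_Aut)
  note \<phi> = E_setD[OF assms(1)]
  show 1: "\<phi> \<circ>\<^sub>e \<psi> = Var" and 2: "\<psi> \<circ>\<^sub>e \<phi> = Var"
    using r_inv[OF \<phi>(1)] l_inv[OF \<phi>(1)] by (simp_all add: \<psi>_def)
  have "\<psi> Vz = Var Vz" using psubst_inverse(2)[OF 1, of Vz] \<phi>(2) by simp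
  then show "\<psi> \<in> E_set a b c" using inv_closed[OF \<phi>(1)] by (simp add: E_set_def \<psi>_def)
qed

lemma alpha_in_poly_Aut:
  assumes "\<phi> \<in> E_set a b c"
  shows "alpha \<phi> \<in> carrier poly_Aut"
proof -
  note inv = E_set_inverse[OF assms]
  show ?thesis
  proof (rule poly_AutI)
    show "alpha \<phi> \<circ>\<^sub>e alpha (inv\<^bsub>graded_Aut (Gamma a b c)\<^esub> \<phi>) = Var"
      using alpha_comp[of "inv\<^bsub>graded_Aut (Gamma a b c)\<^esub> \<phi>" \<phi>, OF E_setD(2)[OF inv(1)]] inv(2) by simp
    show "alpha (inv\<^bsub>graded_Aut (Gamma a b c)\<^esub> \<phi>) \<circ>\<^sub>e alpha \<phi> = Var"
      using alpha_comp[of \<phi> "inv\<^bsub>graded_Aut (Gamma a b c)\<^esub> \<phi>", OF E_setD(2)[OF assms]] inv(3) by simp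
  qed
qed

text \<open>
  A monomial \<open>x^i y^j z^k\<close> of degree \<open>i a + j b - k c\<close> loses the nonnegative number \<open>k\<close> under \<open>z = 1\<close>.
  Hence the degree in \<open>u\<close>, \<open>v\<close> agrees with the original one modulo \<open>c\<close>, and is at least as large;
  the second statement expresses this with negated weights.
\<close>

lemma alpha_component:
  fixes \<phi> :: "(var3, 'k::field) endo"
  assumes "\<phi> \<in> E_set a b c"
  shows "alpha \<phi> v \<in> hom_comp (Gamma_tilde a b c) (case_var2 (int a) (int b) v mod int c)"
    "alpha \<phi> v \<in> below (case_var2 (- int a) (- int b)) (case_var2 (- int a) (- int b) v)"
proof -
  let ?w = "case_var3 (int a) (int b) (- int c)" and ?w2 = "case_var2 (int a) (int b)"
  let ?\<sigma> = "case_var3 (Var Vu) (Var Vv) 1 :: var3 \<Rightarrow> (var2, 'k) mpol"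
  obtain x where x: "alpha \<phi> v = psubst ?\<sigma> (\<phi> x)" "?w2 v = ?w x"
    "case_var2 (- int a) (- int b) v = - ?w x"
    by (cases v) (use alpha_simps[of \<phi>] in fastforce)+
  have hom: "wdeg ?w m = ?w x" if "m \<in> mons (\<phi> x)" for m
    using graded_Gamma_component[OF E_setD(1)[OF assms], of x] that by (simp add: hom_comp_def Gamma_def)
  have \<sigma>: "?\<sigma> u \<in> hom_comp (wdeg_mod c ?w2) (?w u mod int c)" for u
    using hom_comp_Var[of Vu c ?w2] hom_comp_Var[of Vv c ?w2] hom_comp_Const[of 1 c ?w2]
    by (cases u) simp_all
  have "\<phi> x \<in> hom_comp (wdeg_mod c ?w) (?w x mod int c)"
    using hom by (simp add: hom_comp_def wdeg_mod_def)
  from hom_comp_psubst[OF \<sigma> this]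
  show "alpha \<phi> v \<in> hom_comp (Gamma_tilde a b c) (?w2 v mod int c)"
    unfolding Gamma_tilde_def x .
  have "?\<sigma> u \<in> below (case_var2 (- int a) (- int b)) (- ?w u)" for u
    using below_Const[of "int c" 1] by (cases u) (auto intro: below_Var)
  moreover have "\<phi> x \<in> below (\<lambda>u. - ?w u) (- ?w x)"
    using hom by (force simp: below_def wdeg_def sum_negf)
  ultimately show "alpha \<phi> v \<in> below (case_var2 (- int a) (- int b)) (case_var2 (- int a) (- int b) v)"
    unfolding x by (rule below_psubst)
qed

text \<open>
  Here \<open>a > b\<close> is essential: it excludes the monomial \<open>v\<close> of weight \<open>b\<close> from the first component.
\<close>

lemma alpha_origin_order:
  assumes "\<phi> \<in> E_set a b c" "a > b" "b > 0"
  shows "alpha \<phi> v \<in> below origin_order (origin_order v)"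
  unfolding below_def
proof (intro CollectI ballI)
  fix m assume m: "m \<in> mons (alpha \<phi> v)"
  let ?i = "expo m Vu" and ?j = "expo m Vv"
  have "wdeg (case_var2 (- int a) (- int b)) m \<le> case_var2 (- int a) (- int b) v"
    by (rule belowD[OF alpha_component(2)[OF assms(1)] m])
  then have le: "case_var2 (int a) (int b) v \<le> int (?i * a + ?j * b)"
    by (cases v) (simp_all add: wdeg_var2[of Vu Vv])
  have "2 * ?i + ?j \<ge> 1" using le assms(2,3) by (cases v; cases ?i; cases ?j) auto
  moreover have "2 * ?i + ?j \<ge> 2" if "v = Vu"
  proof (rule ccontr)
    assume "\<not> 2 * ?i + ?j \<ge> 2"
    then have "?i = 0" "?j \<le> 1" by auto
    then have "?i * a + ?j * b \<le> b" using mult_le_mono1[of ?j 1 b] by simp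
    moreover have "int a \<le> int (?i * a + ?j * b)" using le that by (simp only: var2.case)
    then have "a \<le> ?i * a + ?j * b" by (simp only: of_nat_le_iff)
    ultimately show False using assms(2) by linarith
  qed
  ultimately show "wdeg origin_order m \<le> origin_order v"
    by (cases v) (auto simp: wdeg_var2[of Vu Vv] origin_order_def wt_def)
qed

subsection \<open>Triangular automorphisms\<close>

text \<open>
  The triangular maps of which both \<open>U\<close> and \<open>W\<close> consist.  The two sets differ only in the monomials
  allowed in \<open>f\<close>.
\<close>

definition lower :: "'k::field \<Rightarrow> 'k poly \<Rightarrow> (var2, 'k) endo"
  where "lower l f = case_var2 (Const l * Var Vu + upoly f (Var Vv)) (Var Vv)"

definition hom_poly :: "nat \<Rightarrow> nat \<Rightarrow> nat \<Rightarrow> 'k::field poly \<Rightarrow> bool"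
  where "hom_poly a b c f \<longleftrightarrow> upoly f (Var Vv) \<in> hom_comp (Gamma_tilde a b c) (int a mod int c)"

lemma hom_poly_add: "hom_poly a b c f \<Longrightarrow> hom_poly a b c g \<Longrightarrow> hom_poly a b c (f + g)"
  by (simp add: hom_poly_def upoly_add hom_comp_add)

lemma hom_poly_smult: "hom_poly a b c f \<Longrightarrow> hom_poly a b c (smult l f)"
  by (simp add: hom_poly_def upoly_smult hom_comp_Const_mult)

lemma hom_poly_coeff:
  assumes "hom_poly a b c f" "coeff f j \<noteq> 0"
  shows "int a mod int c = (int j * int b) mod int c"
proof -
  have "mono1 Vv j \<in> mons (upoly f (Var Vv))" using assms(2) by (simp add: in_keys_iff coef_upoly_Var)
  then show ?thesis using assms(1) by (auto simp: hom_poly_def hom_comp_def Gamma_tilde_def wdeg_mod_def)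
qed

lemma low_degree_coeff: "f \<noteq> 0 \<Longrightarrow> coeff f (low_degree f) \<noteq> 0"
  unfolding low_degree_def by (rule LeastI_ex) (metis leading_coeff_0_iff)

lemma low_degree_le: "coeff f j \<noteq> 0 \<Longrightarrow> low_degree f \<le> j"
  unfolding low_degree_def by (rule Least_le)

text \<open>
  Conditions on each coefficient, unlike those on the smallest and the largest degree, need no case
  distinction for \<open>0\<close> and are evidently inherited by linear combinations.
\<close>

lemma U_set_lower:
  "\<theta> \<in> U_set a b c \<longleftrightarrow> (\<exists>l f. \<theta> = lower l f \<and> l \<noteq> 0 \<and> hom_poly a b c f \<and>
    (\<forall>j. coeff f j \<noteq> 0 \<longrightarrow> real j \<ge> real a / real b))"
proof -
  have "(f = 0 \<or> real (low_degree f) \<ge> real a / real b) \<longleftrightarrow>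
      (\<forall>j. coeff f j \<noteq> 0 \<longrightarrow> real j \<ge> real a / real b)" for f :: "'a poly"
    using low_degree_coeff[of f] low_degree_le[of f]
    by (metis coeff_0 of_nat_le_iff order_trans)
  then show ?thesis unfolding U_set_def lower_def hom_poly_def by auto
qed

lemma W_set_lower:
  "\<theta> \<in> W_set a b c \<longleftrightarrow> (\<exists>l f. \<theta> = lower l f \<and> l \<noteq> 0 \<and> hom_poly a b c f \<and>
    (\<forall>j. coeff f j \<noteq> 0 \<longrightarrow> j > 1 \<and> real j < real a / real b))"
proof -
  have "(f = 0 \<or> low_degree f > 1 \<and> real (degree f) < real a / real b) \<longleftrightarrow>
      (\<forall>j. coeff f j \<noteq> 0 \<longrightarrow> j > 1 \<and> real j < real a / real b)" (is "?L \<longleftrightarrow> ?R") for f :: "'a poly"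
  proof
    assume L: ?L
    show ?R
    proof (intro allI impI)
      fix j assume j: "coeff f j \<noteq> 0"
      then have "f \<noteq> 0" by auto
      then have "low_degree f > 1" "real (degree f) < real a / real b" using L by auto
      moreover have "low_degree f \<le> j" "j \<le> degree f" using low_degree_le[OF j] le_degree[OF j] by auto
      ultimately show "j > 1 \<and> real j < real a / real b" by linarith
    qed
  next
    assume R: ?R
    show ?L
    proof (cases "f = 0")
      case False
      then show ?thesis using R low_degree_coeff[OF False] by (simp add: leading_coeff_neq_0)
    qed simp
  qed
  then show ?thesis unfolding W_set_def lower_def hom_poly_def by auto
qed

lemma lower_comp: "lower l f \<circ>\<^sub>e lower m g = lower (l * m) (smult l g + f)"
  by (rule endo_var2_eqI)
    (simp_all add: endo_comp_apply lower_def upoly_add upoly_smult Const_mult algebra_simps)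

lemma lower_1_0: "lower 1 0 = Var"
  by (rule endo_var2_eqI) (simp_all add: lower_def)

lemma W_set_comp:
  assumes "\<theta> \<in> W_set a b c" "\<tau> \<in> W_set a b c"
  shows "\<theta> \<circ>\<^sub>e \<tau> \<in> W_set a b c"
proof -
  obtain l f m g where *: "\<theta> = lower l f" "l \<noteq> 0" "hom_poly a b c f"
      "\<forall>j. coeff f j \<noteq> 0 \<longrightarrow> j > 1 \<and> real j < real a / real b"
      "\<tau> = lower m g" "m \<noteq> 0" "hom_poly a b c g"
      "\<forall>j. coeff g j \<noteq> 0 \<longrightarrow> j > 1 \<and> real j < real a / real b"
    using assms unfolding W_set_lower by blast
  have "\<forall>j. coeff (smult l g + f) j \<noteq> 0 \<longrightarrow> j > 1 \<and> real j < real a / real b"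
    using *(4,8) by (metis add_0 coeff_add coeff_smult mult_zero_right)
  then show ?thesis
    unfolding W_set_lower using * lower_comp[of l f m g] hom_poly_add hom_poly_smult
    by (metis no_zero_divisors)
qed

lemma W_set_inverse:
  assumes "\<tau> \<in> W_set a b c"
  obtains \<tau>' where "\<tau>' \<in> W_set a b c" "\<tau> \<circ>\<^sub>e \<tau>' = Var" "\<tau>' \<circ>\<^sub>e \<tau> = Var"
proof -
  obtain l f where *: "\<tau> = lower l f" "l \<noteq> 0" "hom_poly a b c f"
      "\<forall>j. coeff f j \<noteq> 0 \<longrightarrow> j > 1 \<and> real j < real a / real b"
    using assms unfolding W_set_lower by blast
  let ?\<tau>' = "lower (1 / l) (smult (- 1 / l) f)"
  have "\<tau> \<circ>\<^sub>e ?\<tau>' = Var" "?\<tau>' \<circ>\<^sub>e \<tau> = Var"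
    using *(2) by (simp_all add: *(1) lower_comp lower_1_0 smult_add_left[symmetric])
  moreover have "?\<tau>' \<in> W_set a b c"
    unfolding W_set_lower using * hom_poly_smult[OF *(3), of "- 1 / l"]
    by (intro exI[of _ "1 / l"] exI[of _ "smult (- 1 / l) f"]) simp
  ultimately show ?thesis using that by blast
qed

lemma W_set_in_poly_Aut: "\<tau> \<in> W_set a b c \<Longrightarrow> \<tau> \<in> carrier poly_Aut"
  by (metis W_set_inverse poly_AutI)

lemma Var_in_W_set: "Var \<in> W_set a b c"
  unfolding W_set_lower lower_1_0[symmetric]
  by (intro exI[of _ 1] exI[of _ 0]) (simp add: hom_poly_def)

text \<open>
  The monomial \<open>v^j\<close> lifts to \<open>y^j z^N\<close> of degree \<open>j b - N c = a\<close>.  The required exponent \<open>N\<close> is an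
  integer by homogeneity modulo \<open>c\<close>, and nonnegative by the bound on degrees that defines \<open>U\<close>.
\<close>

lemma U_set_lift:
  fixes \<theta> :: "(var2, 'k::field) endo"
  assumes "\<theta> \<in> U_set a b c" "b > 0" "c > 0"
  obtains \<phi> where "\<phi> \<in> E_set a b c" "alpha \<phi> = \<theta>"
proof -
  obtain l f where *: "\<theta> = lower l f" "l \<noteq> 0" "hom_poly a b c f"
      "\<And>j. coeff f j \<noteq> 0 \<Longrightarrow> real j \<ge> real a / real b"
    using assms(1) unfolding U_set_lower by blast
  define N where "N j = (j * b - a) div c" for j
  have N: "int (j * b) - int c * int (N j) = int a" if "coeff f j \<noteq> 0" for j
  proof -
    have "real a \<le> real (j * b)" using *(4)[OF that] assms(2) by (simp add: field_simps)
    then have le: "a \<le> j * b" by (simp only: of_nat_le_iff)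
    have "int c dvd int (j * b) - int a"
      using hom_poly_coeff[OF *(3) that] by (metis mod_eq_dvd_iff of_nat_mult)
    then have "c dvd j * b - a" using le by (metis int_dvd_int_iff of_nat_diff)
    then have "c * N j = j * b - a" by (simp add: N_def)
    then have "int c * int (N j) = int (j * b - a)" by (metis of_nat_mult)
    then show ?thesis using le by (simp add: of_nat_diff)
  qed
  define R :: "(var3, 'k) mpol" where "R = (\<Sum>j\<le>degree f. Const (coeff f j) * (Var Vy ^ j * Var Vz ^ N j))"
  have R_fixed: "psubst \<sigma> R = R" if "\<sigma> Vy = Var Vy" "\<sigma> Vz = Var Vz" for \<sigma>
    by (simp add: R_def that)
  define \<phi> \<psi> where "\<phi> = case_var3 (Const l * Var Vx + R) (Var Vy) (Var Vz)"
    and "\<psi> = case_var3 (Const (1 / l) * Var Vx + Const (- (1 / l)) * R) (Var Vy) (Var Vz)"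
  have canc: "Const l * (Const (1 / l) * p) = p" "Const (1 / l) * (Const l * p) = p"
    "Const (- (1 / l)) * p = - (Const (1 / l) * p)" for p :: "(var3, 'k) mpol"
    using *(2) by (simp_all add: mult.assoc[symmetric] Const_mult[symmetric]) (simp_all add: Const_uminus)
  have "\<phi> \<circ>\<^sub>e \<psi> = Var" "\<psi> \<circ>\<^sub>e \<phi> = Var"
    by (rule endo_var3_eqI;
        simp add: endo_comp_apply \<phi>_def \<psi>_def R_fixed distrib_left right_diff_distrib canc)+
  moreover have "graded (Gamma a b c) \<phi>"
    unfolding graded_Gamma_iff
  proof
    fix v
    let ?w = "case_var3 (int a) (int b) (- int c)"
    have V: "Var u \<in> hom_comp (Gamma a b c) (?w u)" for u
      by (simp add: hom_comp_def Gamma_def Var_def)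
    have "Const (coeff f j) * (Var Vy ^ j * Var Vz ^ N j) \<in> hom_comp (Gamma a b c) (int a)" for j
    proof (cases "coeff f j = 0")
      case False
      have "Var Vy ^ j * Var Vz ^ N j = term1 (mono1 Vy j + mono1 Vz (N j)) (1 :: 'k)"
        by (simp add: Var_power mult_single)
      then show ?thesis using N[OF False] by (simp add: Const_mult_term1 hom_comp_def Gamma_def algebra_simps)
    qed simp
    then have "R \<in> hom_comp (Gamma a b c) (int a)" unfolding R_def by (rule hom_comp_sum)
    then show "\<phi> v \<in> hom_comp (Gamma a b c) (?w v)"
      using V[of Vx] V[of Vy] V[of Vz] unfolding \<phi>_def
      by (cases v) (auto intro!: hom_comp_add hom_comp_Const_mult)
  qed
  ultimately have "\<phi> \<in> E_set a b c" by (simp add: E_set_def graded_AutI) (simp add: \<phi>_def)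
  moreover have "alpha \<phi> = \<theta>"
    unfolding *(1)
    by (rule endo_var2_eqI) (simp_all add: alpha_simps \<phi>_def R_def lower_def upoly_eq_sum[of f "degree f"])
  ultimately show ?thesis using that by blast
qed

subsection \<open>Rescaling the third variable\<close>

lemma T_set_graded:
  fixes l :: "'k::field"
  assumes "l \<noteq> 0"
  defines "t \<equiv> \<lambda>l :: 'k. case_var3 (Var Vx) (Var Vy) (Const l * Var Vz)"
  shows "t l \<in> carrier (graded_Aut (Gamma a b c))" "t l \<circ>\<^sub>e t (1 / l) = Var"
proof -
  have inv: "t l \<circ>\<^sub>e t (1 / l) = Var" "t (1 / l) \<circ>\<^sub>e t l = Var"
    using assms(1) by (rule_tac [!] endo_var3_eqI)
      (simp_all add: t_def endo_comp_apply mult.assoc[symmetric] Const_mult[symmetric])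
  have "graded (Gamma a b c) (t l)"
    unfolding graded_Gamma_iff
  proof
    fix v
    show "t l v \<in> hom_comp (Gamma a b c) (case_var3 (int a) (int b) (- int c) v)"
      by (cases v) (auto simp: t_def hom_comp_def Gamma_def Var_def Const_mult_term1 split: if_splits)
  qed
  then show "t l \<in> carrier (graded_Aut (Gamma a b c))" by (rule graded_AutI[OF _ inv])
  show "t l \<circ>\<^sub>e t (1 / l) = Var" by (rule inv(1))
qed

section \<open>Generators\<close>

theorem theorem3p8:
  fixes a b c :: nat
    and s :: "(var2, 'k::{alg_closed_field, field_char_0}) endo \<Rightarrow> (var2, 'k) endo \<Rightarrow> (var2, 'k) endo"
  assumes "a > 0" and "b > 0" and "c > 0"
    and "gcd a (gcd b c) = 1"
    and "\<exists>\<phi> :: (var3, 'k) endo. graded_wild (Gamma a b c) \<phi>"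
    and "a > b"
    and "\<forall>\<tau>\<in>W_set a b c. \<forall>\<theta>\<in>D_set a b c.
           s \<tau> \<theta> \<in> W_set a b c \<and>
           s \<tau> \<theta> \<circ>\<^sub>e inv\<^bsub>poly_Aut\<^esub> \<tau> \<circ>\<^sub>e \<theta> \<circ>\<^sub>e \<tau> \<in> alpha ` E_set a b c"
  shows "generate (graded_Aut (Gamma a b c))
           ({\<phi> \<in> E_set a b c. alpha \<phi> \<in> U_set a b c} \<union>
            {\<phi> \<in> E_set a b c. \<exists>\<tau>\<in>W_set a b c. \<exists>\<theta>\<in>D_set a b c.
               alpha \<phi> = (s \<tau> \<theta> \<circ>\<^sub>e inv\<^bsub>poly_Aut\<^esub> \<tau>) \<circ>\<^sub>e \<theta> \<circ>\<^sub>e \<tau>} \<union>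
            T_set)
         = carrier (graded_Aut (Gamma a b c))"
proof -
  let ?G = "graded_Aut (Gamma a b c) :: (var3, 'k) endo monoid"
  define S :: "(var3, 'k) endo set" where "S = {\<phi> \<in> E_set a b c. alpha \<phi> \<in> U_set a b c} \<union>
            {\<phi> \<in> E_set a b c. \<exists>\<tau>\<in>W_set a b c. \<exists>\<theta>\<in>D_set a b c.
               alpha \<phi> = (s \<tau> \<theta> \<circ>\<^sub>e inv\<^bsub>poly_Aut\<^esub> \<tau>) \<circ>\<^sub>e \<theta> \<circ>\<^sub>e \<tau>} \<union> T_set"
  interpret G: group ?G by (rule group_graded_Aut)
  have S_carrier: "S \<subseteq> carrier ?G"
    unfolding S_def T_set_def using E_setD(1) T_set_graded(1) by blast
  define H where "H = generate ?G S"
  have H_S: "\<phi> \<in> H" if "\<phi> \<in> S" for \<phi> unfolding H_def using that by (rule generate.incl)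
  have H_comp: "\<phi> \<circ>\<^sub>e \<psi> \<in> H" if "\<phi> \<in> H" "\<psi> \<in> H" for \<phi> \<psi>
    using generate.eng[OF that[unfolded H_def]] by (simp add: H_def)
  have H_one: "Var \<in> H" using generate.one[of ?G S] by (simp add: H_def)
  \<comment> \<open>the automorphisms of the form \<open>\<tau> \<circ> \<alpha>(h)\<close> are stable under left multiplication by \<open>D\<close>, \<open>U\<close>, \<open>W\<close>\<close>
  define M where "M = {\<tau> \<circ>\<^sub>e alpha h | \<tau> h. \<tau> \<in> W_set a b c \<and> h \<in> H \<and> h \<in> E_set a b c}"
  define P where "P \<theta> \<longleftrightarrow> (\<forall>\<mu>\<in>M. \<theta> \<circ>\<^sub>e \<mu> \<in> M)" for \<theta>
  have absorb: "\<tau> \<circ>\<^sub>e alpha \<phi> \<circ>\<^sub>e alpha h \<in> M"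
    if "\<tau> \<in> W_set a b c" "\<phi> \<in> S" "\<phi> \<in> E_set a b c" "h \<in> H" "h \<in> E_set a b c" for \<tau> \<phi> h
  proof -
    have "\<tau> \<circ>\<^sub>e alpha \<phi> \<circ>\<^sub>e alpha h = \<tau> \<circ>\<^sub>e alpha (\<phi> \<circ>\<^sub>e h)"
      using alpha_comp[of h \<phi>, OF E_setD(2)[OF that(5)]] by (simp add: endo_comp_assoc)
    moreover have "\<phi> \<circ>\<^sub>e h \<in> H" "\<phi> \<circ>\<^sub>e h \<in> E_set a b c" using H_comp H_S E_set_comp that by blast+
    ultimately show ?thesis unfolding M_def using that(1) by blast
  qed
  have P_comp: "P (\<theta> \<circ>\<^sub>e \<theta>')" if "P \<theta>" "P \<theta>'" for \<theta> \<theta>'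
    using that by (simp add: P_def endo_comp_assoc)
  have P_W: "P \<theta>" if "\<theta> \<in> W_set a b c" for \<theta>
    unfolding P_def
  proof
    fix \<mu> assume "\<mu> \<in> M"
    then obtain \<tau> h where \<mu>: "\<mu> = \<tau> \<circ>\<^sub>e alpha h" "\<tau> \<in> W_set a b c" "h \<in> H" "h \<in> E_set a b c"
      by (auto simp: M_def)
    then have "\<theta> \<circ>\<^sub>e \<mu> = (\<theta> \<circ>\<^sub>e \<tau>) \<circ>\<^sub>e alpha h" by (simp add: endo_comp_assoc)
    moreover have "\<theta> \<circ>\<^sub>e \<tau> \<in> W_set a b c" using W_set_comp that \<mu>(2) by blast
    ultimately show "\<theta> \<circ>\<^sub>e \<mu> \<in> M" unfolding M_def using \<mu> by blast
  qed
  have P_U: "P \<theta>" if "\<theta> \<in> U_set a b c" for \<theta>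
    unfolding P_def
  proof
    fix \<mu> assume "\<mu> \<in> M"
    then obtain \<tau> h where \<mu>: "\<mu> = \<tau> \<circ>\<^sub>e alpha h" "\<tau> \<in> W_set a b c" "h \<in> H" "h \<in> E_set a b c"
      by (auto simp: M_def)
    obtain l f where \<theta>: "\<theta> = lower l f" "l \<noteq> 0" "hom_poly a b c f"
        "\<forall>j. coeff f j \<noteq> 0 \<longrightarrow> real j \<ge> real a / real b"
      using \<open>\<theta> \<in> U_set a b c\<close> unfolding U_set_lower by blast
    obtain m g where \<tau>: "\<tau> = lower m g" "m \<noteq> 0" "hom_poly a b c g"
        "\<forall>j. coeff g j \<noteq> 0 \<longrightarrow> j > 1 \<and> real j < real a / real b"
      using \<mu>(2) unfolding W_set_lower by blast
    \<comment> \<open>exchange the two triangular maps: \<open>(l u + f, v) \<circ> (m u + g, v) = (m u + l g, v) \<circ> (l u + f / m, v)\<close>\<close>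
    have W: "lower m (smult l g) \<in> W_set a b c"
      unfolding W_set_lower using \<tau> hom_poly_smult
      by (intro exI[of _ m] exI[of _ "smult l g"]) simp
    have "lower l (smult (1 / m) f) \<in> U_set a b c"
      unfolding U_set_lower using \<theta> hom_poly_smult
      by (intro exI[of _ l] exI[of _ "smult (1 / m) f"]) simp
    then obtain \<phi> where \<phi>: "\<phi> \<in> E_set a b c" "alpha \<phi> = lower l (smult (1 / m) f)"
      and "\<phi> \<in> S" unfolding S_def using U_set_lift[OF _ assms(2,3)] by (metis (mono_tags, lifting) UnI1 mem_Collect_eq)
    have "\<theta> \<circ>\<^sub>e \<tau> = lower m (smult l g) \<circ>\<^sub>e alpha \<phi>"
      using \<tau>(2) by (simp add: \<theta>(1) \<tau>(1) \<phi>(2) lower_comp mult.commute add.commute)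
    then have "\<theta> \<circ>\<^sub>e \<mu> = lower m (smult l g) \<circ>\<^sub>e alpha \<phi> \<circ>\<^sub>e alpha h"
      by (simp add: \<mu>(1) endo_comp_assoc[symmetric])
    then show "\<theta> \<circ>\<^sub>e \<mu> \<in> M" using absorb[OF W \<open>\<phi> \<in> S\<close> \<phi>(1) \<mu>(3,4)] by simp
  qed
  have P_D: "P \<theta>" if "\<theta> \<in> D_set a b c" for \<theta>
    unfolding P_def
  proof
    fix \<mu> assume "\<mu> \<in> M"
    then obtain \<tau> h where \<mu>: "\<mu> = \<tau> \<circ>\<^sub>e alpha h" "\<tau> \<in> W_set a b c" "h \<in> H" "h \<in> E_set a b c"
      by (auto simp: M_def)
    have s: "s \<tau> \<theta> \<in> W_set a b c" using assms(7) \<mu>(2) that by blast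
    have "s \<tau> \<theta> \<circ>\<^sub>e inv\<^bsub>poly_Aut\<^esub> \<tau> \<circ>\<^sub>e \<theta> \<circ>\<^sub>e \<tau> \<in> alpha ` E_set a b c"
      using assms(7) \<mu>(2) that by blast
    then obtain \<phi> where \<phi>: "\<phi> \<in> E_set a b c"
      "alpha \<phi> = s \<tau> \<theta> \<circ>\<^sub>e inv\<^bsub>poly_Aut\<^esub> \<tau> \<circ>\<^sub>e \<theta> \<circ>\<^sub>e \<tau>"
      by (rule imageE) (rule that, assumption, rule sym)
    then have "\<phi> \<in> S" unfolding S_def using \<mu>(2) that by blast
    obtain s' where s': "s' \<in> W_set a b c" "s' \<circ>\<^sub>e s \<tau> \<theta> = Var" using W_set_inverse[OF s] by metis
    \<comment> \<open>\<open>\<theta> \<circ> \<tau>\<close> differs from the element \<open>\<alpha>(\<phi>)\<close> of \<open>\<alpha>(E)\<close> by a factor in \<open>W\<close>\<close>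
    have "\<tau> \<circ>\<^sub>e s' \<circ>\<^sub>e alpha \<phi> = \<tau> \<circ>\<^sub>e ((s' \<circ>\<^sub>e s \<tau> \<theta>) \<circ>\<^sub>e inv\<^bsub>poly_Aut\<^esub> \<tau>) \<circ>\<^sub>e (\<theta> \<circ>\<^sub>e \<tau>)"
      by (simp only: \<phi>(2) endo_comp_assoc)
    also have "\<dots> = \<theta> \<circ>\<^sub>e \<tau>"
      by (simp add: s'(2) inv_poly_Aut(2)[OF W_set_in_poly_Aut[OF \<mu>(2)]])
    finally have "\<theta> \<circ>\<^sub>e \<mu> = (\<tau> \<circ>\<^sub>e s') \<circ>\<^sub>e alpha \<phi> \<circ>\<^sub>e alpha h"
      by (simp add: \<mu>(1) endo_comp_assoc[symmetric])
    then show "\<theta> \<circ>\<^sub>e \<mu> \<in> M"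
      using absorb[OF W_set_comp[OF \<mu>(2) s'(1)] \<open>\<phi> \<in> S\<close> \<phi>(1) \<mu>(3,4)] by simp
  qed
  have E_H: "\<phi> \<in> H" if \<phi>: "\<phi> \<in> E_set a b c" for \<phi>
  proof -
    have "P (alpha \<phi>)"
      by (rule graded_tame_at_origin[where a = a and b = b and c = c])
        (use P_D P_U P_W P_comp alpha_in_poly_Aut[OF \<phi>] alpha_component(1)[OF \<phi>]
          alpha_origin_order[OF \<phi> assms(6,2)] in blast)+
    moreover have "Var \<in> M"
      unfolding M_def using Var_in_W_set[of a b c] H_one E_set_Var[of a b c]
      by (intro CollectI exI[of _ Var]) simp
    ultimately have "alpha \<phi> \<in> M" unfolding P_def using endo_comp_Var(1) by metis
    then obtain \<tau> h where h: "alpha \<phi> = \<tau> \<circ>\<^sub>e alpha h" "\<tau> \<in> W_set a b c" "h \<in> H" "h \<in> E_set a b c"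
      by (auto simp: M_def)
    define h' where "h' = inv\<^bsub>?G\<^esub> h"
    note h' = E_set_inverse[OF h(4), folded h'_def]
    have q_E: "\<phi> \<circ>\<^sub>e h' \<in> E_set a b c" using E_set_comp \<phi> h'(1) by blast
    have "alpha (\<phi> \<circ>\<^sub>e h') = \<tau> \<circ>\<^sub>e alpha (h \<circ>\<^sub>e h')"
      using alpha_comp[of h' \<phi>, OF E_setD(2)[OF h'(1)]] alpha_comp[of h' h, OF E_setD(2)[OF h'(1)]] h(1)
      by (simp add: endo_comp_assoc)
    then have q: "alpha (\<phi> \<circ>\<^sub>e h') = \<tau>" by (simp add: h'(2))
    \<comment> \<open>the \<open>W\<close>-factor \<open>\<tau>\<close> lies in \<open>\<alpha>(E)\<close>, so its monomials satisfy the bound that defines \<open>U\<close>\<close>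
    obtain l f where \<tau>: "\<tau> = lower l f" "l \<noteq> 0" "hom_poly a b c f"
      using h(2) unfolding W_set_lower by blast
    have "real j \<ge> real a / real b" if "coeff f j \<noteq> 0" for j
    proof -
      have "coef (\<tau> Vu) (mono1 Vv j) = coeff f j"
      proof -
        have "mono1 Vu 1 \<noteq> mono1 Vv j"
          by (metis lookup_single_eq lookup_single_not_eq var2.distinct(1) zero_neq_one)
        then have "coef (Const l * Var Vu) (mono1 Vv j) = 0"
          by (simp add: coef_Const_mult Var_def coef_term1)
        then show ?thesis by (simp add: \<tau>(1) lower_def lookup_add coef_upoly_Var)
      qed
      then have "mono1 Vv j \<in> mons (alpha (\<phi> \<circ>\<^sub>e h') Vu)" using that q by (simp add: in_keys_iff)
      from belowD[OF alpha_component(2)[OF q_E] this] have "int a \<le> int (j * b)" by simp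
      then have "real a \<le> real j * real b" by (metis of_nat_le_iff of_nat_mult)
      then show ?thesis using assms(2) by (simp add: divide_le_eq)
    qed
    then have "\<tau> \<in> U_set a b c" unfolding U_set_lower using \<tau> by blast
    then have "\<phi> \<circ>\<^sub>e h' \<in> H" using q q_E by (intro H_S) (simp add: S_def)
    then have "\<phi> \<circ>\<^sub>e h' \<circ>\<^sub>e h \<in> H" using H_comp h(3) by blast
    then show ?thesis by (simp add: endo_comp_assoc h'(3))
  qed
  have "carrier ?G \<subseteq> H"
  proof
    fix \<phi> assume \<phi>: "\<phi> \<in> carrier ?G"
    obtain l where l: "l \<noteq> 0" "\<phi> Vz = Const l * Var Vz" by (rule graded_Aut_scales_z[OF \<phi> assms(3)])
    let ?t = "\<lambda>l :: 'k. case_var3 (Var Vx) (Var Vy) (Const l * Var Vz)"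
    have l': "1 / l \<noteq> 0" using l(1) by simp
    have "?t (1 / l) \<circ>\<^sub>e \<phi> \<in> carrier ?G"
      using G.m_closed[OF T_set_graded(1)[OF l', of a b c] \<phi>] by simp
    moreover have "(?t (1 / l) \<circ>\<^sub>e \<phi>) Vz = Var Vz"
      using l by (simp add: endo_comp_apply mult.assoc[symmetric] Const_mult[symmetric])
    ultimately have "?t (1 / l) \<circ>\<^sub>e \<phi> \<in> H" using E_H by (simp add: E_set_def)
    moreover have "?t l \<in> H" using l(1) by (intro H_S) (auto simp: S_def T_set_def)
    ultimately have "?t l \<circ>\<^sub>e (?t (1 / l) \<circ>\<^sub>e \<phi>) \<in> H" by (rule H_comp[rotated])
    then show "\<phi> \<in> H" by (simp add: endo_comp_assoc[symmetric] T_set_graded(2)[OF l(1)])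
  qed
  moreover have "H \<subseteq> carrier ?G" unfolding H_def by (rule G.generate_incl[OF S_carrier])
  ultimately show ?thesis unfolding H_def S_def by blast
qed

end
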